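(* Let $G$ be a finite group and $k$ a field. Let $ik$ be an injective resolution and $tk$ a Tate resolution of the trivial $kG$-module $k$. There exists a dg algebra $\mathcal{E}nd(ik)'$ quasi-isomorphic to $\mathcal{E}nd(ik)$ and a zigzag of dg algebra morphisms $$\mathcal{E}nd(ik)\xleftarrow[\ \sim\ ]{\rho}\mathcal{E}nd(ik)'\xrightarrow{\ \varphi\ }\mathcal{E}nd(tk),$$ with $\rho$ a quasi-isomorphism, inducing the canonical inclusion $\iota\colon H^*(G,k)\to\hat H^*(G,k)$ in cohomology; that is, under the identifications $H^*\mathcal{E}nd(ik)\cong H^*(G,k)$ and $H^*\mathcal{E}nd(tk)\cong\hat H^*(G,k)$ one has $H^*\varphi=\iota\circ H^*\rho$.
   Context: $H^*(G,k)=\mathrm{Ext}^*_{kG}(k,k)$ is the group cohomology ring and $\hat H^*(G,k)$ the Tate cohomology ring, $\hat H^n(G,k)\cong\underline{\mathrm{Hom}}_{kG}(k,\Omega^{-n}k)$ for $n\in\mathbb Z$. A Tate resolution of $k$ is an exact complex of projective (=injective) $kG$-modules obtained by splicing a projective and an injective resolution of $k$. For a complex $C$ of $kG$-modules, $\mathcal{E}nd(C)$ is the endomorphism dg algebra $\coprod_{n\in\mathbb Z}\prod_{q\in\mathbb Z}\mathrm{Hom}_{kG}(C^q,C^{q+n})$ with differential $d(\phi)=d_C\circ\phi-(-1)^n\phi\circ d_C$ for $\phi$ of degree $n$; its cohomology is the graded endomorphism ring of $C$ in the homotopy category. The canonical inclusion $\iota$ identifies $H^*(G,k)$ with the subring of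 $\hat H^*(G,k)$ of elements of non-negative degree; the standing assumption for Tate cohomology in the source is that $\operatorname{char}k=p>0$ divides $|G|$. *)

theory Defs
  imports "HOL-Algebra.Module" "HOL-Algebra.AbelCoset"
begin

section \<open>Left modules over a not necessarily commutative ring\<close>

text \<open>The locale \<^locale>\<open>module\<close> of HOL-Algebra requires a commutative ring of scalars, so it does
  not apply to a group algebra. We keep its record type and its axioms, but allow any ring.\<close>

locale left_module = R?: ring R + M?: abelian_group M
  for R :: "('r, 'c) ring_scheme" (structure) and M :: "('r, 'm, 'd) module_scheme" (structure) +
  assumes smult_closed [simp, intro]:
      "\<lbrakk>a \<in> carrier R; x \<in> carrier M\<rbrakk> \<Longrightarrow> a \<odot>\<^bsub>M\<^esub> x \<in> carrier M"
    and smult_l_distr: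
      "\<lbrakk>a \<in> carrier R; b \<in> carrier R; x \<in> carrier M\<rbrakk> \<Longrightarrow>
       (a \<oplus>\<^bsub>R\<^esub> b) \<odot>\<^bsub>M\<^esub> x = a \<odot>\<^bsub>M\<^esub> x \<oplus>\<^bsub>M\<^esub> b \<odot>\<^bsub>M\<^esub> x"
    and smult_r_distr:
      "\<lbrakk>a \<in> carrier R; x \<in> carrier M; y \<in> carrier M\<rbrakk> \<Longrightarrow>
       a \<odot>\<^bsub>M\<^esub> (x \<oplus>\<^bsub>M\<^esub> y) = a \<odot>\<^bsub>M\<^esub> x \<oplus>\<^bsub>M\<^esub> a \<odot>\<^bsub>M\<^esub> y"
    and smult_assoc1:
      "\<lbrakk>a \<in> carrier R; b \<in> carrier R; x \<in> carrier M\<rbrakk> \<Longrightarrow>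
       (a \<otimes>\<^bsub>R\<^esub> b) \<odot>\<^bsub>M\<^esub> x = a \<odot>\<^bsub>M\<^esub> (b \<odot>\<^bsub>M\<^esub> x)"
    and smult_one [simp]: "x \<in> carrier M \<Longrightarrow> \<one>\<^bsub>R\<^esub> \<odot>\<^bsub>M\<^esub> x = x"

lemma (in cring) left_module_iff_module: "left_module R M \<longleftrightarrow> module R M"
  unfolding left_module_def module_def left_module_axioms_def module_axioms_def
  using cring_axioms ring_axioms by auto

definition lmod_hom ::
    "('r, 'c) ring_scheme \<Rightarrow> ('r, 'm, 'd) module_scheme \<Rightarrow> ('r, 'n, 'e) module_scheme \<Rightarrow> ('m \<Rightarrow> 'n) set"
  where "lmod_hom R M N = {f \<in> carrier M \<rightarrow> carrier N.
    (\<forall>x\<in>carrier M. \<forall>y\<in>carrier M. f (x \<oplus>\<^bsub>M\<^esub> y) = f x \<oplus>\<^bsub>N\<^esub> f y) \<and>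
    (\<forall>a\<in>carrier R. \<forall>x\<in>carrier M. f (a \<odot>\<^bsub>M\<^esub> x) = a \<odot>\<^bsub>N\<^esub> f x)}"

text \<open>HOL cannot quantify over all types, so the lifting problems below range over modules carried
  by subsets of the type \<open>'m \<Rightarrow> 'r\<close>. This is no restriction. It contains a copy of every left
  ideal of \<open>R\<close> (as constant functions), so that Baer's criterion gives injectivity against
  modules of any type; and it contains the free module on the underlying set of \<open>M\<close> (the finitely
  supported functions) and, if \<open>R\<close> is not the zero ring, a copy of \<open>M\<close>. Hence a projective \<open>M\<close> is
  a direct summand of a free module, and has the lifting property for modules of any type.\<close>

definition projective :: "('r, 'c) ring_scheme \<Rightarrow> ('r, 'm) module \<Rightarrow> bool"
  where "projective R M \<longleftrightarrow> left_module R M \<and>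
    (\<forall>(A :: ('r, 'm \<Rightarrow> 'r) module) (B :: ('r, 'm \<Rightarrow> 'r) module). \<forall>p\<in>lmod_hom R A B. \<forall>f\<in>lmod_hom R M B.
       left_module R A \<longrightarrow> left_module R B \<longrightarrow> p ` carrier A = carrier B \<longrightarrow>
       (\<exists>g\<in>lmod_hom R M A. \<forall>x\<in>carrier M. p (g x) = f x))"

definition injective :: "('r, 'c) ring_scheme \<Rightarrow> ('r, 'm) module \<Rightarrow> bool"
  where "injective R M \<longleftrightarrow> left_module R M \<and>
    (\<forall>(A :: ('r, 'm \<Rightarrow> 'r) module) (B :: ('r, 'm \<Rightarrow> 'r) module). \<forall>j\<in>lmod_hom R A B. \<forall>f\<in>lmod_hom R A M.
       left_module R A \<longrightarrow> left_module R B \<longrightarrow> inj_on j (carrier A) \<longrightarrow>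
       (\<exists>g\<in>lmod_hom R B M. \<forall>x\<in>carrier A. g (j x) = f x))"


section \<open>Cochain complexes and their cohomology\<close>

record ('r, 'm) cochain =
  obj :: "int \<Rightarrow> ('r, 'm) module"
  diff :: "int \<Rightarrow> 'm \<Rightarrow> 'm"

definition cochain_complex :: "('r, 'c) ring_scheme \<Rightarrow> ('r, 'm, 'z) cochain_scheme \<Rightarrow> bool"
  where "cochain_complex R C \<longleftrightarrow>
    (\<forall>n. left_module R (obj C n)) \<and>
    (\<forall>n. diff C n \<in> lmod_hom R (obj C n) (obj C (n + 1))) \<and>
    (\<forall>n. \<forall>x\<in>carrier (obj C n). diff C (n + 1) (diff C n x) = \<zero>\<^bsub>obj C (n + 2)\<^esub>)"

definition cocycles :: "('r, 'm, 'z) cochain_scheme \<Rightarrow> int \<Rightarrow> 'm set"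
  where "cocycles C n = {x \<in> carrier (obj C n). diff C n x = \<zero>\<^bsub>obj C (n + 1)\<^esub>}"

definition coboundaries :: "('r, 'm, 'z) cochain_scheme \<Rightarrow> int \<Rightarrow> 'm set"
  where "coboundaries C n = diff C (n - 1) ` carrier (obj C (n - 1))"

definition cohomology :: "('r, 'm, 'z) cochain_scheme \<Rightarrow> int \<Rightarrow> 'm set set"
  where "cohomology C n = (\<lambda>z. coboundaries C n +>\<^bsub>obj C n\<^esub> z) ` cocycles C n"

definition chain_map ::
    "('r, 'c) ring_scheme \<Rightarrow> ('r, 'm, 'z) cochain_scheme \<Rightarrow> ('r, 'n, 'y) cochain_scheme \<Rightarrow> (int \<Rightarrow> 'm \<Rightarrow> 'n) \<Rightarrow> bool"
  where "chain_map R C D f \<longleftrightarrow>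
    (\<forall>n. f n \<in> lmod_hom R (obj C n) (obj D n)) \<and>
    (\<forall>n. \<forall>x\<in>carrier (obj C n). f (n + 1) (diff C n x) = diff D n (f n x))"

text \<open>If \<open>S\<close> is the class of \<open>z\<close>, then \<open>f n ` S\<close> is the set of all \<open>f n z + f n b\<close> with \<open>b\<close> a
  coboundary, and adding all coboundaries of \<open>D\<close> turns it into the class of \<open>f n z\<close>.\<close>

definition cohomology_map :: "('r, 'n, 'y) cochain_scheme \<Rightarrow> (int \<Rightarrow> 'm \<Rightarrow> 'n) \<Rightarrow> int \<Rightarrow> 'm set \<Rightarrow> 'n set"
  where "cohomology_map D f n S = set_add (obj D n) (coboundaries D n) (f n ` S)"

definition quasi_iso ::
    "('r, 'm, 'z) cochain_scheme \<Rightarrow> ('r, 'n, 'y) cochain_scheme \<Rightarrow> (int \<Rightarrow> 'm \<Rightarrow> 'n) \<Rightarrow> bool"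
  where "quasi_iso C D f \<longleftrightarrow> (\<forall>n. bij_betw (cohomology_map D f n) (cohomology C n) (cohomology D n))"


section \<open>Resolutions\<close>

definition injective_resolution ::
    "('r, 'c) ring_scheme \<Rightarrow> ('r, 'a) module \<Rightarrow> ('r, 'm) cochain \<Rightarrow> ('a \<Rightarrow> 'm) \<Rightarrow> bool"
  where "injective_resolution R M I \<eta> \<longleftrightarrow>
    cochain_complex R I \<and> (\<forall>n. injective R (obj I n)) \<and>
    (\<forall>n<0. carrier (obj I n) = {\<zero>\<^bsub>obj I n\<^esub>}) \<and>
    \<eta> \<in> lmod_hom R M (obj I 0) \<and> inj_on \<eta> (carrier M) \<and> \<eta> ` carrier M = cocycles I 0 \<and>
    (\<forall>n>0. cocycles I n = coboundaries I n)"

text \<open>Cohomological indexing: the projective modules sit in degrees \<open>\<le> 0\<close>.\<close>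

definition projective_resolution ::
    "('r, 'c) ring_scheme \<Rightarrow> ('r, 'a) module \<Rightarrow> ('r, 'm) cochain \<Rightarrow> ('m \<Rightarrow> 'a) \<Rightarrow> bool"
  where "projective_resolution R M P \<epsilon> \<longleftrightarrow>
    cochain_complex R P \<and> (\<forall>n. projective R (obj P n)) \<and>
    (\<forall>n>0. carrier (obj P n) = {\<zero>\<^bsub>obj P n\<^esub>}) \<and>
    \<epsilon> \<in> lmod_hom R (obj P 0) M \<and> \<epsilon> ` carrier (obj P 0) = carrier M \<and>
    {x \<in> carrier (obj P 0). \<epsilon> x = \<zero>\<^bsub>M\<^esub>} = coboundaries P 0 \<and>
    (\<forall>n<0. cocycles P n = coboundaries P n)"

text \<open>The complex \<open>\<cdots> \<rightarrow> P\<^sup>-\<^sup>1 \<rightarrow> P\<^sup>0 \<rightarrow> J\<^sup>0 \<rightarrow> J\<^sup>1 \<rightarrow> \<cdots>\<close> with \<open>J\<^sup>0\<close> in degree \<open>0\<close> and middle map \<open>\<eta> \<circ> \<epsilon>\<close>.\<close>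

definition splice ::
    "('r, 'm) cochain \<Rightarrow> ('m \<Rightarrow> 'a) \<Rightarrow> ('r, 'm) cochain \<Rightarrow> ('a \<Rightarrow> 'm) \<Rightarrow> ('r, 'm) cochain"
  where "splice P \<epsilon> J \<eta> =
    \<lparr>obj = (\<lambda>n. if n \<ge> 0 then obj J n else obj P (n + 1)),
     diff = (\<lambda>n. if n \<ge> 0 then diff J n else if n = -1 then \<eta> \<circ> \<epsilon> else diff P (n + 1))\<rparr>"

text \<open>Over a group algebra of a finite group, projective and injective modules coincide; both are
  listed so that the definition does not depend on this. Exactness follows from the splicing. The
  map \<open>\<eta>\<close> identifies \<open>M\<close> with the kernel of the differential in degree \<open>0\<close>.\<close>

definition tate_resolution ::
    "('r, 'c) ring_scheme \<Rightarrow> ('r, 'a) module \<Rightarrow> ('r, 'm) cochain \<Rightarrow> ('a \<Rightarrow> 'm) \<Rightarrow> bool"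
  where "tate_resolution R M T \<eta> \<longleftrightarrow>
    (\<forall>n. projective R (obj T n) \<and> injective R (obj T n)) \<and>
    (\<exists>P \<epsilon> J. projective_resolution R M P \<epsilon> \<and> injective_resolution R M J \<eta> \<and> T = splice P \<epsilon> J \<eta>)"


section \<open>The group algebra and its modules of homomorphisms\<close>

definition group_algebra :: "('k, 'c) ring_scheme \<Rightarrow> ('g, 'b) monoid_scheme \<Rightarrow> ('g \<Rightarrow> 'k) ring"
  where "group_algebra K G =
    \<lparr>carrier = carrier G \<rightarrow>\<^sub>E carrier K,
     mult = (\<lambda>a b. \<lambda>g\<in>carrier G. \<Oplus>\<^bsub>K\<^esub>h\<in>carrier G. a h \<otimes>\<^bsub>K\<^esub> b (inv\<^bsub>G\<^esub> h \<otimes>\<^bsub>G\<^esub> g)),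
     one = (\<lambda>g\<in>carrier G. if g = \<one>\<^bsub>G\<^esub> then \<one>\<^bsub>K\<^esub> else \<zero>\<^bsub>K\<^esub>),
     zero = (\<lambda>g\<in>carrier G. \<zero>\<^bsub>K\<^esub>),
     add = (\<lambda>a b. \<lambda>g\<in>carrier G. a g \<oplus>\<^bsub>K\<^esub> b g)\<rparr>"

definition scalar :: "('k, 'c) ring_scheme \<Rightarrow> ('g, 'b) monoid_scheme \<Rightarrow> 'k \<Rightarrow> ('g \<Rightarrow> 'k)"
  where "scalar K G c = (\<lambda>g\<in>carrier G. if g = \<one>\<^bsub>G\<^esub> then c else \<zero>\<^bsub>K\<^esub>)"

text \<open>The group algebra acts on \<open>K\<close> through the augmentation. The ring multiplication and unit that
  a \<^typ>\<open>('a, 'b) module\<close> record inherits play no role here or below.\<close>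

definition trivial_module ::
    "('k, 'c) ring_scheme \<Rightarrow> ('g, 'b) monoid_scheme \<Rightarrow> ('g \<Rightarrow> 'k, 'k) module"
  where "trivial_module K G =
    \<lparr>carrier = carrier K, mult = mult K, one = one K, zero = zero K, add = add K,
     smult = (\<lambda>a x. (\<Oplus>\<^bsub>K\<^esub>g\<in>carrier G. a g) \<otimes>\<^bsub>K\<^esub> x)\<rparr>"

lemma (in abelian_monoid) finsum_swap:
  assumes "finite A" "finite B" "\<And>x y. x \<in> A \<Longrightarrow> y \<in> B \<Longrightarrow> f x y \<in> carrier G"
  shows "(\<Oplus>x\<in>A. \<Oplus>y\<in>B. f x y) = (\<Oplus>y\<in>B. \<Oplus>x\<in>A. f x y)"
  using assms(1) assms(3)
proof (induction A rule: finite_induct)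
  case empty
  then show ?case by (simp add: finsum_zero)
next
  case (insert a A)
  have "(\<Oplus>x\<in>insert a A. \<Oplus>y\<in>B. f x y) = (\<Oplus>y\<in>B. f a y) \<oplus> (\<Oplus>x\<in>A. \<Oplus>y\<in>B. f x y)"
    using insert by (intro finsum_insert) (auto intro!: finsum_closed)
  also have "\<dots> = (\<Oplus>y\<in>B. f a y) \<oplus> (\<Oplus>y\<in>B. \<Oplus>x\<in>A. f x y)"
    using insert by simp
  also have "\<dots> = (\<Oplus>y\<in>B. f a y \<oplus> (\<Oplus>x\<in>A. f x y))"
    using insert by (intro finsum_addf[symmetric]) (auto intro!: finsum_closed)
  also have "\<dots> = (\<Oplus>y\<in>B. \<Oplus>x\<in>insert a A. f x y)"
    using insert by (intro finsum_cong') (auto intro!: finsum_closed finsum_insert[symmetric])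
  finally show ?case .
qed

lemma (in abelian_monoid) finsum_translate:
  assumes "group H" "h \<in> carrier H" "\<And>g. g \<in> carrier H \<Longrightarrow> f g \<in> carrier G"
  shows "(\<Oplus>g\<in>carrier H. f (h \<otimes>\<^bsub>H\<^esub> g)) = (\<Oplus>g\<in>carrier H. f g)"
proof -
  interpret H: group H by fact
  have im: "(\<lambda>g. h \<otimes>\<^bsub>H\<^esub> g) ` carrier H = carrier H"
    using H.surj_const_mult assms(2) by auto
  have inj: "inj_on (\<lambda>g. h \<otimes>\<^bsub>H\<^esub> g) (carrier H)"
    using assms(2) by (auto simp: inj_on_def)
  have "(\<Oplus>g\<in>(\<lambda>g. h \<otimes>\<^bsub>H\<^esub> g) ` carrier H. f g) = (\<Oplus>g\<in>carrier H. f (h \<otimes>\<^bsub>H\<^esub> g))"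
    by (rule finsum_reindex[OF _ inj]) (use assms in auto)
  then show ?thesis by (simp add: im)
qed

lemma ring_group_algebra:
  assumes "group G" "finite (carrier G)" "field K"
  shows "ring (group_algebra K G)"
proof -
  interpret G: group G by fact
  interpret K: field K by fact
  note fin = assms(2)
  let ?A = "group_algebra K G"
  have cl: "a g \<in> carrier K" if "a \<in> carrier ?A" "g \<in> carrier G" for a g
    using that by (auto simp: group_algebra_def)
  have eqI: "a = b" if "a \<in> carrier ?A" "b \<in> carrier ?A" "\<And>g. g \<in> carrier G \<Longrightarrow> a g = b g" for a b
    using that by (intro PiE_ext[of a "carrier G" "\<lambda>_. carrier K"]) (auto simp: group_algebra_def)
  have mult: "(a \<otimes>\<^bsub>?A\<^esub> b) g = (\<Oplus>\<^bsub>K\<^esub>h\<in>carrier G. a h \<otimes>\<^bsub>K\<^esub> b (inv\<^bsub>G\<^esub> h \<otimes>\<^bsub>G\<^esub> g))" if "g \<in> carrier G" for a b g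
    using that by (simp add: group_algebra_def)
  have add: "(a \<oplus>\<^bsub>?A\<^esub> b) g = a g \<oplus>\<^bsub>K\<^esub> b g" if "g \<in> carrier G" for a b g
    using that by (simp add: group_algebra_def)
  have one: "\<one>\<^bsub>?A\<^esub> g = (if g = \<one>\<^bsub>G\<^esub> then \<one>\<^bsub>K\<^esub> else \<zero>\<^bsub>K\<^esub>)" if "g \<in> carrier G" for g
    using that by (simp add: group_algebra_def)
  have zero: "\<zero>\<^bsub>?A\<^esub> g = \<zero>\<^bsub>K\<^esub>" if "g \<in> carrier G" for g
    using that by (simp add: group_algebra_def)
  have mcl: "a \<otimes>\<^bsub>?A\<^esub> b \<in> carrier ?A" if "a \<in> carrier ?A" "b \<in> carrier ?A" for a b
    using that cl by (auto simp: group_algebra_def intro!: K.finsum_closed) 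
  have acl: "a \<oplus>\<^bsub>?A\<^esub> b \<in> carrier ?A" if "a \<in> carrier ?A" "b \<in> carrier ?A" for a b
    using that cl by (auto simp: group_algebra_def) 
  have ocl: "\<one>\<^bsub>?A\<^esub> \<in> carrier ?A" "\<zero>\<^bsub>?A\<^esub> \<in> carrier ?A"
    by (auto simp: group_algebra_def)
  have delta: "(\<Oplus>\<^bsub>K\<^esub>h\<in>carrier G. if h = x then f h else \<zero>\<^bsub>K\<^esub>) = f x"
    if "x \<in> carrier G" "f \<in> carrier G \<rightarrow> carrier K" for x f
    using K.finsum_singleton[OF that(1) fin that(2)] by (simp add: eq_commute cong: if_cong)
  have ag: "abelian_group ?A"
  proof (rule abelian_groupI)
    fix a assume a: "a \<in> carrier ?A"
    let ?b = "\<lambda>g\<in>carrier G. \<ominus>\<^bsub>K\<^esub> a g"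
    have b: "?b \<in> carrier ?A" using cl[OF a] by (auto simp: group_algebra_def)
    show "\<exists>b\<in>carrier ?A. b \<oplus>\<^bsub>?A\<^esub> a = \<zero>\<^bsub>?A\<^esub>"
      by (rule bexI[OF _ b], rule eqI) (use a b in \<open>auto simp: acl ocl add zero cl K.l_neg\<close>)
  qed (auto intro!: eqI simp: acl ocl add zero cl K.a_ac)
  have mon: "monoid ?A"
  proof (rule monoidI)
    fix a b c assume a: "a \<in> carrier ?A" and b: "b \<in> carrier ?A" and c: "c \<in> carrier ?A"
    note cl3 = cl[OF a] cl[OF b] cl[OF c]
    show "(a \<otimes>\<^bsub>?A\<^esub> b) \<otimes>\<^bsub>?A\<^esub> c = a \<otimes>\<^bsub>?A\<^esub> (b \<otimes>\<^bsub>?A\<^esub> c)"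
    proof (rule eqI)
      fix g assume g: "g \<in> carrier G"
      let ?t = "\<lambda>h x. a x \<otimes>\<^bsub>K\<^esub> (b (inv\<^bsub>G\<^esub> x \<otimes>\<^bsub>G\<^esub> h) \<otimes>\<^bsub>K\<^esub> c (inv\<^bsub>G\<^esub> h \<otimes>\<^bsub>G\<^esub> g))"
      have "((a \<otimes>\<^bsub>?A\<^esub> b) \<otimes>\<^bsub>?A\<^esub> c) g = (\<Oplus>\<^bsub>K\<^esub>h\<in>carrier G. \<Oplus>\<^bsub>K\<^esub>x\<in>carrier G. ?t h x)"
        unfolding mult[OF g]
        by (intro K.finsum_cong') (use g cl3 in \<open>auto simp: mult K.finsum_ldistr[OF fin] K.m_assoc Pi_def
            intro!: K.finsum_closed K.finsum_cong'\<close>)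
      also have "\<dots> = (\<Oplus>\<^bsub>K\<^esub>x\<in>carrier G. \<Oplus>\<^bsub>K\<^esub>h\<in>carrier G. ?t h x)"
        by (rule K.finsum_swap[OF fin fin]) (use g cl3 in auto)
      also have "\<dots> = (\<Oplus>\<^bsub>K\<^esub>x\<in>carrier G. \<Oplus>\<^bsub>K\<^esub>h\<in>carrier G. ?t (x \<otimes>\<^bsub>G\<^esub> h) x)"
        by (intro K.finsum_cong' K.finsum_translate[OF assms(1), symmetric])
           (use g cl3 in \<open>auto intro!: K.finsum_closed\<close>)
      also have "\<dots> = (\<Oplus>\<^bsub>K\<^esub>x\<in>carrier G. \<Oplus>\<^bsub>K\<^esub>h\<in>carrier G.
          a x \<otimes>\<^bsub>K\<^esub> (b h \<otimes>\<^bsub>K\<^esub> c (inv\<^bsub>G\<^esub> h \<otimes>\<^bsub>G\<^esub> (inv\<^bsub>G\<^esub> x \<otimes>\<^bsub>G\<^esub> g))))"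
        by (intro K.finsum_cong')
           (use g cl3 in \<open>auto simp: G.m_assoc[symmetric] G.inv_mult_group intro!: K.finsum_closed\<close>)
      also have "\<dots> = (a \<otimes>\<^bsub>?A\<^esub> (b \<otimes>\<^bsub>?A\<^esub> c)) g"
        unfolding mult[OF g]
        by (intro K.finsum_cong') (use g cl3 in \<open>auto simp: mult K.finsum_rdistr[OF fin] Pi_def
            intro!: K.finsum_closed\<close>)
      finally show "((a \<otimes>\<^bsub>?A\<^esub> b) \<otimes>\<^bsub>?A\<^esub> c) g = (a \<otimes>\<^bsub>?A\<^esub> (b \<otimes>\<^bsub>?A\<^esub> c)) g" .
    qed (use a b c mcl in auto)
  next
    fix a assume a: "a \<in> carrier ?A"
    note cla = cl[OF a]
    show "\<one>\<^bsub>?A\<^esub> \<otimes>\<^bsub>?A\<^esub> a = a"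
    proof (rule eqI)
      fix g assume g: "g \<in> carrier G"
      have "(\<one>\<^bsub>?A\<^esub> \<otimes>\<^bsub>?A\<^esub> a) g = (\<Oplus>\<^bsub>K\<^esub>h\<in>carrier G. if h = \<one>\<^bsub>G\<^esub> then a (inv\<^bsub>G\<^esub> h \<otimes>\<^bsub>G\<^esub> g) else \<zero>\<^bsub>K\<^esub>)"
        unfolding mult[OF g] by (intro K.finsum_cong') (use g cla in \<open>auto simp: one\<close>)
      also have "\<dots> = a g" using delta[of "\<one>\<^bsub>G\<^esub>" "\<lambda>h. a (inv\<^bsub>G\<^esub> h \<otimes>\<^bsub>G\<^esub> g)"] g cla by simp
      finally show "(\<one>\<^bsub>?A\<^esub> \<otimes>\<^bsub>?A\<^esub> a) g = a g" .
    qed (use a mcl ocl in auto)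
    show "a \<otimes>\<^bsub>?A\<^esub> \<one>\<^bsub>?A\<^esub> = a"
    proof (rule eqI)
      fix g assume g: "g \<in> carrier G"
      have iff: "inv\<^bsub>G\<^esub> h \<otimes>\<^bsub>G\<^esub> g = \<one>\<^bsub>G\<^esub> \<longleftrightarrow> h = g" if "h \<in> carrier G" for h
        using that g by (metis G.inv_equality G.inv_inv G.inv_closed G.l_inv)
      have "(a \<otimes>\<^bsub>?A\<^esub> \<one>\<^bsub>?A\<^esub>) g = (\<Oplus>\<^bsub>K\<^esub>h\<in>carrier G. if h = g then a h else \<zero>\<^bsub>K\<^esub>)"
        unfolding mult[OF g] by (intro K.finsum_cong') (use g cla in \<open>auto simp: one iff\<close>)
      also have "\<dots> = a g" using delta[of g a] g cla by simp
      finally show "(a \<otimes>\<^bsub>?A\<^esub> \<one>\<^bsub>?A\<^esub>) g = a g" .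
    qed (use a mcl ocl in auto)
  qed (use mcl ocl in auto)
  show ?thesis
  proof (rule ringI[OF ag mon])
    fix a b c assume a: "a \<in> carrier ?A" and b: "b \<in> carrier ?A" and c: "c \<in> carrier ?A"
    note cl3 = cl[OF a] cl[OF b] cl[OF c]
    show "(a \<oplus>\<^bsub>?A\<^esub> b) \<otimes>\<^bsub>?A\<^esub> c = a \<otimes>\<^bsub>?A\<^esub> c \<oplus>\<^bsub>?A\<^esub> b \<otimes>\<^bsub>?A\<^esub> c"
    proof (rule eqI)
      fix g assume g: "g \<in> carrier G"
      show "((a \<oplus>\<^bsub>?A\<^esub> b) \<otimes>\<^bsub>?A\<^esub> c) g = (a \<otimes>\<^bsub>?A\<^esub> c \<oplus>\<^bsub>?A\<^esub> b \<otimes>\<^bsub>?A\<^esub> c) g"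
        unfolding add[OF g] mult[OF g]
        by (rule trans[OF K.finsum_cong'[OF refl] K.finsum_addf]) (use g cl3 in \<open>auto simp: add K.l_distr\<close>)
    qed (use a b c mcl acl in auto)
    show "c \<otimes>\<^bsub>?A\<^esub> (a \<oplus>\<^bsub>?A\<^esub> b) = c \<otimes>\<^bsub>?A\<^esub> a \<oplus>\<^bsub>?A\<^esub> c \<otimes>\<^bsub>?A\<^esub> b"
    proof (rule eqI)
      fix g assume g: "g \<in> carrier G"
      show "(c \<otimes>\<^bsub>?A\<^esub> (a \<oplus>\<^bsub>?A\<^esub> b)) g = (c \<otimes>\<^bsub>?A\<^esub> a \<oplus>\<^bsub>?A\<^esub> c \<otimes>\<^bsub>?A\<^esub> b) g"
        unfolding add[OF g] mult[OF g]
        by (rule trans[OF K.finsum_cong'[OF refl] K.finsum_addf]) (use g cl3 in \<open>auto simp: add K.r_distr\<close>)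
    qed (use a b c mcl acl in auto)
  qed
qed

lemma left_module_trivial_module:
  assumes "group G" "finite (carrier G)" "field K"
  shows "left_module (group_algebra K G) (trivial_module K G)"
proof -
  interpret G: group G by fact
  interpret K: field K by fact
  note fin = assms(2)
  let ?A = "group_algebra K G"
  let ?e = "\<lambda>a. \<Oplus>\<^bsub>K\<^esub>g\<in>carrier G. a g"
  have cl: "a g \<in> carrier K" if "a \<in> carrier ?A" "g \<in> carrier G" for a g
    using that by (auto simp: group_algebra_def)
  have ecl: "?e a \<in> carrier K" if "a \<in> carrier ?A" for a
    using cl[OF that] by (auto intro!: K.finsum_closed)
  have eadd: "?e (a \<oplus>\<^bsub>?A\<^esub> b) = ?e a \<oplus>\<^bsub>K\<^esub> ?e b" if "a \<in> carrier ?A" "b \<in> carrier ?A" for a b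
    by (rule trans[OF K.finsum_cong'[OF refl] K.finsum_addf])
       (use cl[OF that(1)] cl[OF that(2)] in \<open>auto simp: group_algebra_def\<close>)
  have emult: "?e (a \<otimes>\<^bsub>?A\<^esub> b) = ?e a \<otimes>\<^bsub>K\<^esub> ?e b" if a: "a \<in> carrier ?A" and b: "b \<in> carrier ?A" for a b
  proof -
    note cl2 = cl[OF a] cl[OF b]
    have "?e (a \<otimes>\<^bsub>?A\<^esub> b) = (\<Oplus>\<^bsub>K\<^esub>g\<in>carrier G. \<Oplus>\<^bsub>K\<^esub>h\<in>carrier G. a h \<otimes>\<^bsub>K\<^esub> b (inv\<^bsub>G\<^esub> h \<otimes>\<^bsub>G\<^esub> g))"
      by (intro K.finsum_cong') (use cl2 in \<open>auto simp: group_algebra_def intro!: K.finsum_closed\<close>)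
    also have "\<dots> = (\<Oplus>\<^bsub>K\<^esub>h\<in>carrier G. \<Oplus>\<^bsub>K\<^esub>g\<in>carrier G. a h \<otimes>\<^bsub>K\<^esub> b (inv\<^bsub>G\<^esub> h \<otimes>\<^bsub>G\<^esub> g))"
      by (rule K.finsum_swap[OF fin fin]) (use cl2 in auto)
    also have "\<dots> = (\<Oplus>\<^bsub>K\<^esub>h\<in>carrier G. \<Oplus>\<^bsub>K\<^esub>g\<in>carrier G. a h \<otimes>\<^bsub>K\<^esub> b g)"
      by (intro K.finsum_cong' K.finsum_translate[OF assms(1), where f = "\<lambda>g. a _ \<otimes>\<^bsub>K\<^esub> b g"])
         (use cl2 in \<open>auto intro!: K.finsum_closed\<close>)
    also have "\<dots> = (\<Oplus>\<^bsub>K\<^esub>h\<in>carrier G. a h \<otimes>\<^bsub>K\<^esub> ?e b)"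
      by (intro K.finsum_cong') (use cl2 ecl[OF b] in \<open>auto simp: K.finsum_rdistr[OF fin] Pi_def\<close>)
    also have "\<dots> = ?e a \<otimes>\<^bsub>K\<^esub> ?e b"
      using cl2 ecl[OF b] by (simp add: K.finsum_ldistr[OF fin] Pi_def)
    finally show ?thesis .
  qed
  have eone: "?e \<one>\<^bsub>?A\<^esub> = \<one>\<^bsub>K\<^esub>"
  proof -
    have "?e \<one>\<^bsub>?A\<^esub> = (\<Oplus>\<^bsub>K\<^esub>g\<in>carrier G. if \<one>\<^bsub>G\<^esub> = g then \<one>\<^bsub>K\<^esub> else \<zero>\<^bsub>K\<^esub>)"
      by (intro K.finsum_cong') (auto simp: group_algebra_def)
    then show ?thesis using K.finsum_singleton[OF G.one_closed fin, of "\<lambda>_. \<one>\<^bsub>K\<^esub>"] by simp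
  qed
  have "abelian_group (trivial_module K G)"
    by (rule abelian_groupI) (auto simp: trivial_module_def K.a_ac intro: K.l_neg)
  moreover have "left_module_axioms ?A (trivial_module K G)"
    by standard (use ecl eadd emult eone in
      \<open>auto simp: trivial_module_def K.l_distr K.r_distr K.m_assoc\<close>)
  ultimately show ?thesis
    using ring_group_algebra[OF assms] by (simp add: left_module_def)
qed

text \<open>\<open>Hom\<^bsub>kG\<^esub>(M, N)\<close> as a vector space over \<open>K\<close>; homomorphisms are made extensional so that equality in
  the record is equality on the carrier.\<close>

definition hom_module ::
    "('k, 'c) ring_scheme \<Rightarrow> ('g, 'b) monoid_scheme \<Rightarrow>
     ('g \<Rightarrow> 'k, 'm) module \<Rightarrow> ('g \<Rightarrow> 'k, 'n) module \<Rightarrow> ('k, 'm \<Rightarrow> 'n) module"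
  where "hom_module K G M N =
    \<lparr>carrier = lmod_hom (group_algebra K G) M N \<inter> extensional (carrier M),
     mult = undefined, one = undefined,
     zero = (\<lambda>x\<in>carrier M. \<zero>\<^bsub>N\<^esub>),
     add = (\<lambda>f g. \<lambda>x\<in>carrier M. f x \<oplus>\<^bsub>N\<^esub> g x),
     smult = (\<lambda>c f. \<lambda>x\<in>carrier M. scalar K G c \<odot>\<^bsub>N\<^esub> f x)\<rparr>"

definition prod_module :: "(int \<Rightarrow> ('k, 'a) module) \<Rightarrow> ('k, int \<Rightarrow> 'a) module"
  where "prod_module F =
    \<lparr>carrier = {\<phi>. \<forall>q. \<phi> q \<in> carrier (F q)},
     mult = undefined, one = undefined,
     zero = (\<lambda>q. \<zero>\<^bsub>F q\<^esub>),
     add = (\<lambda>\<phi> \<psi> q. \<phi> q \<oplus>\<^bsub>F q\<^esub> \<psi> q),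
     smult = (\<lambda>c \<phi> q. c \<odot>\<^bsub>F q\<^esub> \<phi> q)\<rparr>"


section \<open>Differential graded algebras\<close>

text \<open>A graded algebra is given by its homogeneous components, and \<open>gmult A p q\<close> is the product of an
  element of degree \<open>p\<close> with one of degree \<open>q\<close>; the underlying ungraded algebra is the direct sum
  of the components.\<close>

record ('k, 'a) dga = "('k, 'a) cochain" +
  gmult :: "int \<Rightarrow> int \<Rightarrow> 'a \<Rightarrow> 'a \<Rightarrow> 'a"
  gone :: 'a

definition koszul :: "('k, 'a, 'z) module_scheme \<Rightarrow> int \<Rightarrow> 'a \<Rightarrow> 'a"
  where "koszul M n x = (if even n then x else \<ominus>\<^bsub>M\<^esub> x)"

locale dg_algebra =
  fixes K :: "('k, 'c) ring_scheme" and A :: "('k, 'a) dga"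
  assumes field: "field K"
    and complex: "cochain_complex K A"
    and gmult_left: "y \<in> carrier (obj A q) \<Longrightarrow>
      (\<lambda>x. gmult A p q x y) \<in> lmod_hom K (obj A p) (obj A (p + q))"
    and gmult_right: "x \<in> carrier (obj A p) \<Longrightarrow>
      (\<lambda>y. gmult A p q x y) \<in> lmod_hom K (obj A q) (obj A (p + q))"
    and gmult_assoc:
      "\<lbrakk>x \<in> carrier (obj A p); y \<in> carrier (obj A q); z \<in> carrier (obj A r)\<rbrakk> \<Longrightarrow>
       gmult A (p + q) r (gmult A p q x y) z = gmult A p (q + r) x (gmult A q r y z)"
    and gone_closed: "gone A \<in> carrier (obj A 0)"
    and gone_left: "x \<in> carrier (obj A p) \<Longrightarrow> gmult A 0 p (gone A) x = x"
    and gone_right: "x \<in> carrier (obj A p) \<Longrightarrow> gmult A p 0 x (gone A) = x"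
    and leibniz: "\<lbrakk>x \<in> carrier (obj A p); y \<in> carrier (obj A q)\<rbrakk> \<Longrightarrow>
      diff A (p + q) (gmult A p q x y) =
        gmult A (p + 1) q (diff A p x) y
          \<oplus>\<^bsub>obj A (p + q + 1)\<^esub> koszul (obj A (p + q + 1)) p (gmult A p (q + 1) x (diff A q y))"

locale dga_hom = A: dg_algebra K A + B: dg_algebra K B
  for K :: "('k, 'c) ring_scheme" and A :: "('k, 'a) dga" and B :: "('k, 'b) dga" +
  fixes f :: "int \<Rightarrow> 'a \<Rightarrow> 'b"
  assumes chain_map: "chain_map K A B f"
    and hom_gmult: "\<lbrakk>x \<in> carrier (obj A p); y \<in> carrier (obj A q)\<rbrakk> \<Longrightarrow>
      f (p + q) (gmult A p q x y) = gmult B p q (f p x) (f q y)"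
    and hom_gone: "f 0 (gone A) = gone B"

text \<open>The component of degree \<open>n\<close> is \<open>\<Prod>\<^sub>q Hom\<^bsub>kG\<^esub>(C\<^sup>q, C\<^bsup>q+n\<^esup>)\<close> and the product is composition, so an
  element \<open>\<phi>\<close> of degree \<open>p\<close> times \<open>\<psi>\<close> of degree \<open>q\<close> is \<open>\<phi>\<^bsup>i+q\<^esup> \<circ> \<psi>\<^sup>i\<close> on \<open>C\<^sup>i\<close>. The differential is
  \<open>d\<^sub>C \<circ> \<phi> - (-1)\<^sup>n \<phi> \<circ> d\<^sub>C\<close>.\<close>

definition End_dga ::
    "('k, 'c) ring_scheme \<Rightarrow> ('g, 'b) monoid_scheme \<Rightarrow> ('g \<Rightarrow> 'k, 'm) cochain \<Rightarrow> ('k, int \<Rightarrow> 'm \<Rightarrow> 'm) dga"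
  where "End_dga K G C =
    \<lparr>obj = (\<lambda>n. prod_module (\<lambda>q. hom_module K G (obj C q) (obj C (q + n)))),
     diff = (\<lambda>n \<phi> q. \<lambda>x\<in>carrier (obj C q).
       diff C (q + n) (\<phi> q x)
         \<ominus>\<^bsub>obj C (q + n + 1)\<^esub> koszul (obj C (q + n + 1)) n (\<phi> (q + 1) (diff C q x))),
     gmult = (\<lambda>p q \<phi> \<psi> i. compose (carrier (obj C i)) (\<phi> (i + q)) (\<psi> i)),
     gone = (\<lambda>q. \<lambda>x\<in>carrier (obj C q). x)\<rparr>"


section \<open>Group cohomology and Tate cohomology\<close>

definition hom_complex ::
    "('k, 'c) ring_scheme \<Rightarrow> ('g, 'b) monoid_scheme \<Rightarrow>
     ('g \<Rightarrow> 'k, 'a) module \<Rightarrow> ('g \<Rightarrow> 'k, 'm) cochain \<Rightarrow> ('k, 'a \<Rightarrow> 'm) cochain"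
  where "hom_complex K G M C =
    \<lparr>obj = (\<lambda>n. hom_module K G M (obj C n)),
     diff = (\<lambda>n f. compose (carrier M) (diff C n) f)\<rparr>"

text \<open>\<open>H\<^sup>n(G, k) = Ext\<^sup>n\<^bsub>kG\<^esub>(k, k)\<close>, computed from an injective resolution \<open>I\<close> of the second argument.\<close>

definition group_cohomology ::
    "('k, 'c) ring_scheme \<Rightarrow> ('g, 'b) monoid_scheme \<Rightarrow> ('g \<Rightarrow> 'k, 'm) cochain \<Rightarrow> int \<Rightarrow> ('k \<Rightarrow> 'm) set set"
  where "group_cohomology K G I n = cohomology (hom_complex K G (trivial_module K G) I) n"

text \<open>The homomorphisms that factor through a projective module. Such a map also factors through the
  free module on the underlying set of \<open>N\<close>, which lives in the type \<open>'n \<Rightarrow> 'g \<Rightarrow> 'k\<close>; hence it is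
  enough to consider projective modules carried by this type.\<close>

definition proj_homs ::
    "('k, 'c) ring_scheme \<Rightarrow> ('g, 'b) monoid_scheme \<Rightarrow>
     ('g \<Rightarrow> 'k, 'm) module \<Rightarrow> ('g \<Rightarrow> 'k, 'n) module \<Rightarrow> ('m \<Rightarrow> 'n) set"
  where "proj_homs K G M N = {f \<in> carrier (hom_module K G M N).
    \<exists>P :: ('g \<Rightarrow> 'k, 'n \<Rightarrow> 'g \<Rightarrow> 'k) module. projective (group_algebra K G) P \<and>
      (\<exists>a\<in>lmod_hom (group_algebra K G) M P. \<exists>b\<in>lmod_hom (group_algebra K G) P N.
         \<forall>x\<in>carrier M. f x = b (a x))}"

definition stable_hom ::
    "('k, 'c) ring_scheme \<Rightarrow> ('g, 'b) monoid_scheme \<Rightarrow>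
     ('g \<Rightarrow> 'k, 'm) module \<Rightarrow> ('g \<Rightarrow> 'k, 'n) module \<Rightarrow> ('m \<Rightarrow> 'n) set set"
  where "stable_hom K G M N =
    (\<lambda>f. proj_homs K G M N +>\<^bsub>hom_module K G M N\<^esub> f) ` carrier (hom_module K G M N)"

text \<open>For a Tate resolution \<open>T\<close> of \<open>k\<close>, the module of cocycles in degree \<open>n\<close> is \<open>\<Omega>\<^bsup>-n\<^esup>k\<close>: for \<open>n \<ge> 0\<close>
  it is an iterated cokernel in the injective resolution, for \<open>n < 0\<close> an iterated kernel in the
  projective one.\<close>

definition syzygy :: "('r, 'm) cochain \<Rightarrow> int \<Rightarrow> ('r, 'm) module"
  where "syzygy T n = (obj T n)\<lparr>carrier := cocycles T n\<rparr>"

definition tate_cohomology ::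
    "('k, 'c) ring_scheme \<Rightarrow> ('g, 'b) monoid_scheme \<Rightarrow> ('g \<Rightarrow> 'k, 'm) cochain \<Rightarrow> int \<Rightarrow> ('k \<Rightarrow> 'm) set set"
  where "tate_cohomology K G T n = stable_hom K G (trivial_module K G) (syzygy T n)"

definition stable_class_map ::
    "('k, 'c) ring_scheme \<Rightarrow> ('g, 'b) monoid_scheme \<Rightarrow> ('g \<Rightarrow> 'k, 'm) cochain \<Rightarrow> int \<Rightarrow>
     ('a \<Rightarrow> 'k \<Rightarrow> 'm) \<Rightarrow> 'a set \<Rightarrow> ('k \<Rightarrow> 'm) set"
  where "stable_class_map K G T n F S =
    set_add (hom_module K G (trivial_module K G) (syzygy T n))
      (proj_homs K G (trivial_module K G) (syzygy T n)) (F ` S)"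

text \<open>The identification of \<open>H\<^sup>n\<close> of the endomorphism algebra of an injective resolution with \<open>H\<^sup>n(G, k)\<close>
  is induced by \<open>\<phi> \<mapsto> \<phi>\<^sup>0 \<circ> \<eta>\<close>.\<close>

definition ident_ext ::
    "('k, 'c) ring_scheme \<Rightarrow> ('g, 'b) monoid_scheme \<Rightarrow> ('g \<Rightarrow> 'k, 'm) cochain \<Rightarrow> ('k \<Rightarrow> 'm) \<Rightarrow>
     int \<Rightarrow> (int \<Rightarrow> 'm \<Rightarrow> 'm) set \<Rightarrow> ('k \<Rightarrow> 'm) set"
  where "ident_ext K G I \<eta> =
    cohomology_map (hom_complex K G (trivial_module K G) I) (\<lambda>n \<phi>. compose (carrier K) (\<phi> 0) \<eta>)"

text \<open>The identification of \<open>H\<^sup>n\<close> of the endomorphism algebra of a Tate resolution with Tate cohomology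
  restricts a cocycle \<open>\<phi>\<close> of degree \<open>n\<close> to a map from \<open>k \<cong> Z\<^sup>0(T)\<close> to \<open>\<Omega>\<^bsup>-n\<^esup>k = Z\<^sup>n(T)\<close>.\<close>

definition ident_tate ::
    "('k, 'c) ring_scheme \<Rightarrow> ('g, 'b) monoid_scheme \<Rightarrow> ('g \<Rightarrow> 'k, 'm) cochain \<Rightarrow> ('k \<Rightarrow> 'm) \<Rightarrow>
     int \<Rightarrow> (int \<Rightarrow> 'm \<Rightarrow> 'm) set \<Rightarrow> ('k \<Rightarrow> 'm) set"
  where "ident_tate K G T \<eta> n = stable_class_map K G T n (\<lambda>\<phi>. compose (carrier K) (\<phi> 0) \<eta>)"

text \<open>The canonical map \<open>\<iota>\<close> from \<open>H\<^sup>n(G, k)\<close> to Tate cohomology sends the class of a cocycle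
  \<open>z : k \<rightarrow> Z\<^sup>n(I)\<close> to its stable class. As \<open>T\<close> need not be spliced from \<open>I\<close> itself, \<open>z\<close> is first
  transported along a comparison map \<open>I \<rightarrow> T\<close> over the identity of \<open>k\<close>. Such a map exists and is
  unique up to homotopy, so the description below determines \<open>\<iota>\<close>.\<close>

definition comparison ::
    "('r, 'c) ring_scheme \<Rightarrow> ('r, 'a) module \<Rightarrow> ('r, 'm) cochain \<Rightarrow> ('a \<Rightarrow> 'm) \<Rightarrow>
     ('r, 'n) cochain \<Rightarrow> ('a \<Rightarrow> 'n) \<Rightarrow> (int \<Rightarrow> 'm \<Rightarrow> 'n) \<Rightarrow> bool"
  where "comparison R M I \<eta> T \<theta> c \<longleftrightarrow>
    chain_map R I T c \<and> (\<forall>x\<in>carrier M. c 0 (\<eta> x) = \<theta> x)"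

definition tate_iota ::
    "('k, 'c) ring_scheme \<Rightarrow> ('g, 'b) monoid_scheme \<Rightarrow> ('g \<Rightarrow> 'k, 'm) cochain \<Rightarrow> ('k \<Rightarrow> 'm) \<Rightarrow>
     ('g \<Rightarrow> 'k, 'n) cochain \<Rightarrow> ('k \<Rightarrow> 'n) \<Rightarrow> int \<Rightarrow> ('k \<Rightarrow> 'm) set \<Rightarrow> ('k \<Rightarrow> 'n) set"
  where "tate_iota K G I \<eta> T \<theta> n = (\<lambda>S\<in>group_cohomology K G I n.
    (THE Y. Y \<in> tate_cohomology K G T n \<and>
      (\<exists>c. comparison (group_algebra K G) (trivial_module K G) I \<eta> T \<theta> c \<and>
           Y = stable_class_map K G T n (\<lambda>z. compose (carrier K) (c n) z) S)))"

end

theory Submission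
  imports Defs
begin

text \<open>The proof compares the two endomorphism algebras inside the endomorphisms of a cone. Let
  \<open>c : I \<rightarrow> T\<close> be a comparison map over the identity of \<open>k\<close>. The dg algebra of the zigzag consists of
  the triangular matrices \<open>(\<alpha>, \<beta>, \<gamma>)\<close> with \<open>\<alpha>\<close> in \<open>End(I)\<close>, \<open>\<beta>\<close> in \<open>End(T)\<close> and \<open>\<gamma>\<close> in \<open>Hom(I, T)\<close>, shifted by
  one: these are the endomorphisms of the cone of \<open>c\<close> that preserve the subcomplex \<open>T\<close>. The last
  component of the differential is \<open>\<beta> c - c \<alpha> - d \<gamma>\<close>. The morphisms \<open>\<rho>\<close> and \<open>\<phi>\<close> are the two diagonal
  projections. A cocycle therefore says that \<open>\<alpha>\<close> and \<open>\<beta>\<close> are chain maps which \<open>c\<close> intertwines up to the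
  homotopy \<open>\<gamma>\<close>.

  The kernel of \<open>\<rho>\<close> is the complex of homomorphisms from the cone of \<open>c\<close> to \<open>T\<close>, so \<open>\<rho>\<close> is a
  quasi-isomorphism as soon as that complex is acyclic (\<open>hom_from_cone_acyclic\<close>). Two null-homotopies
  prove this. The part \<open>T\<^sup>\<ge>\<^sup>0\<close> of \<open>T\<close> is an injective resolution of \<open>k\<close>, hence \<open>I \<rightarrow> T\<^sup>\<ge>\<^sup>0\<close> has an exact
  cone that is bounded below (\<open>cone_exact\<close>), and a cochain map from such a complex to the injective
  modules of \<open>T\<close> is null-homotopic, by induction from the bottom
  (\<open>null_homotopy_into_injectives\<close>). What remains is a map that lives on the projective modules of \<open>T\<close>
  in negative degrees, and it is null-homotopic by induction from the top, because \<open>T\<close> is exact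
  (\<open>null_homotopy_from_projectives\<close>). The first induction, applied to the augmented complex
  \<open>k \<rightarrow> I\<close>, also yields existence of \<open>c\<close> and its uniqueness up to homotopy
  (\<open>comparison_exists\<close>, \<open>comparison_unique\<close>).

  For the map in cohomology, evaluate \<open>\<beta> c - c \<alpha> = d \<gamma>\<close> on the image of \<open>\<eta> : k \<rightarrow> I\<^sup>0\<close>. It says that
  \<open>\<beta> \<theta>\<close> and \<open>c \<alpha> \<eta>\<close>, as maps from \<open>k\<close> to the cocycles of \<open>T\<close> in degree \<open>n\<close>, differ by a map that factors
  through the projective module \<open>T\<close> has in degree \<open>n - 1\<close>, so they have the same stable class
  (\<open>projections_induce_iota\<close>).

  Projectivity and injectivity are defined by lifting problems in one fixed type, while the
  arguments above mix modules of several types. The criterion of Baer (\<open>injective_extend\<close>) and the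
  splitting of a projective module off a free one (\<open>projective_lift\<close>) remove this dependence.\<close>

section \<open>Homomorphisms of left modules\<close>

lemma left_module_abelian_group: "left_module R M \<Longrightarrow> abelian_group M"
  by (simp add: left_module_def)

lemma left_module_ring: "left_module R M \<Longrightarrow> ring R"
  by (simp add: left_module_def)

lemma (in abelian_group) double_eq_zero:
  assumes "x \<in> carrier G" "x \<oplus> x = x" shows "x = \<zero>"
  using assms by (metis l_neg r_neg1)

lemma (in left_module) smult_r_zero [simp]:
  assumes "a \<in> carrier R" shows "a \<odot>\<^bsub>M\<^esub> \<zero>\<^bsub>M\<^esub> = \<zero>\<^bsub>M\<^esub>"
  using assms smult_r_distr[of a "\<zero>\<^bsub>M\<^esub>" "\<zero>\<^bsub>M\<^esub>"] by (intro M.double_eq_zero) auto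

lemma (in left_module) smult_l_zero [simp]:
  assumes "x \<in> carrier M" shows "\<zero>\<^bsub>R\<^esub> \<odot>\<^bsub>M\<^esub> x = \<zero>\<^bsub>M\<^esub>"
  using assms smult_l_distr[of "\<zero>\<^bsub>R\<^esub>" "\<zero>\<^bsub>R\<^esub>" x] by (intro M.double_eq_zero) auto

lemma (in left_module) smult_r_minus:
  assumes "a \<in> carrier R" "x \<in> carrier M" shows "a \<odot>\<^bsub>M\<^esub> (\<ominus>\<^bsub>M\<^esub> x) = \<ominus>\<^bsub>M\<^esub> (a \<odot>\<^bsub>M\<^esub> x)"
  by (rule M.minus_equality[symmetric])
     (use assms in \<open>simp_all add: smult_r_distr[symmetric] M.l_neg\<close>)

lemma (in left_module) smult_l_minus:
  assumes "a \<in> carrier R" "x \<in> carrier M" shows "(\<ominus>\<^bsub>R\<^esub> a) \<odot>\<^bsub>M\<^esub> x = \<ominus>\<^bsub>M\<^esub> (a \<odot>\<^bsub>M\<^esub> x)"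
  by (rule M.minus_equality[symmetric])
     (use assms in \<open>simp_all add: smult_l_distr[symmetric] R.l_neg\<close>)

lemma lmod_homI:
  assumes "\<And>x. x \<in> carrier M \<Longrightarrow> f x \<in> carrier N"
    and "\<And>x y. x \<in> carrier M \<Longrightarrow> y \<in> carrier M \<Longrightarrow> f (x \<oplus>\<^bsub>M\<^esub> y) = f x \<oplus>\<^bsub>N\<^esub> f y"
    and "\<And>a x. a \<in> carrier R \<Longrightarrow> x \<in> carrier M \<Longrightarrow> f (a \<odot>\<^bsub>M\<^esub> x) = a \<odot>\<^bsub>N\<^esub> f x"
  shows "f \<in> lmod_hom R M N"
  using assms by (auto simp: lmod_hom_def)

lemma lmod_hom_closed: "f \<in> lmod_hom R M N \<Longrightarrow> x \<in> carrier M \<Longrightarrow> f x \<in> carrier N"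
  by (auto simp: lmod_hom_def)

lemma lmod_hom_add:
  "f \<in> lmod_hom R M N \<Longrightarrow> x \<in> carrier M \<Longrightarrow> y \<in> carrier M \<Longrightarrow> f (x \<oplus>\<^bsub>M\<^esub> y) = f x \<oplus>\<^bsub>N\<^esub> f y"
  by (auto simp: lmod_hom_def)

lemma lmod_hom_smult:
  "f \<in> lmod_hom R M N \<Longrightarrow> a \<in> carrier R \<Longrightarrow> x \<in> carrier M \<Longrightarrow> f (a \<odot>\<^bsub>M\<^esub> x) = a \<odot>\<^bsub>N\<^esub> f x"
  by (auto simp: lmod_hom_def)

lemma additive_zero:
  assumes M: "abelian_group M" and N: "abelian_group N"
    and "f \<zero>\<^bsub>M\<^esub> \<in> carrier N" and "f (\<zero>\<^bsub>M\<^esub> \<oplus>\<^bsub>M\<^esub> \<zero>\<^bsub>M\<^esub>) = f \<zero>\<^bsub>M\<^esub> \<oplus>\<^bsub>N\<^esub> f \<zero>\<^bsub>M\<^esub>"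
  shows "f \<zero>\<^bsub>M\<^esub> = \<zero>\<^bsub>N\<^esub>"
proof -
  interpret M: abelian_group M by fact
  interpret N: abelian_group N by fact
  show ?thesis by (rule N.double_eq_zero) (use assms in auto)
qed

lemma lmod_hom_zero:
  assumes "f \<in> lmod_hom R M N" "left_module R M" "left_module R N"
  shows "f \<zero>\<^bsub>M\<^esub> = \<zero>\<^bsub>N\<^esub>"
proof -
  interpret M: left_module R M by fact
  show ?thesis
    by (rule additive_zero[OF left_module_abelian_group left_module_abelian_group])
       (use assms in \<open>auto simp: lmod_hom_closed lmod_hom_add simp del: M.r_zero M.l_zero\<close>)
qed

lemma lmod_hom_minus:
  assumes f: "f \<in> lmod_hom R M N" and M: "left_module R M" and N: "left_module R N"
    and x: "x \<in> carrier M"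
  shows "f (\<ominus>\<^bsub>M\<^esub> x) = \<ominus>\<^bsub>N\<^esub> f x"
proof -
  interpret M: left_module R M by fact
  interpret N: left_module R N by fact
  show ?thesis
    by (rule N.minus_equality[symmetric])
       (use f x in \<open>simp_all add: lmod_hom_closed lmod_hom_add[symmetric] M.l_neg lmod_hom_zero[OF f M N]\<close>)
qed

lemma lmod_hom_diff:
  assumes f: "f \<in> lmod_hom R M N" and M: "left_module R M" and N: "left_module R N"
    and x: "x \<in> carrier M" and y: "y \<in> carrier M"
  shows "f (x \<ominus>\<^bsub>M\<^esub> y) = f x \<ominus>\<^bsub>N\<^esub> f y"
proof -
  interpret M: left_module R M by fact
  show ?thesis using x y by (simp add: a_minus_def lmod_hom_add[OF f] lmod_hom_minus[OF f M N])
qed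

lemma lmod_hom_comp:
  "f \<in> lmod_hom R M N \<Longrightarrow> g \<in> lmod_hom R N P \<Longrightarrow> (\<lambda>x. g (f x)) \<in> lmod_hom R M P"
  by (auto simp: lmod_hom_def Pi_def)

lemma lmod_hom_cong:
  assumes "left_module R M" "f \<in> lmod_hom R M N" "\<And>x. x \<in> carrier M \<Longrightarrow> f x = g x"
  shows "g \<in> lmod_hom R M N"
proof -
  interpret M: left_module R M by fact
  have "\<And>x. x \<in> carrier M \<Longrightarrow> g x = f x" using assms by simp
  then show ?thesis using assms(2) by (auto simp: lmod_hom_def Pi_def)
qed

lemma lmod_hom_plus:
  assumes "left_module R N" and f: "f \<in> lmod_hom R M N" and g: "g \<in> lmod_hom R M N"
  shows "(\<lambda>x. f x \<oplus>\<^bsub>N\<^esub> g x) \<in> lmod_hom R M N"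
proof -
  interpret N: left_module R N by fact
  show ?thesis
    by (rule lmod_homI)
       (use f g in \<open>auto simp: lmod_hom_closed lmod_hom_add lmod_hom_smult N.a_ac N.smult_r_distr\<close>)
qed

lemma lmod_hom_uminus:
  assumes "left_module R N" and f: "f \<in> lmod_hom R M N"
  shows "(\<lambda>x. \<ominus>\<^bsub>N\<^esub> f x) \<in> lmod_hom R M N"
proof -
  interpret N: left_module R N by fact
  show ?thesis
    by (rule lmod_homI)
       (use f in \<open>auto simp: lmod_hom_closed lmod_hom_add lmod_hom_smult N.minus_add N.smult_r_minus\<close>)
qed

lemma lmod_hom_sub:
  assumes "left_module R N" and "f \<in> lmod_hom R M N" and "g \<in> lmod_hom R M N"
  shows "(\<lambda>x. f x \<ominus>\<^bsub>N\<^esub> g x) \<in> lmod_hom R M N"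
  unfolding a_minus_def by (intro lmod_hom_plus lmod_hom_uminus assms)

lemma lmod_hom_const_zero:
  assumes "left_module R N" shows "(\<lambda>x. \<zero>\<^bsub>N\<^esub>) \<in> lmod_hom R M N"
proof -
  interpret N: left_module R N by fact
  show ?thesis by (rule lmod_homI) auto
qed

lemma lmod_hom_id: "(\<lambda>x. x) \<in> lmod_hom R M M"
  by (auto simp: lmod_hom_def)

lemma left_moduleI:
  assumes "ring R" "abelian_group M"
    and "\<And>a x. a \<in> carrier R \<Longrightarrow> x \<in> carrier M \<Longrightarrow> a \<odot>\<^bsub>M\<^esub> x \<in> carrier M"
    and "\<And>a b x. a \<in> carrier R \<Longrightarrow> b \<in> carrier R \<Longrightarrow> x \<in> carrier M \<Longrightarrow>
       (a \<oplus>\<^bsub>R\<^esub> b) \<odot>\<^bsub>M\<^esub> x = a \<odot>\<^bsub>M\<^esub> x \<oplus>\<^bsub>M\<^esub> b \<odot>\<^bsub>M\<^esub> x"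
    and "\<And>a x y. a \<in> carrier R \<Longrightarrow> x \<in> carrier M \<Longrightarrow> y \<in> carrier M \<Longrightarrow>
       a \<odot>\<^bsub>M\<^esub> (x \<oplus>\<^bsub>M\<^esub> y) = a \<odot>\<^bsub>M\<^esub> x \<oplus>\<^bsub>M\<^esub> a \<odot>\<^bsub>M\<^esub> y"
    and "\<And>a b x. a \<in> carrier R \<Longrightarrow> b \<in> carrier R \<Longrightarrow> x \<in> carrier M \<Longrightarrow>
       (a \<otimes>\<^bsub>R\<^esub> b) \<odot>\<^bsub>M\<^esub> x = a \<odot>\<^bsub>M\<^esub> (b \<odot>\<^bsub>M\<^esub> x)"
    and "\<And>x. x \<in> carrier M \<Longrightarrow> \<one>\<^bsub>R\<^esub> \<odot>\<^bsub>M\<^esub> x = x"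
  shows "left_module R M"
  using assms by (simp add: left_module_def left_module_axioms_def)

lemma (in abelian_group) minus_eq_zero_iff:
  "x \<in> carrier G \<Longrightarrow> y \<in> carrier G \<Longrightarrow> x \<ominus> y = \<zero> \<longleftrightarrow> x = y"
  by (metis a_minus_def add.inv_closed minus_equality minus_minus r_neg)

definition submod :: "('r, 'c) ring_scheme \<Rightarrow> 'm set \<Rightarrow> ('r, 'm, 'd) module_scheme \<Rightarrow> bool"
  where "submod R S M \<longleftrightarrow> S \<subseteq> carrier M \<and> \<zero>\<^bsub>M\<^esub> \<in> S \<and> (\<forall>x\<in>S. \<forall>y\<in>S. x \<oplus>\<^bsub>M\<^esub> y \<in> S) \<and>
    (\<forall>a\<in>carrier R. \<forall>x\<in>S. a \<odot>\<^bsub>M\<^esub> x \<in> S)"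

lemma left_module_submod:
  assumes M: "left_module R M" and S: "submod R S M"
  shows "left_module R (M\<lparr>carrier := S\<rparr>)"
proof -
  interpret M: left_module R M by fact
  have S': "\<And>x. x \<in> S \<Longrightarrow> x \<in> carrier M" "\<zero>\<^bsub>M\<^esub> \<in> S" "\<And>x y. x \<in> S \<Longrightarrow> y \<in> S \<Longrightarrow> x \<oplus>\<^bsub>M\<^esub> y \<in> S"
    "\<And>a x. a \<in> carrier R \<Longrightarrow> x \<in> S \<Longrightarrow> a \<odot>\<^bsub>M\<^esub> x \<in> S"
    using S by (auto simp: submod_def)
  have neg: "\<ominus>\<^bsub>M\<^esub> x \<in> S" if "x \<in> S" for x
    using S'(4)[of "\<ominus>\<^bsub>R\<^esub> \<one>\<^bsub>R\<^esub>" x] that S'(1) by (simp add: M.smult_l_minus)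
  show ?thesis
  proof (rule left_moduleI)
    show "abelian_group (M\<lparr>carrier := S\<rparr>)"
    proof (rule abelian_groupI)
      fix x assume "x \<in> carrier (M\<lparr>carrier := S\<rparr>)"
      then show "\<exists>y\<in>carrier (M\<lparr>carrier := S\<rparr>). y \<oplus>\<^bsub>M\<lparr>carrier := S\<rparr>\<^esub> x = \<zero>\<^bsub>M\<lparr>carrier := S\<rparr>\<^esub>"
        using S' neg M.l_neg by (intro bexI[of _ "\<ominus>\<^bsub>M\<^esub> x"]) auto
    qed (use S' in \<open>auto simp: M.a_ac\<close>)
  qed (use S' in \<open>auto simp: M.smult_l_distr M.smult_r_distr M.smult_assoc1 M.R.ring_axioms\<close>)
qed

section \<open>Injective modules: the criterion of Baer\<close>

text \<open>Transport of structure along an injection. It moves a module into the type over which the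
  lifting problems for injective and projective modules range.\<close>

definition copy_module :: "('m \<Rightarrow> 'n) \<Rightarrow> ('r, 'm, 'd) module_scheme \<Rightarrow> ('r, 'n) module"
  where "copy_module u M = (let v = inv_into (carrier M) u in
    \<lparr>carrier = u ` carrier M, mult = undefined, one = undefined, zero = u \<zero>\<^bsub>M\<^esub>,
     add = (\<lambda>x y. u (v x \<oplus>\<^bsub>M\<^esub> v y)), smult = (\<lambda>a x. u (a \<odot>\<^bsub>M\<^esub> v x))\<rparr>)"

lemma copy_module:
  assumes M: "left_module R M" and u: "inj_on u (carrier M)"
  shows "left_module R (copy_module u M)" and "u \<in> lmod_hom R M (copy_module u M)"
    and "inv_into (carrier M) u \<in> lmod_hom R (copy_module u M) M"
    and "carrier (copy_module u M) = u ` carrier M"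
proof -
  interpret M: left_module R M by fact
  note v = inv_into_f_f[OF u]
  have simps: "carrier (copy_module u M) = u ` carrier M" "\<zero>\<^bsub>copy_module u M\<^esub> = u \<zero>\<^bsub>M\<^esub>"
    "\<And>x y. x \<in> carrier M \<Longrightarrow> y \<in> carrier M \<Longrightarrow> u x \<oplus>\<^bsub>copy_module u M\<^esub> u y = u (x \<oplus>\<^bsub>M\<^esub> y)"
    "\<And>a x. x \<in> carrier M \<Longrightarrow> a \<odot>\<^bsub>copy_module u M\<^esub> u x = u (a \<odot>\<^bsub>M\<^esub> x)"
    by (simp_all add: copy_module_def v Let_def)
  show "left_module R (copy_module u M)"
  proof (rule left_moduleI)
    show "abelian_group (copy_module u M)"
    proof (rule abelian_groupI)
      fix x assume "x \<in> carrier (copy_module u M)"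
      then obtain y where y: "y \<in> carrier M" "x = u y" by (auto simp: simps)
      show "\<exists>z\<in>carrier (copy_module u M). z \<oplus>\<^bsub>copy_module u M\<^esub> x = \<zero>\<^bsub>copy_module u M\<^esub>"
        by (rule bexI[of _ "u (\<ominus>\<^bsub>M\<^esub> y)"]) (use y in \<open>auto simp: simps M.l_neg\<close>)
    qed (auto simp: simps M.a_ac)
  qed (auto simp: simps M.R.ring_axioms M.smult_l_distr M.smult_r_distr M.smult_assoc1)
  show "u \<in> lmod_hom R M (copy_module u M)" by (rule lmod_homI) (auto simp: simps)
  show "inv_into (carrier M) u \<in> lmod_hom R (copy_module u M) M"
    by (rule lmod_homI) (auto simp: simps v)
  show "carrier (copy_module u M) = u ` carrier M" by (fact simps)
qed

definition regular_module :: "('r, 'c) ring_scheme \<Rightarrow> ('r, 'r) module"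
  where "regular_module R = \<lparr>carrier = carrier R, mult = mult R, one = one R, zero = zero R, add = add R,
     smult = mult R\<rparr>"

lemma left_module_regular: "ring R \<Longrightarrow> left_module R (regular_module R)"
proof -
  assume "ring R"
  then interpret R: ring R .
  show ?thesis
  proof (rule left_moduleI)
    show "abelian_group (regular_module R)"
      by (rule abelian_groupI) (auto simp: regular_module_def R.a_ac intro: R.l_neg)
  qed (auto simp: regular_module_def R.l_distr R.r_distr R.m_assoc R.ring_axioms)
qed

text \<open>The sets of constant functions contain a copy of every left ideal, so extension from \<open>L\<close> to \<open>R\<close> is
  one of the lifting problems in the definition. The element \<open>m\<close> is the value of the extension at \<open>1\<close>.\<close>

lemma injective_left_ideal:
  fixes M :: "('r, 'm) module"
  assumes M: "injective R M" and L: "submod R L (regular_module R)"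
    and f: "f \<in> lmod_hom R ((regular_module R)\<lparr>carrier := L\<rparr>) M"
  shows "\<exists>m\<in>carrier M. \<forall>r\<in>L. f r = r \<odot>\<^bsub>M\<^esub> m"
proof -
  have lM: "left_module R M" using M by (simp add: injective_def)
  interpret M: left_module R M by fact
  let ?R = "regular_module R" and ?u = "\<lambda>r. (\<lambda>_. r) :: 'm \<Rightarrow> 'r"
  let ?L = "?R\<lparr>carrier := L\<rparr>"
  have lR: "left_module R ?R" by (rule left_module_regular) (rule M.R.ring_axioms)
  have lL: "left_module R ?L" by (rule left_module_submod[OF lR L])
  have u: "inj_on ?u X" for X by (auto simp: inj_on_def fun_eq_iff)
  note cR = copy_module[OF lR u] and cL = copy_module[OF lL u]
  have incl: "(\<lambda>x. x) \<in> lmod_hom R ?L ?R" using L by (auto simp: submod_def intro!: lmod_homI)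
  define j where "j x = ?u (inv_into (carrier ?L) ?u x)" for x
  have j: "j \<in> lmod_hom R (copy_module ?u ?L) (copy_module ?u ?R)"
    unfolding j_def by (rule lmod_hom_comp[OF lmod_hom_comp[OF cL(3) incl] cR(2)])
  have j_inj: "inj_on j (carrier (copy_module ?u ?L))"
    unfolding j_def cL(4) by (rule inj_onI) (auto simp: inv_into_f_f[OF u] fun_eq_iff)
  have f': "(\<lambda>x. f (inv_into (carrier ?L) ?u x)) \<in> lmod_hom R (copy_module ?u ?L) M"
    by (rule lmod_hom_comp[OF cL(3) f])
  obtain g where g: "g \<in> lmod_hom R (copy_module ?u ?R) M"
    and gj: "\<And>x. x \<in> carrier (copy_module ?u ?L) \<Longrightarrow> g (j x) = f (inv_into (carrier ?L) ?u x)"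
    using M[unfolded injective_def, THEN conjunct2, rule_format, OF j f' cL(1) cR(1) j_inj] by blast
  have gu: "(\<lambda>r. g (?u r)) \<in> lmod_hom R ?R M" by (rule lmod_hom_comp[OF cR(2) g])
  have "f r = r \<odot>\<^bsub>M\<^esub> g (?u \<one>\<^bsub>R\<^esub>)" if r: "r \<in> L" for r
  proof -
    have "f r = g (?u r)"
      using gj[of "?u r"] r inv_into_f_f[OF u, of r "carrier ?L"] by (simp add: cL(4) j_def)
    also have "\<dots> = g (?u (r \<odot>\<^bsub>?R\<^esub> \<one>\<^bsub>R\<^esub>))"
      using r L by (auto simp: regular_module_def submod_def)
    also have "\<dots> = r \<odot>\<^bsub>M\<^esub> g (?u \<one>\<^bsub>R\<^esub>)"
      by (rule lmod_hom_smult[OF gu]) (use r L in \<open>auto simp: regular_module_def submod_def\<close>)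
    finally show ?thesis .
  qed
  moreover have "g (?u \<one>\<^bsub>R\<^esub>) \<in> carrier M"
    by (rule lmod_hom_closed[OF gu]) (simp add: regular_module_def)
  ultimately show ?thesis by blast
qed

text \<open>Consider the submodules of \<open>X \<times> M\<close> that contain all pairs \<open>(d y, f y)\<close> and are graphs of partial
  homomorphisms. By the lemma of Zorn one of them is maximal. If its domain missed some \<open>x\<close>, it could
  be enlarged, by the extension property for the left ideal of all \<open>r\<close> with \<open>r x\<close> in the domain. The
  formulation with a homomorphism \<open>d\<close> and its kernel treats extension from the image of a differential
  without the need to form that image.\<close>

lemma injective_extend:
  fixes M :: "('r, 'm) module" and X :: "('r, 'x) module" and Y :: "('r, 'y) module"
  assumes M: "injective R M" and X: "left_module R X" and Y: "left_module R Y"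
    and d: "d \<in> lmod_hom R Y X" and f: "f \<in> lmod_hom R Y M"
    and ker: "\<And>y. y \<in> carrier Y \<Longrightarrow> d y = \<zero>\<^bsub>X\<^esub> \<Longrightarrow> f y = \<zero>\<^bsub>M\<^esub>"
  shows "\<exists>g\<in>lmod_hom R X M. \<forall>y\<in>carrier Y. g (d y) = f y"
proof -
  have lM: "left_module R M" using M by (simp add: injective_def)
  interpret M: left_module R M by fact
  interpret X: left_module R X by fact
  interpret Y: left_module R Y by fact
  \<comment> \<open>Given additivity, the fourth condition makes \<open>\<Gamma>\<close> single-valued.\<close>
  define \<G> where "\<G> = {\<Gamma>. \<Gamma> \<subseteq> carrier X \<times> carrier M \<and>
     (\<forall>p\<in>\<Gamma>. \<forall>q\<in>\<Gamma>. (fst p \<oplus>\<^bsub>X\<^esub> fst q, snd p \<oplus>\<^bsub>M\<^esub> snd q) \<in> \<Gamma>) \<and>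
     (\<forall>a\<in>carrier R. \<forall>p\<in>\<Gamma>. (a \<odot>\<^bsub>X\<^esub> fst p, a \<odot>\<^bsub>M\<^esub> snd p) \<in> \<Gamma>) \<and>
     (\<forall>p\<in>\<Gamma>. fst p = \<zero>\<^bsub>X\<^esub> \<longrightarrow> snd p = \<zero>\<^bsub>M\<^esub>) \<and> (\<lambda>y. (d y, f y)) ` carrier Y \<subseteq> \<Gamma>}"
  have "(\<lambda>y. (d y, f y)) ` carrier Y \<in> \<G>"
    unfolding \<G>_def using ker
    by (auto simp: lmod_hom_closed[OF d] lmod_hom_closed[OF f] lmod_hom_add[OF d, symmetric]
        lmod_hom_add[OF f, symmetric] lmod_hom_smult[OF d, symmetric] lmod_hom_smult[OF f, symmetric])
  then have ne: "\<G> \<noteq> {}" by blast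
  have chain: "\<Union>\<C> \<in> \<G>" if "\<C> \<noteq> {}" "subset.chain \<G> \<C>" for \<C>
  proof -
    have in_G: "\<And>\<Gamma>. \<Gamma> \<in> \<C> \<Longrightarrow> \<Gamma> \<in> \<G>" using that by (auto simp: subset.chain_def)
    have add: "(fst p \<oplus>\<^bsub>X\<^esub> fst q, snd p \<oplus>\<^bsub>M\<^esub> snd q) \<in> \<Union>\<C>" if p: "p \<in> \<Union>\<C>" and q: "q \<in> \<Union>\<C>" for p q
    proof -
      obtain \<Gamma> where "\<Gamma> \<in> \<C>" "p \<in> \<Gamma>" "q \<in> \<Gamma>"
        using p q \<open>subset.chain \<G> \<C>\<close> unfolding subset.chain_def by blast
      then show ?thesis using in_G[of \<Gamma>] unfolding \<G>_def by blast
    qed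
    have "\<Union>\<C> \<subseteq> carrier X \<times> carrier M"
      and "\<forall>a\<in>carrier R. \<forall>p\<in>\<Union>\<C>. (a \<odot>\<^bsub>X\<^esub> fst p, a \<odot>\<^bsub>M\<^esub> snd p) \<in> \<Union>\<C>"
      and "\<forall>p\<in>\<Union>\<C>. fst p = \<zero>\<^bsub>X\<^esub> \<longrightarrow> snd p = \<zero>\<^bsub>M\<^esub>"
      and "(\<lambda>y. (d y, f y)) ` carrier Y \<subseteq> \<Union>\<C>"
      using in_G that(1) unfolding \<G>_def by blast+
    then show ?thesis using add unfolding \<G>_def by simp
  qed
  obtain \<Gamma> where \<Gamma>: "\<Gamma> \<in> \<G>" and max: "\<And>\<Delta>. \<Delta> \<in> \<G> \<Longrightarrow> \<Gamma> \<subseteq> \<Delta> \<Longrightarrow> \<Delta> = \<Gamma>"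
    using subset_Zorn_nonempty[OF ne chain] by blast
  note \<Gamma>' = \<Gamma>[unfolded \<G>_def mem_Collect_eq]
  have sub: "x \<in> carrier X \<and> m \<in> carrier M" if "(x, m) \<in> \<Gamma>" for x m
    using \<Gamma>'[THEN conjunct1] that by blast
  have add: "(x \<oplus>\<^bsub>X\<^esub> y, m \<oplus>\<^bsub>M\<^esub> n) \<in> \<Gamma>" if "(x, m) \<in> \<Gamma>" "(y, n) \<in> \<Gamma>" for x m y n
    using \<Gamma>'[THEN conjunct2, THEN conjunct1, rule_format, OF that] by simp
  have sm: "(a \<odot>\<^bsub>X\<^esub> x, a \<odot>\<^bsub>M\<^esub> m) \<in> \<Gamma>" if "a \<in> carrier R" "(x, m) \<in> \<Gamma>" for a x m
    using \<Gamma>'[THEN conjunct2, THEN conjunct2, THEN conjunct1, rule_format, OF that] by simp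
  have sv: "m = \<zero>\<^bsub>M\<^esub>" if "(\<zero>\<^bsub>X\<^esub>, m) \<in> \<Gamma>" for m
    using \<Gamma>'[THEN conjunct2, THEN conjunct2, THEN conjunct2, THEN conjunct1, rule_format, OF that] by simp
  have base: "(d y, f y) \<in> \<Gamma>" if "y \<in> carrier Y" for y
    using \<Gamma>' that by blast
  have neg: "(\<ominus>\<^bsub>X\<^esub> x, \<ominus>\<^bsub>M\<^esub> m) \<in> \<Gamma>" if "(x, m) \<in> \<Gamma>" for x m
    using sm[OF _ that, of "\<ominus>\<^bsub>R\<^esub> \<one>\<^bsub>R\<^esub>"] sub[OF that] by (simp add: X.smult_l_minus M.smult_l_minus)
  have uniq: "m = n" if m: "(x, m) \<in> \<Gamma>" and n: "(x, n) \<in> \<Gamma>" for x m n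
    using sv[of "m \<ominus>\<^bsub>M\<^esub> n"] add[OF m neg[OF n]] sub[OF m] sub[OF n]
    by (simp add: X.r_neg a_minus_def M.minus_eq_zero_iff[unfolded a_minus_def])
  have zero: "(\<zero>\<^bsub>X\<^esub>, \<zero>\<^bsub>M\<^esub>) \<in> \<Gamma>"
    using base[of "\<zero>\<^bsub>Y\<^esub>"] by (simp add: lmod_hom_zero[OF d Y X] lmod_hom_zero[OF f Y lM])
  have total: "\<exists>m. (x, m) \<in> \<Gamma>" if x: "x \<in> carrier X" for x
  proof -
    define L where "L = {r \<in> carrier R. \<exists>m. (r \<odot>\<^bsub>X\<^esub> x, m) \<in> \<Gamma>}"
    define e where "e r = (SOME m. (r \<odot>\<^bsub>X\<^esub> x, m) \<in> \<Gamma>)" for r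
    have e: "(r \<odot>\<^bsub>X\<^esub> x, e r) \<in> \<Gamma>" if "r \<in> L" for r
      using that unfolding L_def e_def by (auto intro: someI)
    have L: "submod R L (regular_module R)"
      unfolding submod_def L_def regular_module_def
      using x zero add sm by (auto simp: X.smult_l_distr X.smult_assoc1) blast+
    have "e \<in> lmod_hom R ((regular_module R)\<lparr>carrier := L\<rparr>) M"
    proof (rule lmod_homI)
      fix r s assume "r \<in> carrier ((regular_module R)\<lparr>carrier := L\<rparr>)"
        and "s \<in> carrier ((regular_module R)\<lparr>carrier := L\<rparr>)"
      then have rs: "r \<in> L" "s \<in> L" by auto
      then have "r \<oplus>\<^bsub>R\<^esub> s \<in> L" using L by (auto simp: submod_def regular_module_def)
      then show "e (r \<oplus>\<^bsub>(regular_module R)\<lparr>carrier := L\<rparr>\<^esub> s) = e r \<oplus>\<^bsub>M\<^esub> e s"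
        using uniq[OF e[of "r \<oplus>\<^bsub>R\<^esub> s"], of "e r \<oplus>\<^bsub>M\<^esub> e s"] add[OF e[OF rs(1)] e[OF rs(2)]] rs x
        by (auto simp: regular_module_def L_def X.smult_l_distr)
    next
      fix a r assume a: "a \<in> carrier R" and "r \<in> carrier ((regular_module R)\<lparr>carrier := L\<rparr>)"
      then have r: "r \<in> L" by auto
      then have "a \<otimes>\<^bsub>R\<^esub> r \<in> L" using L a by (auto simp: submod_def regular_module_def)
      then show "e (a \<odot>\<^bsub>(regular_module R)\<lparr>carrier := L\<rparr>\<^esub> r) = a \<odot>\<^bsub>M\<^esub> e r"
        using uniq[OF e[of "a \<otimes>\<^bsub>R\<^esub> r"], of "a \<odot>\<^bsub>M\<^esub> e r"] sm[OF a e[OF r]] r x a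
        by (auto simp: regular_module_def L_def X.smult_assoc1)
    qed (use e sub in auto)
    then obtain m0 where m0: "m0 \<in> carrier M" and em: "\<And>r. r \<in> L \<Longrightarrow> e r = r \<odot>\<^bsub>M\<^esub> m0"
      using injective_left_ideal[OF M L] by blast
    have key: "m = r \<odot>\<^bsub>M\<^esub> m0" if r: "r \<in> carrier R" and m: "(r \<odot>\<^bsub>X\<^esub> x, m) \<in> \<Gamma>" for r m
    proof -
      have "r \<in> L" using r m by (auto simp: L_def)
      then show ?thesis using uniq[OF m e] em by simp
    qed
    \<comment> \<open>the extension of \<open>\<Gamma>\<close> that sends \<open>x\<close> to \<open>m0\<close>\<close>
    define \<Delta> where "\<Delta> = {(y \<oplus>\<^bsub>X\<^esub> r \<odot>\<^bsub>X\<^esub> x, m \<oplus>\<^bsub>M\<^esub> r \<odot>\<^bsub>M\<^esub> m0) | y m r. (y, m) \<in> \<Gamma> \<and> r \<in> carrier R}"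
    have \<Delta>I: "(y \<oplus>\<^bsub>X\<^esub> r \<odot>\<^bsub>X\<^esub> x, m \<oplus>\<^bsub>M\<^esub> r \<odot>\<^bsub>M\<^esub> m0) \<in> \<Delta>" if "(y, m) \<in> \<Gamma>" "r \<in> carrier R" for y m r
      unfolding \<Delta>_def using that by blast
    have incl: "\<Gamma> \<subseteq> \<Delta>"
    proof
      fix p assume p: "p \<in> \<Gamma>"
      then have "(fst p, snd p) \<in> \<Gamma>" by simp
      from \<Delta>I[OF this M.R.zero_closed] sub[OF this] x m0 show "p \<in> \<Delta>" by simp
    qed
    have "\<Delta> \<in> \<G>"
      unfolding \<G>_def mem_Collect_eq
    proof (intro conjI ballI impI)
      show "\<Delta> \<subseteq> carrier X \<times> carrier M" unfolding \<Delta>_def using sub x m0 by fastforce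
    next
      fix p q assume "p \<in> \<Delta>" "q \<in> \<Delta>"
      then obtain y m r z n s where 1: "(y, m) \<in> \<Gamma>" "r \<in> carrier R" "(z, n) \<in> \<Gamma>" "s \<in> carrier R"
        and 2: "p = (y \<oplus>\<^bsub>X\<^esub> r \<odot>\<^bsub>X\<^esub> x, m \<oplus>\<^bsub>M\<^esub> r \<odot>\<^bsub>M\<^esub> m0)" "q = (z \<oplus>\<^bsub>X\<^esub> s \<odot>\<^bsub>X\<^esub> x, n \<oplus>\<^bsub>M\<^esub> s \<odot>\<^bsub>M\<^esub> m0)"
        unfolding \<Delta>_def by blast
      from \<Delta>I[OF add[OF 1(1,3)] M.R.a_closed[OF 1(2,4)]] 1 sub[OF 1(1)] sub[OF 1(3)]
      show "(fst p \<oplus>\<^bsub>X\<^esub> fst q, snd p \<oplus>\<^bsub>M\<^esub> snd q) \<in> \<Delta>"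
        by (simp add: 2 x m0 X.smult_l_distr M.smult_l_distr X.a_ac M.a_ac)
    next
      fix a p assume a: "a \<in> carrier R" and "p \<in> \<Delta>"
      then obtain y m r where 1: "(y, m) \<in> \<Gamma>" "r \<in> carrier R"
        and 2: "p = (y \<oplus>\<^bsub>X\<^esub> r \<odot>\<^bsub>X\<^esub> x, m \<oplus>\<^bsub>M\<^esub> r \<odot>\<^bsub>M\<^esub> m0)"
        unfolding \<Delta>_def by blast
      from \<Delta>I[OF sm[OF a 1(1)] M.R.m_closed[OF a 1(2)]] 1 sub[OF 1(1)] a
      show "(a \<odot>\<^bsub>X\<^esub> fst p, a \<odot>\<^bsub>M\<^esub> snd p) \<in> \<Delta>"
        by (simp add: 2 x m0 X.smult_r_distr M.smult_r_distr X.smult_assoc1 M.smult_assoc1)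
    next
      fix p assume "p \<in> \<Delta>" and p0: "fst p = \<zero>\<^bsub>X\<^esub>"
      then obtain y m r where 1: "(y, m) \<in> \<Gamma>" "r \<in> carrier R"
        and 2: "p = (y \<oplus>\<^bsub>X\<^esub> r \<odot>\<^bsub>X\<^esub> x, m \<oplus>\<^bsub>M\<^esub> r \<odot>\<^bsub>M\<^esub> m0)"
        unfolding \<Delta>_def by blast
      have "r \<odot>\<^bsub>X\<^esub> x = \<ominus>\<^bsub>X\<^esub> y"
        by (rule X.minus_equality[symmetric]) (use 1 2 p0 sub[OF 1(1)] x in \<open>simp_all add: X.a_ac\<close>)
      then have "\<ominus>\<^bsub>M\<^esub> m = r \<odot>\<^bsub>M\<^esub> m0" using key[OF 1(2)] neg[OF 1(1)] by simp
      then show "snd p = \<zero>\<^bsub>M\<^esub>" using sub[OF 1(1)] by (simp add: 2 M.r_neg flip: \<open>\<ominus>\<^bsub>M\<^esub> m = r \<odot>\<^bsub>M\<^esub> m0\<close>)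
    next
      show "(\<lambda>y. (d y, f y)) ` carrier Y \<subseteq> \<Delta>" using base incl by blast
    qed
    then have "\<Delta> = \<Gamma>" using max incl by blast
    with \<Delta>I[OF zero M.R.one_closed] x m0 show ?thesis by auto
  qed
  define g where "g x = (SOME m. (x, m) \<in> \<Gamma>)" for x
  have g: "(x, g x) \<in> \<Gamma>" if "x \<in> carrier X" for x
    unfolding g_def using total[OF that] by (rule someI_ex)
  have "g \<in> lmod_hom R X M"
    by (rule lmod_homI)
       (use g sub in \<open>auto intro: uniq[OF g add[OF g g]] uniq[OF g sm[OF _ g]]\<close>)
  moreover have "g (d y) = f y" if "y \<in> carrier Y" for y
    using uniq[OF g base[OF that]] lmod_hom_closed[OF d that] by blast
  ultimately show ?thesis by blast
qed

section \<open>Free modules and the lifting property of projective modules\<close>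

text \<open>Applied to homomorphisms, to the action of a scalar, and to evaluation of functions at a point.\<close>

lemma additive_finsum:
  assumes M: "abelian_group M" and N: "abelian_group N"
    and closed: "\<And>x. x \<in> carrier M \<Longrightarrow> h x \<in> carrier N"
    and add: "\<And>x y. x \<in> carrier M \<Longrightarrow> y \<in> carrier M \<Longrightarrow> h (x \<oplus>\<^bsub>M\<^esub> y) = h x \<oplus>\<^bsub>N\<^esub> h y"
    and "finite A" and "\<And>i. i \<in> A \<Longrightarrow> g i \<in> carrier M"
  shows "h (finsum M g A) = finsum N (\<lambda>i. h (g i)) A"
proof -
  interpret M: abelian_group M by fact
  interpret N: abelian_group N by fact
  have zero: "h \<zero>\<^bsub>M\<^esub> = \<zero>\<^bsub>N\<^esub>"
    by (rule additive_zero[OF M N]) (auto intro!: closed add simp del: M.l_zero M.r_zero)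
  show ?thesis using assms(5,6)
  proof (induction A rule: finite_induct)
    case (insert i A)
    then show ?case
      using M.finsum_insert[of A i g] N.finsum_insert[of A i "\<lambda>i. h (g i)"]
      by (auto simp: add closed Pi_def M.finsum_closed)
  qed (simp add: zero)
qed

definition free_module :: "('r, 'c) ring_scheme \<Rightarrow> 'm set \<Rightarrow> ('r, 'm \<Rightarrow> 'r) module"
  where "free_module R S =
    \<lparr>carrier = {f. (\<forall>x. f x \<in> carrier R) \<and> finite {x. f x \<noteq> \<zero>\<^bsub>R\<^esub>} \<and> {x. f x \<noteq> \<zero>\<^bsub>R\<^esub>} \<subseteq> S},
     mult = undefined, one = undefined, zero = (\<lambda>x. \<zero>\<^bsub>R\<^esub>), add = (\<lambda>f g x. f x \<oplus>\<^bsub>R\<^esub> g x),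
     smult = (\<lambda>a f x. a \<otimes>\<^bsub>R\<^esub> f x)\<rparr>"

definition basis_vector :: "('r, 'c) ring_scheme \<Rightarrow> 'm \<Rightarrow> 'm \<Rightarrow> 'r"
  where "basis_vector R x = (\<lambda>y. if y = x then \<one>\<^bsub>R\<^esub> else \<zero>\<^bsub>R\<^esub>)"

definition linear_extension ::
    "('r, 'c) ring_scheme \<Rightarrow> ('r, 'n, 'd) module_scheme \<Rightarrow> ('m \<Rightarrow> 'n) \<Rightarrow> ('m \<Rightarrow> 'r) \<Rightarrow> 'n"
  where "linear_extension R N g f = (\<Oplus>\<^bsub>N\<^esub>x\<in>{x. f x \<noteq> \<zero>\<^bsub>R\<^esub>}. f x \<odot>\<^bsub>N\<^esub> g x)"

lemma left_module_free:
  fixes R :: "('r, 'c) ring_scheme" and S :: "'m set"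
  assumes "ring R"
  shows "left_module R (free_module R S)"
proof -
  interpret R: ring R by fact
  have fin: "finite {x. f x \<oplus>\<^bsub>R\<^esub> g x \<noteq> \<zero>\<^bsub>R\<^esub>}"
    if "finite {x. f x \<noteq> \<zero>\<^bsub>R\<^esub>}" "finite {x. g x \<noteq> \<zero>\<^bsub>R\<^esub>}" for f g :: "'m \<Rightarrow> 'r"
    by (rule finite_subset[OF _ finite_UnI[OF that]]) auto
  have fin': "finite {x. a \<otimes>\<^bsub>R\<^esub> f x \<noteq> \<zero>\<^bsub>R\<^esub>}"
    if "finite {x. f x \<noteq> \<zero>\<^bsub>R\<^esub>}" "a \<in> carrier R" for a and f :: "'m \<Rightarrow> 'r"
    by (rule finite_subset[OF _ that(1)]) (use that in auto)
  show ?thesis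
  proof (rule left_moduleI)
    show "abelian_group (free_module R S)"
    proof (rule abelian_groupI)
      fix f assume f: "f \<in> carrier (free_module R S)"
      have "finite {x. \<ominus>\<^bsub>R\<^esub> f x \<noteq> \<zero>\<^bsub>R\<^esub>}"
        by (rule finite_subset[of _ "{x. f x \<noteq> \<zero>\<^bsub>R\<^esub>}"]) (use f in \<open>auto simp: free_module_def\<close>)
      moreover have "S \<supseteq> {x. \<ominus>\<^bsub>R\<^esub> f x \<noteq> \<zero>\<^bsub>R\<^esub>}"
        using f R.minus_zero unfolding free_module_def by fastforce
      ultimately show "\<exists>g\<in>carrier (free_module R S). g \<oplus>\<^bsub>free_module R S\<^esub> f = \<zero>\<^bsub>free_module R S\<^esub>"
        using f by (intro bexI[of _ "\<lambda>x. \<ominus>\<^bsub>R\<^esub> f x"]) (auto simp: free_module_def R.l_neg)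
    next
      fix f g assume fg: "f \<in> carrier (free_module R S)" "g \<in> carrier (free_module R S)"
      then have "{x. f x \<oplus>\<^bsub>R\<^esub> g x \<noteq> \<zero>\<^bsub>R\<^esub>} \<subseteq> {x. f x \<noteq> \<zero>\<^bsub>R\<^esub>} \<union> {x. g x \<noteq> \<zero>\<^bsub>R\<^esub>}"
        by auto
      with fg show "f \<oplus>\<^bsub>free_module R S\<^esub> g \<in> carrier (free_module R S)"
        using fin[of f g] by (auto simp: free_module_def)
    qed (auto simp: free_module_def R.a_ac)
  next
    fix a f assume "a \<in> carrier R" "f \<in> carrier (free_module R S)"
    then show "a \<odot>\<^bsub>free_module R S\<^esub> f \<in> carrier (free_module R S)"
      using fin'[of f a] by (fastforce simp: free_module_def)
  qed (auto simp: free_module_def R.l_distr R.r_distr R.m_assoc R.ring_axioms)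
qed

lemma basis_vector_closed: "ring R \<Longrightarrow> x \<in> S \<Longrightarrow> basis_vector R x \<in> carrier (free_module R S)"
proof -
  assume "ring R" "x \<in> S"
  interpret R: ring R by fact
  have "finite {y. basis_vector R x y \<noteq> \<zero>\<^bsub>R\<^esub>}"
    by (rule finite_subset[of _ "{x}"]) (auto simp: basis_vector_def)
  then show ?thesis using \<open>x \<in> S\<close> by (auto simp: free_module_def basis_vector_def)
qed

text \<open>Sums over different supports can be added once they run over a common index set.\<close>

lemma linear_extension_superset:
  assumes N: "left_module R N" and g: "\<And>x. x \<in> S \<Longrightarrow> g x \<in> carrier N"
    and f: "f \<in> carrier (free_module R S)"
    and A: "finite A" "{x. f x \<noteq> \<zero>\<^bsub>R\<^esub>} \<subseteq> A" "A \<subseteq> S"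
  shows "linear_extension R N g f = (\<Oplus>\<^bsub>N\<^esub>x\<in>A. f x \<odot>\<^bsub>N\<^esub> g x)"
proof -
  interpret N: left_module R N by fact
  show ?thesis unfolding linear_extension_def
    by (rule N.M.add.finprod_mono_neutral_cong_left) (use f g A in \<open>auto simp: free_module_def\<close>)
qed

lemma linear_extension_hom:
  assumes N: "left_module R N" and g: "\<And>x. x \<in> S \<Longrightarrow> g x \<in> carrier N"
  shows "linear_extension R N g \<in> lmod_hom R (free_module R S) N"
proof -
  interpret N: left_module R N by fact
  interpret F: left_module R "free_module R S" by (rule left_module_free) (rule N.R.ring_axioms)
  have cl: "f x \<in> carrier R" if "f \<in> carrier (free_module R S)" for f x
    using that by (auto simp: free_module_def)
  show ?thesis
  proof (rule lmod_homI)
    fix f assume f: "f \<in> carrier (free_module R S)"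
    show "linear_extension R N g f \<in> carrier N"
      unfolding linear_extension_def
      by (rule N.M.finsum_closed) (use f g in \<open>auto simp: free_module_def\<close>)
  next
    fix f h assume f: "f \<in> carrier (free_module R S)" and h: "h \<in> carrier (free_module R S)"
    let ?A = "{x. f x \<noteq> \<zero>\<^bsub>R\<^esub>} \<union> {x. h x \<noteq> \<zero>\<^bsub>R\<^esub>}"
    have A: "finite ?A" "?A \<subseteq> S" using f h by (auto simp: free_module_def)
    have eq: "linear_extension R N g k = (\<Oplus>\<^bsub>N\<^esub>x\<in>?A. k x \<odot>\<^bsub>N\<^esub> g x)"
      if "k \<in> carrier (free_module R S)" "{x. k x \<noteq> \<zero>\<^bsub>R\<^esub>} \<subseteq> ?A" for k
      by (rule linear_extension_superset[OF N g that(1) A(1) that(2) A(2)])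
    have "linear_extension R N g (f \<oplus>\<^bsub>free_module R S\<^esub> h) =
        (\<Oplus>\<^bsub>N\<^esub>x\<in>?A. (f \<oplus>\<^bsub>free_module R S\<^esub> h) x \<odot>\<^bsub>N\<^esub> g x)"
      by (rule eq[OF F.M.a_closed[OF f h]]) (auto simp: free_module_def)
    also have "\<dots> = (\<Oplus>\<^bsub>N\<^esub>x\<in>?A. f x \<odot>\<^bsub>N\<^esub> g x \<oplus>\<^bsub>N\<^esub> h x \<odot>\<^bsub>N\<^esub> g x)"
      by (rule N.M.finsum_cong')
         (use A g cl[OF f] cl[OF h] in \<open>auto simp: free_module_def N.smult_l_distr subset_iff\<close>)
    also have "\<dots> = linear_extension R N g f \<oplus>\<^bsub>N\<^esub> linear_extension R N g h"
      unfolding eq[OF f Un_upper1] eq[OF h Un_upper2]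
      by (rule N.M.finsum_addf) (use A g cl[OF f] cl[OF h] in auto)
    finally show "linear_extension R N g (f \<oplus>\<^bsub>free_module R S\<^esub> h) =
        linear_extension R N g f \<oplus>\<^bsub>N\<^esub> linear_extension R N g h" .
  next
    fix a f assume a: "a \<in> carrier R" and f: "f \<in> carrier (free_module R S)"
    let ?A = "{x. f x \<noteq> \<zero>\<^bsub>R\<^esub>}"
    have A: "finite ?A" "?A \<subseteq> S" using f by (auto simp: free_module_def)
    have "linear_extension R N g (a \<odot>\<^bsub>free_module R S\<^esub> f) =
        (\<Oplus>\<^bsub>N\<^esub>x\<in>?A. (a \<odot>\<^bsub>free_module R S\<^esub> f) x \<odot>\<^bsub>N\<^esub> g x)"
      by (rule linear_extension_superset[OF N g F.smult_closed[OF a f] A(1) _ A(2)])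
         (use a in \<open>auto simp: free_module_def\<close>)
    also have "\<dots> = (\<Oplus>\<^bsub>N\<^esub>x\<in>?A. a \<odot>\<^bsub>N\<^esub> (f x \<odot>\<^bsub>N\<^esub> g x))"
      by (rule N.M.finsum_cong')
         (use a A g cl[OF f] in \<open>auto simp: free_module_def N.smult_assoc1 subset_iff\<close>)
    also have "\<dots> = a \<odot>\<^bsub>N\<^esub> linear_extension R N g f"
      unfolding linear_extension_def
      by (rule additive_finsum[OF N.M.abelian_group_axioms N.M.abelian_group_axioms, symmetric])
         (use a A g cl[OF f] in \<open>auto simp: N.smult_r_distr\<close>)
    finally show "linear_extension R N g (a \<odot>\<^bsub>free_module R S\<^esub> f) = a \<odot>\<^bsub>N\<^esub> linear_extension R N g f" .
  qed
qed

lemma linear_extension_basis: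
  assumes N: "left_module R N" and "\<one>\<^bsub>R\<^esub> \<noteq> \<zero>\<^bsub>R\<^esub>" and g: "g x \<in> carrier N"
  shows "linear_extension R N g (basis_vector R x) = g x"
proof -
  interpret N: left_module R N by fact
  have "{y. basis_vector R x y \<noteq> \<zero>\<^bsub>R\<^esub>} = {x}" using assms(2) by (auto simp: basis_vector_def)
  then show ?thesis using g by (simp add: linear_extension_def basis_vector_def)
qed

text \<open>Evaluation at a point is additive, which reduces the identity to a sum with a single
  nonzero term.\<close>

lemma free_module_expansion:
  assumes R: "ring R" and f: "f \<in> carrier (free_module R S)"
  shows "linear_extension R (free_module R S) (basis_vector R) f = f"
proof
  fix y
  interpret R: ring R by fact
  let ?F = "free_module R S"
  interpret F: left_module R ?F by (rule left_module_free) (rule R)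
  have R': "abelian_group R" ..
  have fx: "finite {x. f x \<noteq> \<zero>\<^bsub>R\<^esub>}" "{x. f x \<noteq> \<zero>\<^bsub>R\<^esub>} \<subseteq> S" "f x \<in> carrier R" for x
    using f by (auto simp: free_module_def)
  have b: "f x \<odot>\<^bsub>?F\<^esub> basis_vector R x \<in> carrier ?F" if "f x \<noteq> \<zero>\<^bsub>R\<^esub>" for x
    by (rule F.smult_closed[OF fx(3) basis_vector_closed[OF R]]) (use that fx in blast)
  have "linear_extension R ?F (basis_vector R) f y =
      (\<Oplus>\<^bsub>R\<^esub>x\<in>{x. f x \<noteq> \<zero>\<^bsub>R\<^esub>}. (f x \<odot>\<^bsub>?F\<^esub> basis_vector R x) y)"
    unfolding linear_extension_def
    by (rule additive_finsum[OF F.M.abelian_group_axioms R', where h = "\<lambda>k. k y"])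
       (use fx b in \<open>auto simp: free_module_def\<close>)
  also have "\<dots> = (\<Oplus>\<^bsub>R\<^esub>x\<in>{x. f x \<noteq> \<zero>\<^bsub>R\<^esub>}. if y = x then f x else \<zero>\<^bsub>R\<^esub>)"
    by (rule R.finsum_cong') (use fx in \<open>auto simp: free_module_def basis_vector_def\<close>)
  also have "\<dots> = f y"
  proof (cases "f y = \<zero>\<^bsub>R\<^esub>")
    case True
    have "(\<Oplus>\<^bsub>R\<^esub>x\<in>{x. f x \<noteq> \<zero>\<^bsub>R\<^esub>}. if y = x then f x else \<zero>\<^bsub>R\<^esub>) = (\<Oplus>\<^bsub>R\<^esub>x\<in>{x. f x \<noteq> \<zero>\<^bsub>R\<^esub>}. \<zero>\<^bsub>R\<^esub>)"
      by (rule R.finsum_cong') (use True in auto)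
    then show ?thesis using True by (simp add: R.finsum_zero)
  next
    case False
    then show ?thesis using R.finsum_singleton[of y "{x. f x \<noteq> \<zero>\<^bsub>R\<^esub>}" f] fx by auto
  qed
  finally show "linear_extension R ?F (basis_vector R) f y = f y" .
qed

lemma hom_from_free:
  assumes R: "ring R" and N: "left_module R N" and h: "h \<in> lmod_hom R (free_module R S) N"
    and f: "f \<in> carrier (free_module R S)"
  shows "h f = linear_extension R N (\<lambda>x. h (basis_vector R x)) f"
proof -
  let ?F = "free_module R S"
  interpret F: left_module R ?F by (rule left_module_free) (rule R)
  interpret N: left_module R N by fact
  have fx: "finite {x. f x \<noteq> \<zero>\<^bsub>R\<^esub>}" "{x. f x \<noteq> \<zero>\<^bsub>R\<^esub>} \<subseteq> S" "f x \<in> carrier R" for x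
    using f by (auto simp: free_module_def)
  have b: "basis_vector R x \<in> carrier ?F" if "f x \<noteq> \<zero>\<^bsub>R\<^esub>" for x
    by (rule basis_vector_closed[OF R]) (use that fx(2) in blast)
  have "h f = h (linear_extension R ?F (basis_vector R) f)"
    using free_module_expansion[OF R f] by simp
  also have "\<dots> = (\<Oplus>\<^bsub>N\<^esub>x\<in>{x. f x \<noteq> \<zero>\<^bsub>R\<^esub>}. h (f x \<odot>\<^bsub>?F\<^esub> basis_vector R x))"
    unfolding linear_extension_def
    by (rule additive_finsum[OF F.M.abelian_group_axioms N.M.abelian_group_axioms])
       (use fx b in \<open>auto simp: lmod_hom_closed[OF h] lmod_hom_add[OF h]\<close>)
  also have "\<dots> = linear_extension R N (\<lambda>x. h (basis_vector R x)) f"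
    unfolding linear_extension_def
    by (rule N.M.finsum_cong') (use fx b in \<open>auto simp: lmod_hom_smult[OF h] lmod_hom_closed[OF h]\<close>)
  finally show ?thesis .
qed

text \<open>A lift is determined by its values on the basis, and those may be chosen arbitrarily among the
  preimages. The types of \<open>A\<close> and \<open>B\<close> are therefore arbitrary.\<close>

lemma free_module_lift:
  assumes R: "ring R" and one: "\<one>\<^bsub>R\<^esub> \<noteq> \<zero>\<^bsub>R\<^esub>" and A: "left_module R A" and B: "left_module R B"
    and p: "p \<in> lmod_hom R A B" and f: "f \<in> lmod_hom R (free_module R S) B"
    and im: "\<And>x. x \<in> S \<Longrightarrow> f (basis_vector R x) \<in> p ` carrier A"
  shows "\<exists>g\<in>lmod_hom R (free_module R S) A. \<forall>x\<in>carrier (free_module R S). p (g x) = f x"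
proof -
  define a where "a x = (SOME y. y \<in> carrier A \<and> p y = f (basis_vector R x))" for x
  have a: "a x \<in> carrier A \<and> p (a x) = f (basis_vector R x)" if "x \<in> S" for x
    unfolding a_def by (rule someI_ex) (use im[OF that] in force)
  let ?g = "linear_extension R A a"
  have g: "?g \<in> lmod_hom R (free_module R S) A"
    by (rule linear_extension_hom[OF A]) (use a in auto)
  interpret B: left_module R B by fact
  have "p (?g x) = f x" if x: "x \<in> carrier (free_module R S)" for x
  proof -
    have "p (?g x) = linear_extension R B (\<lambda>y. p (?g (basis_vector R y))) x"
      by (rule hom_from_free[OF R B lmod_hom_comp[OF g p] x])
    also have "\<dots> = linear_extension R B (\<lambda>y. f (basis_vector R y)) x"
      unfolding linear_extension_def[of R B]
    proof (rule B.M.finsum_cong'[OF refl])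
      fix y assume "y \<in> {y. x y \<noteq> \<zero>\<^bsub>R\<^esub>}"
      then have "y \<in> S" using x by (auto simp: free_module_def)
      then show "x y \<odot>\<^bsub>B\<^esub> p (?g (basis_vector R y)) = x y \<odot>\<^bsub>B\<^esub> f (basis_vector R y)"
        using a linear_extension_basis[OF A one, of a y] by simp
    next
      show "(\<lambda>y. x y \<odot>\<^bsub>B\<^esub> f (basis_vector R y)) \<in> {y. x y \<noteq> \<zero>\<^bsub>R\<^esub>} \<rightarrow> carrier B"
      proof
        fix y assume "y \<in> {y. x y \<noteq> \<zero>\<^bsub>R\<^esub>}"
        then have "y \<in> S" "x y \<in> carrier R" using x by (auto simp: free_module_def)
        then show "x y \<odot>\<^bsub>B\<^esub> f (basis_vector R y) \<in> carrier B"
          by (intro B.smult_closed lmod_hom_closed[OF f] basis_vector_closed[OF R])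
      qed
    qed
    also have "\<dots> = f x" by (rule hom_from_free[OF R B f x, symmetric])
    finally show ?thesis .
  qed
  then show ?thesis by (intro bexI[OF _ g]) blast
qed

lemma projective_free:
  fixes R :: "('r, 'c) ring_scheme" and S :: "'m set"
  assumes "ring R" and "\<one>\<^bsub>R\<^esub> \<noteq> \<zero>\<^bsub>R\<^esub>"
  shows "projective R (free_module R S)"
  unfolding projective_def
proof (intro conjI allI ballI impI)
  show "left_module R (free_module R S)" by (rule left_module_free[OF assms(1)])
next
  fix A B :: "('r, ('m \<Rightarrow> 'r) \<Rightarrow> 'r) module" and p f
  assume p: "p \<in> lmod_hom R A B" and f: "f \<in> lmod_hom R (free_module R S) B"
    and A: "left_module R A" and B: "left_module R B" and im: "p ` carrier A = carrier B"
  show "\<exists>g\<in>lmod_hom R (free_module R S) A. \<forall>x\<in>carrier (free_module R S). p (g x) = f x"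
    by (rule free_module_lift[OF assms A B p f])
       (simp add: im lmod_hom_closed[OF f basis_vector_closed[OF assms(1)]])
qed

abbreviation free_cover :: "('r, 'c) ring_scheme \<Rightarrow> ('r, 'm, 'd) module_scheme \<Rightarrow> ('m \<Rightarrow> 'r) \<Rightarrow> 'm"
  where "free_cover R M \<equiv> linear_extension R M (\<lambda>x. x)"

lemma free_cover_hom:
  "left_module R M \<Longrightarrow> free_cover R M \<in> lmod_hom R (free_module R (carrier M)) M"
  by (rule linear_extension_hom)

text \<open>The definition of projectivity provides the splitting once \<open>M\<close> is
  replaced by its copy among the functions \<open>'m \<Rightarrow> 'r\<close> (where \<open>x\<close> becomes the basis vector of \<open>x\<close>).\<close>

lemma projective_splits:
  fixes M :: "('r, 'm) module"
  assumes M: "projective R M" and one: "\<one>\<^bsub>R\<^esub> \<noteq> \<zero>\<^bsub>R\<^esub>"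
  shows "\<exists>s\<in>lmod_hom R M (free_module R (carrier M)). \<forall>x\<in>carrier M. free_cover R M (s x) = x"
proof -
  have lM: "left_module R M" using M by (simp add: projective_def)
  interpret M: left_module R M by fact
  let ?F = "free_module R (carrier M)" and ?u = "basis_vector R"
  have u: "inj_on ?u (carrier M)"
    using one by (auto simp: inj_on_def basis_vector_def fun_eq_iff split: if_splits)
  let ?C = "copy_module ?u M"
  note C = copy_module[OF lM u]
  have F: "left_module R ?F" by (rule left_module_free) (rule M.R.ring_axioms)
  define \<pi> where "\<pi> f = ?u (free_cover R M f)" for f
  have \<pi>: "\<pi> \<in> lmod_hom R ?F ?C"
    unfolding \<pi>_def by (rule lmod_hom_comp[OF free_cover_hom[OF lM] C(2)])
  have "\<pi> ` carrier ?F = carrier ?C"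
  proof
    show "\<pi> ` carrier ?F \<subseteq> carrier ?C"
      using lmod_hom_closed[OF \<pi>] by blast
    show "carrier ?C \<subseteq> \<pi> ` carrier ?F"
    proof
      fix c assume "c \<in> carrier ?C"
      then obtain x where x: "x \<in> carrier M" "c = ?u x" by (auto simp: C(4))
      then have "c = \<pi> (?u x)" by (simp add: \<pi>_def linear_extension_basis[OF lM one])
      then show "c \<in> \<pi> ` carrier ?F" using basis_vector_closed[OF M.R.ring_axioms x(1)] by blast
    qed
  qed
  with M[unfolded projective_def, THEN conjunct2, THEN spec[of _ ?F], THEN spec[of _ ?C],
      THEN bspec, OF \<pi>, THEN bspec, OF C(2)] F C(1)
  obtain s where s: "s \<in> lmod_hom R M ?F" "\<And>x. x \<in> carrier M \<Longrightarrow> \<pi> (s x) = ?u x"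
    by blast
  then have "free_cover R M (s x) = x" if "x \<in> carrier M" for x
    using inj_onD[OF u s(2)[OF that, unfolded \<pi>_def]] that lmod_hom_closed[OF lmod_hom_comp[OF s(1) free_cover_hom[OF lM]]]
    by blast
  then show ?thesis using s(1) by blast
qed

text \<open>The lifting problem is solved on the free module and restricted along the splitting. The
  homomorphism \<open>p\<close> only has to reach the image of \<open>f\<close>; this is the form in which exactness of a
  complex is available.\<close>

lemma projective_lift:
  fixes M :: "('r, 'm) module" and A :: "('r, 'a) module" and B :: "('r, 'b) module"
  assumes M: "projective R M" and one: "\<one>\<^bsub>R\<^esub> \<noteq> \<zero>\<^bsub>R\<^esub>" and A: "left_module R A" and B: "left_module R B"
    and p: "p \<in> lmod_hom R A B" and f: "f \<in> lmod_hom R M B" and im: "f ` carrier M \<subseteq> p ` carrier A"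
  shows "\<exists>g\<in>lmod_hom R M A. \<forall>x\<in>carrier M. p (g x) = f x"
proof -
  have lM: "left_module R M" using M by (simp add: projective_def)
  note R = left_module_ring[OF lM]
  let ?F = "free_module R (carrier M)"
  note \<pi> = free_cover_hom[OF lM]
  obtain s where s: "s \<in> lmod_hom R M ?F" "\<And>x. x \<in> carrier M \<Longrightarrow> free_cover R M (s x) = x"
    using projective_splits[OF M one] by blast
  have "\<exists>g\<in>lmod_hom R ?F A. \<forall>x\<in>carrier ?F. p (g x) = f (free_cover R M x)"
  proof (rule free_module_lift[OF R one A B p lmod_hom_comp[OF \<pi> f]])
    fix x assume x: "x \<in> carrier M"
    have "(\<lambda>x. x) x \<in> carrier M" using x by simp
    then have "free_cover R M (basis_vector R x) = x" by (rule linear_extension_basis[OF lM one])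
    moreover have "f x \<in> p ` carrier A" using im x by blast
    ultimately show "f (free_cover R M (basis_vector R x)) \<in> p ` carrier A" by simp
  qed
  then obtain g where g: "g \<in> lmod_hom R ?F A" "\<And>x. x \<in> carrier ?F \<Longrightarrow> p (g x) = f (free_cover R M x)"
    by blast
  have "p (g (s x)) = f x" if "x \<in> carrier M" for x
    using g(2)[OF lmod_hom_closed[OF s(1) that]] s(2)[OF that] by simp
  then show ?thesis by (intro bexI[OF _ lmod_hom_comp[OF s(1) g(1)]]) simp
qed

section \<open>Acyclicity of complexes of homomorphisms\<close>

lemma complex_obj: "cochain_complex R C \<Longrightarrow> left_module R (obj C n)"
  by (simp add: cochain_complex_def)

lemma complex_diff: "cochain_complex R C \<Longrightarrow> m = n + 1 \<Longrightarrow> diff C n \<in> lmod_hom R (obj C n) (obj C m)"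
  by (simp add: cochain_complex_def)

lemma complex_diff_diff:
  "cochain_complex R C \<Longrightarrow> x \<in> carrier (obj C n) \<Longrightarrow> m = n + 1 \<Longrightarrow> r = n + 2 \<Longrightarrow>
   diff C m (diff C n x) = \<zero>\<^bsub>obj C r\<^esub>"
  by (simp add: cochain_complex_def)

lemma koszul_hom: "left_module R M \<Longrightarrow> koszul M n \<in> lmod_hom R M M"
  unfolding koszul_def
  by (cases "even n") (simp_all add: lmod_hom_id lmod_hom_uminus)

lemma (in abelian_group) uminus_zero [simp]: "\<ominus> \<zero> = \<zero>"
  by (rule minus_equality) auto

lemma koszul_closed: "abelian_group M \<Longrightarrow> x \<in> carrier M \<Longrightarrow> koszul M n x \<in> carrier M"
  by (simp add: koszul_def abelian_group.a_inv_closed)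

lemma koszul_zero: "abelian_group M \<Longrightarrow> koszul M n \<zero>\<^bsub>M\<^esub> = \<zero>\<^bsub>M\<^esub>"
  by (simp add: koszul_def abelian_group.minus_equality abelian_monoid.l_zero abelian_group.axioms(1)
      abelian_monoid.zero_closed)

lemma hom_koszul:
  "f \<in> lmod_hom R M N \<Longrightarrow> left_module R M \<Longrightarrow> left_module R N \<Longrightarrow> x \<in> carrier M \<Longrightarrow>
   f (koszul M n x) = koszul N n (f x)"
  by (simp add: koszul_def lmod_hom_minus)

text \<open>The required equation prescribes \<open>h'\<close> on the image of \<open>\<delta>\<close>. The prescription is consistent because
  \<open>d h - g\<^sub>0\<close> vanishes on the kernel of \<open>\<delta>\<close>, and injectivity extends it to \<open>X\<^sub>1\<close>. When the complex
  \<open>X\<close> is exact, the second conclusion is the same hypothesis one degree higher.\<close>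

lemma null_homotopy_step_injective:
  fixes X0 :: "('r, 'x) module" and X1 :: "('r, 'y) module" and T0 :: "('r, 't) module"
    and T1 :: "('r, 'u) module" and T2 :: "('r, 'v) module"
  assumes mods: "left_module R X0" "left_module R X1" "left_module R T0" "left_module R T2"
    and inj: "injective R T1"
    and \<delta>: "\<delta> \<in> lmod_hom R X0 X1" and d: "d \<in> lmod_hom R T0 T1" and d': "d' \<in> lmod_hom R T1 T2"
    and dd: "\<And>t. t \<in> carrier T0 \<Longrightarrow> d' (d t) = \<zero>\<^bsub>T2\<^esub>"
    and g0: "g0 \<in> lmod_hom R X0 T1" and g1: "g1 \<in> lmod_hom R X1 T2"
    and g: "\<And>x. x \<in> carrier X0 \<Longrightarrow> d' (g0 x) = koszul T2 n (g1 (\<delta> x))"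
    and h: "h \<in> lmod_hom R X0 T0"
    and hg: "\<And>x. x \<in> carrier X0 \<Longrightarrow> \<delta> x = \<zero>\<^bsub>X1\<^esub> \<Longrightarrow> d (h x) = g0 x"
  shows "\<exists>h'\<in>lmod_hom R X1 T1.
    (\<forall>x\<in>carrier X0. g0 x = d (h x) \<ominus>\<^bsub>T1\<^esub> koszul T1 (n - 1) (h' (\<delta> x))) \<and>
    (\<forall>x\<in>carrier X0. d' (h' (\<delta> x)) = g1 (\<delta> x))"
proof -
  have lT1: "left_module R T1" using inj by (simp add: injective_def)
  interpret T1: left_module R T1 by fact
  interpret T2: left_module R T2 by fact
  note dh = lmod_hom_comp[OF h d]
  note f = lmod_hom_comp[OF lmod_hom_sub[OF lT1 dh g0] koszul_hom[OF lT1, of "n - 1"]]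
  note cl = lmod_hom_closed[OF dh] lmod_hom_closed[OF g0] lmod_hom_closed[OF lmod_hom_comp[OF g0 d']]
    lmod_hom_closed[OF lmod_hom_comp[OF \<delta> g1]] lmod_hom_closed[OF h]
  have "\<exists>h'\<in>lmod_hom R X1 T1. \<forall>x\<in>carrier X0. h' (\<delta> x) = koszul T1 (n - 1) (d (h x) \<ominus>\<^bsub>T1\<^esub> g0 x)"
    by (rule injective_extend[OF inj mods(2,1) \<delta> f])
       (use hg cl in \<open>simp add: T1.minus_eq T1.r_neg koszul_zero T1.M.abelian_group_axioms\<close>)
  then obtain h' where h': "h' \<in> lmod_hom R X1 T1"
    and eq: "\<And>x. x \<in> carrier X0 \<Longrightarrow> h' (\<delta> x) = koszul T1 (n - 1) (d (h x) \<ominus>\<^bsub>T1\<^esub> g0 x)" by blast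
  show ?thesis
  proof (intro bexI[OF _ h'] conjI ballI)
    fix x assume x: "x \<in> carrier X0"
    show "g0 x = d (h x) \<ominus>\<^bsub>T1\<^esub> koszul T1 (n - 1) (h' (\<delta> x))"
      using cl[OF x] by (simp add: eq[OF x] koszul_def T1.minus_eq T1.minus_add T1.a_ac T1.r_neg T1.r_neg1 T1.r_neg2)
    show "d' (h' (\<delta> x)) = g1 (\<delta> x)"
      using cl[OF x]
      by (simp add: eq[OF x] hom_koszul[OF d' lT1 mods(4)] lmod_hom_diff[OF d' lT1 mods(4)] dd g[OF x])
         (simp add: koszul_def T2.minus_eq)
  qed
qed

text \<open>Dually, the map \<open>g\<^sub>0 \<plusminus> h \<delta>\<close> takes values in the kernel of \<open>d'\<close>, hence in the image of \<open>d\<close>, and \<open>h'\<close>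
  is a lift of it along \<open>d\<close>.\<close>

lemma null_homotopy_step_projective:
  fixes X0 :: "('r, 'x) module" and X1 :: "('r, 'y) module" and T0 :: "('r, 't) module"
    and T1 :: "('r, 'u) module" and T2 :: "('r, 'v) module"
  assumes mods: "left_module R X1" "left_module R T0" "left_module R T1" "left_module R T2"
    and proj: "projective R X0" and one: "\<one>\<^bsub>R\<^esub> \<noteq> \<zero>\<^bsub>R\<^esub>"
    and \<delta>: "\<delta> \<in> lmod_hom R X0 X1" and d: "d \<in> lmod_hom R T0 T1" and d': "d' \<in> lmod_hom R T1 T2"
    and exact: "\<And>t. t \<in> carrier T1 \<Longrightarrow> d' t = \<zero>\<^bsub>T2\<^esub> \<Longrightarrow> t \<in> d ` carrier T0"
    and g0: "g0 \<in> lmod_hom R X0 T1" and g1: "g1 \<in> lmod_hom R X1 T2"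
    and g: "\<And>x. x \<in> carrier X0 \<Longrightarrow> d' (g0 x) = koszul T2 n (g1 (\<delta> x))"
    and h: "h \<in> lmod_hom R X1 T1"
    and hg: "\<And>x. x \<in> carrier X0 \<Longrightarrow> d' (h (\<delta> x)) = g1 (\<delta> x)"
  shows "\<exists>h'\<in>lmod_hom R X0 T0.
    \<forall>x\<in>carrier X0. g0 x = d (h' x) \<ominus>\<^bsub>T1\<^esub> koszul T1 (n - 1) (h (\<delta> x))"
proof -
  interpret T1: left_module R T1 by fact
  interpret T2: left_module R T2 by fact
  note lT1 = mods(3)
  note h\<delta> = lmod_hom_comp[OF \<delta> h]
  note f = lmod_hom_plus[OF lT1 g0 lmod_hom_comp[OF h\<delta> koszul_hom[OF lT1, of "n - 1"]]]
  note cl = lmod_hom_closed[OF h\<delta>] lmod_hom_closed[OF g0] lmod_hom_closed[OF lmod_hom_comp[OF g0 d']]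
    lmod_hom_closed[OF lmod_hom_comp[OF \<delta> g1]]
  have "d' (g0 x \<oplus>\<^bsub>T1\<^esub> koszul T1 (n - 1) (h (\<delta> x))) = \<zero>\<^bsub>T2\<^esub>" if x: "x \<in> carrier X0" for x
    using cl[OF x]
    by (simp add: lmod_hom_add[OF d'] koszul_closed T1.M.abelian_group_axioms hom_koszul[OF d' lT1 mods(4)] hg[OF x] g[OF x])
       (simp add: koszul_def T2.r_neg T2.l_neg)
  then have im: "(\<lambda>x. g0 x \<oplus>\<^bsub>T1\<^esub> koszul T1 (n - 1) (h (\<delta> x))) ` carrier X0 \<subseteq> d ` carrier T0"
    using exact lmod_hom_closed[OF f] by blast
  from projective_lift[OF proj one mods(2) lT1 d f im]
  obtain h' where h': "h' \<in> lmod_hom R X0 T0"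
    and eq: "\<And>x. x \<in> carrier X0 \<Longrightarrow> d (h' x) = g0 x \<oplus>\<^bsub>T1\<^esub> koszul T1 (n - 1) (h (\<delta> x))" by blast
  show ?thesis
  proof (intro bexI[OF _ h'] ballI)
    fix x assume x: "x \<in> carrier X0"
    show "g0 x = d (h' x) \<ominus>\<^bsub>T1\<^esub> koszul T1 (n - 1) (h (\<delta> x))"
      using cl[OF x] by (simp add: eq[OF x] T1.minus_eq T1.a_assoc T1.r_neg koszul_closed T1.M.abelian_group_axioms)
  qed
qed

text \<open>In the complex of graded homomorphisms from \<open>X\<close> to \<open>T\<close>, this says that \<open>g\<close>, of degree \<open>n\<close>, is the
  differential of \<open>h\<close>.\<close>

definition null_homotopy ::
    "('r, 'c) ring_scheme \<Rightarrow> ('r, 'x) cochain \<Rightarrow> ('r, 't) cochain \<Rightarrow> int \<Rightarrow>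
     (int \<Rightarrow> 'x \<Rightarrow> 't) \<Rightarrow> (int \<Rightarrow> 'x \<Rightarrow> 't) \<Rightarrow> bool"
  where "null_homotopy R X T n g h \<longleftrightarrow>
    (\<forall>q. h q \<in> lmod_hom R (obj X q) (obj T (q + n - 1))) \<and>
    (\<forall>q. \<forall>x\<in>carrier (obj X q). g q x = diff T (q + n - 1) (h q x)
       \<ominus>\<^bsub>obj T (q + n)\<^esub> koszul (obj T (q + n)) (n - 1) (h (q + 1) (diff X q x)))"

lemma null_homotopy_hom:
  "null_homotopy R X T n g h \<Longrightarrow> m = q + n - 1 \<Longrightarrow> h q \<in> lmod_hom R (obj X q) (obj T m)"
  by (simp add: null_homotopy_def)

lemma null_homotopy_eq:
  "null_homotopy R X T n g h \<Longrightarrow> x \<in> carrier (obj X q) \<Longrightarrow> g q x = diff T (q + n - 1) (h q x)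
     \<ominus>\<^bsub>obj T (q + n)\<^esub> koszul (obj T (q + n)) (n - 1) (h (q + 1) (diff X q x))"
  by (simp add: null_homotopy_def)

text \<open>The hypothesis \<open>cocycle\<close> says that \<open>g\<close> is a cocycle of degree \<open>n\<close> in the complex of graded
  homomorphisms from \<open>X\<close> to \<open>T\<close>. The vanishing of the homotopy in the lowest degree is recorded
  because it fixes the boundary condition of a comparison map.\<close>

lemma null_homotopy_into_injectives:
  fixes X :: "('r, 'x) cochain" and T :: "('r, 't) cochain"
  assumes X: "cochain_complex R X" and T: "cochain_complex R T"
    and inj: "\<And>m. injective R (obj T m)"
    and exact: "\<And>q. cocycles X q \<subseteq> coboundaries X q"
    and bounded: "\<And>q. q < N \<Longrightarrow> carrier (obj X q) = {\<zero>\<^bsub>obj X q\<^esub>}"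
    and g: "\<And>q. g q \<in> lmod_hom R (obj X q) (obj T (q + n))"
    and cocycle: "\<And>q x. x \<in> carrier (obj X q) \<Longrightarrow>
      diff T (q + n) (g q x) = koszul (obj T (q + n + 1)) n (g (q + 1) (diff X q x))"
  shows "\<exists>h. null_homotopy R X T n g h \<and> (\<forall>q\<le>N. \<forall>x. h q x = \<zero>\<^bsub>obj T (q + n - 1)\<^esub>)"
proof -
  note oX = complex_obj[OF X] and oT = complex_obj[OF T]
  have dX: "diff X q \<in> lmod_hom R (obj X q) (obj X (q + 1))" for q by (rule complex_diff[OF X refl])
  have dT: "diff T (m - 1) \<in> lmod_hom R (obj T (m - 1)) (obj T m)" for m
    by (rule complex_diff[OF T]) simp
  define rel where "rel q h h' \<longleftrightarrow> (\<forall>x\<in>carrier (obj X q). g q x = diff T (q + n - 1) (h x)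
       \<ominus>\<^bsub>obj T (q + n)\<^esub> koszul (obj T (q + n)) (n - 1) (h' (diff X q x)))" for q h h'
  define good where "good q h \<longleftrightarrow> h \<in> lmod_hom R (obj X q) (obj T (q + n - 1)) \<and>
      (\<forall>x\<in>cocycles X q. diff T (q + n - 1) (h x) = g q x)" for q h
  have step: "\<exists>h'. good (q + 1) h' \<and> rel q h h'" if h: "good q h" for q h
  proof -
    have "\<exists>h'\<in>lmod_hom R (obj X (q + 1)) (obj T (q + n)).
      (\<forall>x\<in>carrier (obj X q). g q x = diff T (q + n - 1) (h x)
          \<ominus>\<^bsub>obj T (q + n)\<^esub> koszul (obj T (q + n)) (n - 1) (h' (diff X q x))) \<and>
      (\<forall>x\<in>carrier (obj X q). diff T (q + n) (h' (diff X q x)) = g (q + 1) (diff X q x))"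
    proof (rule null_homotopy_step_injective[where \<delta> = "diff X q" and d' = "diff T (q + n)"
          and ?g0.0 = "g q" and ?g1.0 = "g (q + 1)", OF oX oX oT oT inj dX dT _ _ g _ cocycle])
      show "diff T (q + n) \<in> lmod_hom R (obj T (q + n)) (obj T (q + n + 1))"
        by (rule complex_diff[OF T refl])
      show "g (q + 1) \<in> lmod_hom R (obj X (q + 1)) (obj T (q + n + 1))"
        using g[of "q + 1"] by (simp add: ac_simps)
      show "diff T (q + n) (diff T (q + n - 1) t) = \<zero>\<^bsub>obj T (q + n + 1)\<^esub>"
        if "t \<in> carrier (obj T (q + n - 1))" for t
        by (rule complex_diff_diff[OF T that]) auto
    qed (use h in \<open>auto simp: good_def cocycles_def\<close>)
    then obtain h' where h': "h' \<in> lmod_hom R (obj X (q + 1)) (obj T (q + n))" "rel q h h'"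
      "\<And>x. x \<in> carrier (obj X q) \<Longrightarrow> diff T (q + n) (h' (diff X q x)) = g (q + 1) (diff X q x)"
      unfolding rel_def by blast
    have "diff T (q + n) (h' x) = g (q + 1) x" if "x \<in> cocycles X (q + 1)" for x
      using exact[of "q + 1"] that h'(3) by (auto simp: coboundaries_def)
    then have "good (q + 1) h'" using h'(1) by (simp add: good_def)
    then show ?thesis using h'(2) by blast
  qed
  have zero: "(\<lambda>_. \<zero>\<^bsub>obj T m\<^esub>) \<in> lmod_hom R (obj X q) (obj T m)" for q m
    by (rule lmod_hom_const_zero[OF oT])
  have g_zero: "g q \<zero>\<^bsub>obj X q\<^esub> = \<zero>\<^bsub>obj T (q + n)\<^esub>" for q
    by (rule lmod_hom_zero[OF g oX oT])
  have d_zero: "diff T (m - 1) \<zero>\<^bsub>obj T (m - 1)\<^esub> = \<zero>\<^bsub>obj T m\<^esub>" for m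
    by (rule lmod_hom_zero[OF dT oT oT])
  have start: "good N (\<lambda>_. \<zero>\<^bsub>obj T (N + n - 1)\<^esub>)"
  proof -
    have "cocycles X N \<subseteq> {\<zero>\<^bsub>obj X N\<^esub>}"
      using exact[of N] bounded[of "N - 1"] lmod_hom_zero[OF dX oX oX, of "N - 1"]
      by (auto simp: coboundaries_def)
    then show ?thesis using zero g_zero d_zero by (auto simp: good_def)
  qed
  have "\<exists>H. \<forall>k. (good (N + int k) (H k) \<and> (k = 0 \<longrightarrow> H k = (\<lambda>_. \<zero>\<^bsub>obj T (N + n - 1)\<^esub>))) \<and>
      rel (N + int k) (H k) (H (Suc k))"
  proof (rule dependent_nat_choice)
    fix h k assume "good (N + int k) h \<and> (k = 0 \<longrightarrow> h = (\<lambda>_. \<zero>\<^bsub>obj T (N + n - 1)\<^esub>))"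
    then show "\<exists>h'. (good (N + int (Suc k)) h' \<and> (Suc k = 0 \<longrightarrow> h' = (\<lambda>_. \<zero>\<^bsub>obj T (N + n - 1)\<^esub>))) \<and>
        rel (N + int k) h h'"
      using step[of "N + int k" h] by (simp add: ac_simps)
  qed (use start in simp)
  then obtain H where H: "\<And>k. good (N + int k) (H k)" "\<And>k. rel (N + int k) (H k) (H (Suc k))"
    "H 0 = (\<lambda>_. \<zero>\<^bsub>obj T (N + n - 1)\<^esub>)" by blast
  define h where "h q = (if q \<ge> N then H (nat (q - N)) else (\<lambda>_. \<zero>\<^bsub>obj T (q + n - 1)\<^esub>))" for q
  have "h q \<in> lmod_hom R (obj X q) (obj T (q + n - 1))" for q
    using H(1)[of "nat (q - N)"] zero by (auto simp: h_def good_def)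
  moreover have low: "h q x = \<zero>\<^bsub>obj T (q + n - 1)\<^esub>" if "q \<le> N" for q x
    using that H(3) by (auto simp: h_def)
  moreover have "rel q (h q) (h (q + 1))" for q
  proof (cases "q \<ge> N")
    case True
    then have "nat (q + 1 - N) = Suc (nat (q - N))" by simp
    then show ?thesis using True H(2)[of "nat (q - N)"] by (simp add: h_def)
  next
    case False
    interpret Tn: left_module R "obj T (q + n)" by (rule oT)
    have "h (q + 1) x = \<zero>\<^bsub>obj T (q + n)\<^esub>" for x using low[of "q + 1"] False by simp
    then show ?thesis
      unfolding rel_def using False bounded[of q] by (auto simp: low g_zero d_zero Tn.minus_eq koszul_zero Tn.M.abelian_group_axioms)
  qed
  ultimately show ?thesis unfolding rel_def null_homotopy_def by (intro exI[of _ h] conjI allI) simp_all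
qed

text \<open>The complex \<open>X\<close> may be unbounded; the induction starts in degree \<open>N\<close>, from which on \<open>g\<close> vanishes
  and the homotopy can be taken to be zero.\<close>

lemma null_homotopy_from_projectives:
  fixes X :: "('r, 'x) cochain" and T :: "('r, 't) cochain"
  assumes X: "cochain_complex R X" and T: "cochain_complex R T"
    and proj: "\<And>q. q < N \<Longrightarrow> projective R (obj X q)" and one: "\<one>\<^bsub>R\<^esub> \<noteq> \<zero>\<^bsub>R\<^esub>"
    and exact: "\<And>q. cocycles T q \<subseteq> coboundaries T q"
    and g: "\<And>q. g q \<in> lmod_hom R (obj X q) (obj T (q + n))"
    and cocycle: "\<And>q x. x \<in> carrier (obj X q) \<Longrightarrow>
      diff T (q + n) (g q x) = koszul (obj T (q + n + 1)) n (g (q + 1) (diff X q x))"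
    and vanish: "\<And>q x. q \<ge> N \<Longrightarrow> x \<in> carrier (obj X q) \<Longrightarrow> g q x = \<zero>\<^bsub>obj T (q + n)\<^esub>"
  shows "\<exists>h. null_homotopy R X T n g h \<and> (\<forall>q\<ge>N. \<forall>x. h q x = \<zero>\<^bsub>obj T (q + n - 1)\<^esub>)"
proof -
  note oX = complex_obj[OF X] and oT = complex_obj[OF T]
  have dX: "diff X q \<in> lmod_hom R (obj X q) (obj X (q + 1))" for q by (rule complex_diff[OF X refl])
  have dT: "diff T (m - 1) \<in> lmod_hom R (obj T (m - 1)) (obj T m)" for m
    by (rule complex_diff[OF T]) simp
  define rel where "rel q h h' \<longleftrightarrow> (\<forall>x\<in>carrier (obj X q). g q x = diff T (q + n - 1) (h x)
       \<ominus>\<^bsub>obj T (q + n)\<^esub> koszul (obj T (q + n)) (n - 1) (h' (diff X q x)))" for q h h'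
  define good where "good q h \<longleftrightarrow> h \<in> lmod_hom R (obj X q) (obj T (q + n - 1)) \<and>
      (\<forall>x\<in>cocycles X q. diff T (q + n - 1) (h x) = g q x)" for q h
  have step: "\<exists>h'. good q h' \<and> rel q h' h" if h: "good (q + 1) h" and q: "q < N" for q h
  proof -
    have "\<exists>h'\<in>lmod_hom R (obj X q) (obj T (q + n - 1)).
      \<forall>x\<in>carrier (obj X q). g q x = diff T (q + n - 1) (h' x)
          \<ominus>\<^bsub>obj T (q + n)\<^esub> koszul (obj T (q + n)) (n - 1) (h (diff X q x))"
    proof (rule null_homotopy_step_projective[where \<delta> = "diff X q" and d' = "diff T (q + n)"
          and ?g0.0 = "g q" and ?g1.0 = "g (q + 1)", OF oX oT oT oT proj[OF q] one dX dT _ _ g _ cocycle])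
      show "diff T (q + n) \<in> lmod_hom R (obj T (q + n)) (obj T (q + n + 1))"
        by (rule complex_diff[OF T refl])
      show "g (q + 1) \<in> lmod_hom R (obj X (q + 1)) (obj T (q + n + 1))"
        using g[of "q + 1"] by (simp add: ac_simps)
      show "t \<in> diff T (q + n - 1) ` carrier (obj T (q + n - 1))"
        if "t \<in> carrier (obj T (q + n))" "diff T (q + n) t = \<zero>\<^bsub>obj T (q + n + 1)\<^esub>" for t
        using exact[of "q + n"] that by (auto simp: cocycles_def coboundaries_def)
      show "h \<in> lmod_hom R (obj X (q + 1)) (obj T (q + n))" using h by (simp add: good_def)
      show "diff T (q + n) (h (diff X q x)) = g (q + 1) (diff X q x)" if "x \<in> carrier (obj X q)" for x
        using h that lmod_hom_closed[OF dX that] complex_diff_diff[OF X that, of "q + 1" "q + 1 + 1"]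
        by (auto simp: good_def cocycles_def)
    qed
    then obtain h' where h': "h' \<in> lmod_hom R (obj X q) (obj T (q + n - 1))" "rel q h' h"
      unfolding rel_def by blast
    interpret Tn: left_module R "obj T (q + n)" by (rule oT)
    have "h \<in> lmod_hom R (obj X (q + 1)) (obj T (q + n))" using h by (simp add: good_def)
    from lmod_hom_zero[OF this oX oT]
    have "diff T (q + n - 1) (h' x) = g q x" if "x \<in> cocycles X q" for x
      using h'(2) that lmod_hom_closed[OF lmod_hom_comp[OF h'(1) dT]]
      by (auto simp: rel_def cocycles_def Tn.minus_eq koszul_zero Tn.M.abelian_group_axioms)
    then have "good q h'" using h'(1) by (simp add: good_def)
    then show ?thesis using h'(2) by blast
  qed
  have zero: "(\<lambda>_. \<zero>\<^bsub>obj T m\<^esub>) \<in> lmod_hom R (obj X q) (obj T m)" for q m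
    by (rule lmod_hom_const_zero[OF oT])
  have d_zero: "diff T (m - 1) \<zero>\<^bsub>obj T (m - 1)\<^esub> = \<zero>\<^bsub>obj T m\<^esub>" for m
    by (rule lmod_hom_zero[OF dT oT oT])
  have start: "good N (\<lambda>_. \<zero>\<^bsub>obj T (N + n - 1)\<^esub>)"
    using zero vanish[of N] d_zero by (auto simp: good_def cocycles_def)
  have "\<exists>H. \<forall>k. (good (N - int k) (H k) \<and> (k = 0 \<longrightarrow> H k = (\<lambda>_. \<zero>\<^bsub>obj T (N + n - 1)\<^esub>))) \<and>
      rel (N - int (Suc k)) (H (Suc k)) (H k)"
  proof (rule dependent_nat_choice)
    fix h k assume "good (N - int k) h \<and> (k = 0 \<longrightarrow> h = (\<lambda>_. \<zero>\<^bsub>obj T (N + n - 1)\<^esub>))"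
    then show "\<exists>h'. (good (N - int (Suc k)) h' \<and> (Suc k = 0 \<longrightarrow> h' = (\<lambda>_. \<zero>\<^bsub>obj T (N + n - 1)\<^esub>))) \<and>
        rel (N - int (Suc k)) h' h"
      using step[of "N - int (Suc k)" h] by (simp add: algebra_simps)
  qed (use start in simp)
  then obtain H where H: "\<And>k. good (N - int k) (H k)" "\<And>k. rel (N - int (Suc k)) (H (Suc k)) (H k)"
    "H 0 = (\<lambda>_. \<zero>\<^bsub>obj T (N + n - 1)\<^esub>)" by blast
  define h where "h q = (if q \<le> N then H (nat (N - q)) else (\<lambda>_. \<zero>\<^bsub>obj T (q + n - 1)\<^esub>))" for q
  have "h q \<in> lmod_hom R (obj X q) (obj T (q + n - 1))" for q
    using H(1)[of "nat (N - q)"] zero by (auto simp: h_def good_def)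
  moreover have high: "h q x = \<zero>\<^bsub>obj T (q + n - 1)\<^esub>" if "q \<ge> N" for q x
    using that H(3) by (auto simp: h_def)
  moreover have "rel q (h q) (h (q + 1))" for q
  proof (cases "q < N")
    case True
    then have "nat (N - q) = Suc (nat (N - (q + 1)))" by simp
    then show ?thesis using True H(2)[of "nat (N - (q + 1))"] by (simp add: h_def)
  next
    case False
    interpret Tn: left_module R "obj T (q + n)" by (rule oT)
    have "h (q + 1) x = \<zero>\<^bsub>obj T (q + n)\<^esub>" for x using high[of "q + 1"] False by simp
    then show ?thesis
      unfolding rel_def using False vanish[of q] by (auto simp: high d_zero Tn.minus_eq koszul_zero Tn.M.abelian_group_axioms)
  qed
  ultimately show ?thesis unfolding rel_def null_homotopy_def by (intro exI[of _ h] conjI allI) simp_all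
qed

section \<open>Comparison maps\<close>

lemma submod_cocycles:
  assumes C: "cochain_complex R C" shows "submod R (cocycles C n) (obj C n)"
proof -
  interpret left_module R "obj C n" by (rule complex_obj[OF C])
  interpret S: left_module R "obj C (n + 1)" by (rule complex_obj[OF C])
  note d = complex_diff[OF C refl, of n]
  show ?thesis
    by (auto simp: submod_def cocycles_def lmod_hom_add[OF d] lmod_hom_smult[OF d]
        lmod_hom_zero[OF d complex_obj[OF C] complex_obj[OF C]])
qed

lemma submod_zero: "left_module R M \<Longrightarrow> submod R {\<zero>\<^bsub>M\<^esub>} M"
proof -
  assume "left_module R M"
  then interpret left_module R M .
  show ?thesis by (auto simp: submod_def)
qed

lemma chain_map_hom: "chain_map R C D f \<Longrightarrow> f n \<in> lmod_hom R (obj C n) (obj D n)"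
  by (simp add: chain_map_def)

lemma chain_map_diff:
  "chain_map R C D f \<Longrightarrow> x \<in> carrier (obj C n) \<Longrightarrow> f (n + 1) (diff C n x) = diff D n (f n x)"
  by (simp add: chain_map_def)

lemma injective_resolutionD:
  assumes "injective_resolution R M I \<eta>"
  shows "cochain_complex R I" and "n < 0 \<Longrightarrow> carrier (obj I n) = {\<zero>\<^bsub>obj I n\<^esub>}"
    and "\<eta> \<in> lmod_hom R M (obj I 0)" and "inj_on \<eta> (carrier M)" and "\<eta> ` carrier M = cocycles I 0"
    and "n > 0 \<Longrightarrow> cocycles I n = coboundaries I n"
  using assms by (auto simp: injective_resolution_def)

text \<open>Exactness at the splice: as \<open>\<theta>\<close> is injective, the kernel of \<open>\<theta> \<circ> \<epsilon>\<close> is that of \<open>\<epsilon>\<close>, and as \<open>\<epsilon>\<close> is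
  surjective, the image of \<open>\<theta> \<circ> \<epsilon>\<close> is that of \<open>\<theta>\<close>.\<close>

lemma tate_resolutionD:
  assumes M: "left_module R M" and T: "tate_resolution R M T \<theta>"
  shows "cochain_complex R T" and "projective R (obj T n)" and "injective R (obj T n)"
    and "cocycles T n = coboundaries T n"
    and "\<theta> \<in> lmod_hom R M (obj T 0)" and "inj_on \<theta> (carrier M)" and "\<theta> ` carrier M = cocycles T 0"
proof -
  show "projective R (obj T n)" "injective R (obj T n)" using T by (auto simp: tate_resolution_def)
  obtain P \<epsilon> J where P: "projective_resolution R M P \<epsilon>" and J: "injective_resolution R M J \<theta>"
    and T_eq: "T = splice P \<epsilon> J \<theta>" using T by (auto simp: tate_resolution_def)
  note J' = injective_resolutionD[OF J]
  have cP: "cochain_complex R P" and \<epsilon>: "\<epsilon> \<in> lmod_hom R (obj P 0) M"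
    and \<epsilon>_surj: "\<epsilon> ` carrier (obj P 0) = carrier M"
    and \<epsilon>_ker: "{x \<in> carrier (obj P 0). \<epsilon> x = \<zero>\<^bsub>M\<^esub>} = coboundaries P 0"
    and P_exact: "\<And>n. n < 0 \<Longrightarrow> cocycles P n = coboundaries P n"
    using P by (auto simp: projective_resolution_def)
  interpret M: left_module R M by fact
  note oP = complex_obj[OF cP] and oJ = complex_obj[OF J'(1)]
  note dP = complex_diff[OF cP refl] and dJ = complex_diff[OF J'(1) refl]
  have obj_T: "obj T n = (if n \<ge> 0 then obj J n else obj P (n + 1))" for n by (simp add: T_eq splice_def)
  have diff_T: "diff T n = (if n \<ge> 0 then diff J n else if n = -1 then \<lambda>x. \<theta> (\<epsilon> x) else diff P (n + 1))" for n
    by (simp add: T_eq splice_def comp_def)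
  have \<theta>_zero: "\<theta> x = \<zero>\<^bsub>obj J 0\<^esub> \<longleftrightarrow> x = \<zero>\<^bsub>M\<^esub>" if "x \<in> carrier M" for x
    using inj_onD[OF J'(4) _ that M.M.zero_closed] lmod_hom_zero[OF J'(3) M oJ] by auto
  have \<epsilon>_d: "\<epsilon> (diff P (-1) x) = \<zero>\<^bsub>M\<^esub>" if "x \<in> carrier (obj P (-1))" for x
    using \<epsilon>_ker that by (auto simp: coboundaries_def)
  show "cochain_complex R T"
    unfolding cochain_complex_def
  proof (intro conjI allI ballI)
    fix n
    show "left_module R (obj T n)" by (simp add: obj_T oP oJ)
    consider "n \<ge> 0" | "n = -1" | "n < -1" by linarith
    then show "diff T n \<in> lmod_hom R (obj T n) (obj T (n + 1))"
    proof cases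
      case 2
      then show ?thesis using lmod_hom_comp[OF \<epsilon> J'(3)] by (simp add: obj_T diff_T)
    qed (use dP[of "n + 1"] dJ[of n] in \<open>auto simp: obj_T diff_T\<close>)
    fix x assume x: "x \<in> carrier (obj T n)"
    consider "n \<ge> 0" | "n = -1" | "n = -2" | "n < -2" by linarith
    then show "diff T (n + 1) (diff T n x) = \<zero>\<^bsub>obj T (n + 2)\<^esub>"
    proof cases
      case 1
      then show ?thesis using x complex_diff_diff[OF J'(1), of x n] by (simp add: obj_T diff_T)
    next
      case 2
      then have "\<theta> (\<epsilon> x) \<in> cocycles J 0"
        using x lmod_hom_closed[OF \<epsilon>, of x] J'(5) by (auto simp: obj_T)
      then show ?thesis using 2 by (simp add: obj_T diff_T cocycles_def)
    next
      case 3
      then show ?thesis using x \<epsilon>_d[of x] lmod_hom_zero[OF J'(3) M oJ] by (simp add: obj_T diff_T)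
    next
      case 4
      then show ?thesis using x complex_diff_diff[OF cP, of x "n + 1" "n + 1 + 1" "n + 3"]
        by (simp add: obj_T diff_T ac_simps)
    qed
  qed
  show "cocycles T n = coboundaries T n"
  proof -
    consider "n > 0" | "n = 0" | "n = -1" | "n < -1" by linarith
    then show ?thesis
    proof cases
      case 1
      then show ?thesis using J'(6)[OF 1] by (simp add: cocycles_def coboundaries_def obj_T diff_T)
    next
      case 2
      have "(\<lambda>x. \<theta> (\<epsilon> x)) ` carrier (obj P 0) = \<theta> ` carrier M" using \<epsilon>_surj by (simp add: image_image[symmetric])
      then show ?thesis using 2 J'(5) by (simp add: cocycles_def coboundaries_def obj_T diff_T)
    next
      case 3
      have "{x \<in> carrier (obj P 0). \<theta> (\<epsilon> x) = \<zero>\<^bsub>obj J 0\<^esub>} = {x \<in> carrier (obj P 0). \<epsilon> x = \<zero>\<^bsub>M\<^esub>}"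
        using \<theta>_zero lmod_hom_closed[OF \<epsilon>] by auto
      then show ?thesis using 3 \<epsilon>_ker by (simp add: cocycles_def coboundaries_def obj_T diff_T)
    next
      case 4
      then have "n + 1 < 0" by simp
      from P_exact[OF this] show ?thesis using 4
        by (simp add: cocycles_def coboundaries_def obj_T diff_T)
    qed
  qed
  show "\<theta> \<in> lmod_hom R M (obj T 0)" "inj_on \<theta> (carrier M)" "\<theta> ` carrier M = cocycles T 0"
    using J'(3-5) by (auto simp: obj_T diff_T cocycles_def)
qed

text \<open>The resolved module is represented in degree \<open>-1\<close> by its image in \<open>I\<^sup>0\<close>, so that all components
  have the same type. All components in negative degrees are submodules of \<open>I\<^sup>0\<close>, and the identity
  serves as differential between them and into degree \<open>0\<close>.\<close>

definition augmented :: "('r, 'm) cochain \<Rightarrow> ('r, 'm) cochain"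
  where "augmented I =
    \<lparr>obj = (\<lambda>n. if n \<ge> 0 then obj I n else (obj I 0)\<lparr>carrier := if n = -1 then cocycles I 0 else {\<zero>\<^bsub>obj I 0\<^esub>}\<rparr>),
     diff = (\<lambda>n. if n \<ge> 0 then diff I n else (\<lambda>x. x))\<rparr>"

lemma augmented:
  assumes C: "cochain_complex R I"
  shows "cochain_complex R (augmented I)"
    and "n < -1 \<Longrightarrow> carrier (obj (augmented I) n) = {\<zero>\<^bsub>obj (augmented I) n\<^esub>}"
    and "(\<And>n. n > 0 \<Longrightarrow> cocycles I n = coboundaries I n) \<Longrightarrow>
      cocycles (augmented I) n \<subseteq> coboundaries (augmented I) n"
proof -
  note oI = complex_obj[OF C] and dI = complex_diff[OF C refl]
  interpret I0: left_module R "obj I 0" by (rule oI)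
  interpret I1: left_module R "obj I 1" by (rule oI)
  have d0: "diff I 0 \<zero>\<^bsub>obj I 0\<^esub> = \<zero>\<^bsub>obj I 1\<^esub>" using lmod_hom_zero[OF dI oI oI, of 0] by simp
  show "cochain_complex R (augmented I)"
    unfolding cochain_complex_def
  proof (intro conjI allI ballI)
    fix n
    show "left_module R (obj (augmented I) n)"
      by (simp add: augmented_def oI left_module_submod[OF oI] submod_cocycles[OF C] submod_zero[OF oI])
    show "diff (augmented I) n \<in> lmod_hom R (obj (augmented I) n) (obj (augmented I) (n + 1))"
    proof (cases "n = -1")
      case True
      then show ?thesis by (auto simp: augmented_def cocycles_def intro!: lmod_homI)
    next
      case False
      then show ?thesis using dI[of n] by (auto simp: augmented_def cocycles_def d0 intro!: lmod_homI)
    qed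
    fix x assume x: "x \<in> carrier (obj (augmented I) n)"
    show "diff (augmented I) (n + 1) (diff (augmented I) n x) = \<zero>\<^bsub>obj (augmented I) (n + 2)\<^esub>"
      using x complex_diff_diff[OF C, of x n "n + 1" "n + 2"]
      by (cases "n = -2")
         (auto simp: augmented_def cocycles_def split: if_splits)
  qed
  show "n < -1 \<Longrightarrow> carrier (obj (augmented I) n) = {\<zero>\<^bsub>obj (augmented I) n\<^esub>}"
    by (simp add: augmented_def)
  assume ex: "\<And>n. n > 0 \<Longrightarrow> cocycles I n = coboundaries I n"
  consider "n > 0" | "n = 0" | "n = -1" | "n < -1" by linarith
  then show "cocycles (augmented I) n \<subseteq> coboundaries (augmented I) n"
  proof cases
    case 1
    then show ?thesis using ex[OF 1] by (simp add: augmented_def cocycles_def coboundaries_def)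
  qed (auto simp: augmented_def cocycles_def coboundaries_def)
qed

text \<open>A comparison map is a homotopy. On the augmented complex consider the cochain of degree \<open>1\<close> that is
  \<open>- \<theta> \<eta>\<^sup>-\<^sup>1\<close> in degree \<open>-1\<close> and zero elsewhere. It is a cocycle, so it is the differential of some \<open>h\<close>
  that vanishes in degree \<open>-1\<close>. In degrees \<open>\<ge> 0\<close> this means that \<open>h\<close> is a chain map, and in degree \<open>-1\<close>
  that \<open>h \<eta> = \<theta>\<close>.\<close>

lemma comparison_exists:
  assumes M: "left_module R M" and I: "injective_resolution R M I \<eta>" and T: "tate_resolution R M T \<theta>"
  shows "\<exists>c. comparison R M I \<eta> T \<theta> c"
proof -
  note I' = injective_resolutionD[OF I] and T' = tate_resolutionD[OF M T]
  note oI = complex_obj[OF I'(1)] and oT = complex_obj[OF T'(1)]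
  note A = augmented[OF I'(1)]
  note dT = complex_diff[OF T'(1)]
  let ?\<eta> = "inv_into (carrier M) \<eta>"
  interpret M: left_module R M by fact
  interpret T0: left_module R "obj T 0" by (rule oT)
  have inv: "?\<eta> (\<eta> x) = x" if "x \<in> carrier M" for x by (rule inv_into_f_f[OF I'(4) that])
  have \<eta>_inv: "?\<eta> \<in> lmod_hom R ((obj I 0)\<lparr>carrier := cocycles I 0\<rparr>) M"
  proof (rule lmod_homI)
    fix x y assume "x \<in> carrier ((obj I 0)\<lparr>carrier := cocycles I 0\<rparr>)" "y \<in> carrier ((obj I 0)\<lparr>carrier := cocycles I 0\<rparr>)"
    then obtain a b where ab: "a \<in> carrier M" "x = \<eta> a" "b \<in> carrier M" "y = \<eta> b"
      by (auto simp: I'(5)[symmetric])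
    then show "?\<eta> (x \<oplus>\<^bsub>(obj I 0)\<lparr>carrier := cocycles I 0\<rparr>\<^esub> y) = ?\<eta> x \<oplus>\<^bsub>M\<^esub> ?\<eta> y"
      using inv[of "a \<oplus>\<^bsub>M\<^esub> b"] by (simp add: lmod_hom_add[OF I'(3)] inv)
  next
    fix r x assume r: "r \<in> carrier R" and "x \<in> carrier ((obj I 0)\<lparr>carrier := cocycles I 0\<rparr>)"
    then obtain a where a: "a \<in> carrier M" "x = \<eta> a" by (auto simp: I'(5)[symmetric])
    then show "?\<eta> (r \<odot>\<^bsub>(obj I 0)\<lparr>carrier := cocycles I 0\<rparr>\<^esub> x) = r \<odot>\<^bsub>M\<^esub> ?\<eta> x"
      using inv[of "r \<odot>\<^bsub>M\<^esub> a"] r by (simp add: lmod_hom_smult[OF I'(3)] inv)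
  qed (auto simp: inv simp flip: I'(5))
  define g where "g q = (if q = -1 then \<lambda>x. \<ominus>\<^bsub>obj T 0\<^esub> \<theta> (?\<eta> x) else (\<lambda>_. \<zero>\<^bsub>obj T (q + 1)\<^esub>))" for q
  have g: "g q \<in> lmod_hom R (obj (augmented I) q) (obj T (q + 1))" for q
    using lmod_hom_uminus[OF oT lmod_hom_comp[OF \<eta>_inv T'(5)]] lmod_hom_const_zero[OF oT]
    by (auto simp: g_def augmented_def)
  have cocycle: "diff T (q + 1) (g q x) = koszul (obj T (q + 1 + 1)) 1 (g (q + 1) (diff (augmented I) q x))"
    if x: "x \<in> carrier (obj (augmented I) q)" for q x
  proof -
    interpret Tq: left_module R "obj T (q + 1 + 1)" by (rule oT)
    have d_zero: "diff T (q + 1) \<zero>\<^bsub>obj T (q + 1)\<^esub> = \<zero>\<^bsub>obj T (q + 1 + 1)\<^esub>"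
      by (rule lmod_hom_zero[OF dT[OF refl] oT oT])
    consider "q = -1" | "q = -2" | "q \<noteq> -1" "q \<noteq> -2" by blast
    then show ?thesis
    proof cases
      case 1
      then obtain m where m: "m \<in> carrier M" "x = \<eta> m" using x I'(5) by (auto simp: augmented_def)
      then have "\<theta> m \<in> cocycles T 0" using T'(7) by blast
      then have "diff T 0 (\<ominus>\<^bsub>obj T 0\<^esub> \<theta> m) = \<zero>\<^bsub>obj T 1\<^esub>"
        using lmod_hom_minus[OF dT[OF refl] oT oT, of "\<theta> m" 0] Tq.M.uminus_zero 1
        by (auto simp: cocycles_def)
      then show ?thesis using 1 m inv koszul_zero[OF Tq.M.abelian_group_axioms] by (simp add: g_def)
    next
      case 2
      have "?\<eta> \<zero>\<^bsub>obj I 0\<^esub> = \<zero>\<^bsub>M\<^esub>"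
        using lmod_hom_zero[OF \<eta>_inv left_module_submod[OF oI submod_cocycles[OF I'(1)]] M] by simp
      then show ?thesis using 2 x d_zero lmod_hom_zero[OF T'(5) M oT] koszul_zero[OF Tq.M.abelian_group_axioms]
        by (simp add: g_def augmented_def)
    next
      case 3
      then show ?thesis using d_zero koszul_zero[OF Tq.M.abelian_group_axioms] by (simp add: g_def)
    qed
  qed
  have "\<exists>h. null_homotopy R (augmented I) T 1 g h \<and> (\<forall>q\<le>-1. \<forall>x. h q x = \<zero>\<^bsub>obj T (q + 1 - 1)\<^esub>)"
    by (rule null_homotopy_into_injectives[OF A(1) T'(1) T'(3) A(3)[OF I'(6)] A(2) g cocycle])
  then obtain h where H: "null_homotopy R (augmented I) T 1 g h"
    "\<And>q x. q \<le> -1 \<Longrightarrow> h q x = \<zero>\<^bsub>obj T (q + 1 - 1)\<^esub>" by blast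
  have h: "\<And>q. h q \<in> lmod_hom R (obj (augmented I) q) (obj T q)" using null_homotopy_hom[OF H(1)] by simp
  have low: "\<And>q x. q \<le> -1 \<Longrightarrow> h q x = \<zero>\<^bsub>obj T q\<^esub>" using H(2) by simp
  have rel: "\<And>q x. x \<in> carrier (obj (augmented I) q) \<Longrightarrow> g q x = diff T q (h q x)
       \<ominus>\<^bsub>obj T (q + 1)\<^esub> h (q + 1) (diff (augmented I) q x)"
    using null_homotopy_eq[OF H(1)] by (simp add: koszul_def)
  have "h q \<in> lmod_hom R (obj I q) (obj T q)" for q
  proof (cases "q \<ge> 0")
    case False
    then have "h q = (\<lambda>_. \<zero>\<^bsub>obj T q\<^esub>)" using low by auto
    then show ?thesis using lmod_hom_const_zero[OF oT] by simp
  qed (use h[of q] in \<open>simp add: augmented_def\<close>)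
  moreover have "h (q + 1) (diff I q x) = diff T q (h q x)" if x: "x \<in> carrier (obj I q)" for q x
  proof (cases "q \<ge> 0")
    case True
    interpret Tq: left_module R "obj T (q + 1)" by (rule oT)
    have "diff T q (h q x) \<in> carrier (obj T (q + 1))"
      using lmod_hom_closed[OF lmod_hom_comp[OF h dT[OF refl]], of x q] x True by (simp add: augmented_def)
    moreover have "h (q + 1) (diff I q x) \<in> carrier (obj T (q + 1))"
      using lmod_hom_closed[OF h[of "q + 1"]] lmod_hom_closed[OF complex_diff[OF I'(1) refl] x] True
      by (simp add: augmented_def)
    ultimately show ?thesis
      using rel[of x q] x True Tq.M.minus_eq_zero_iff[of "diff T q (h q x)" "h (q + 1) (diff I q x)"] by (simp add: augmented_def g_def)
  next
    case False
    then have "x = \<zero>\<^bsub>obj I q\<^esub>" using x I'(2)[of q] by simp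
    then have "diff I q x = \<zero>\<^bsub>obj I (q + 1)\<^esub>"
      using lmod_hom_zero[OF complex_diff[OF I'(1) refl] oI oI] by simp
    moreover have "h (q + 1) \<zero>\<^bsub>obj I (q + 1)\<^esub> = \<zero>\<^bsub>obj T (q + 1)\<^esub>"
      by (rule lmod_hom_zero[OF \<open>h (q + 1) \<in> lmod_hom R (obj I (q + 1)) (obj T (q + 1))\<close> oI oT])
    ultimately show ?thesis
      using False low lmod_hom_zero[OF dT[OF refl, of q] oT oT] by simp
  qed
  moreover have "h 0 (\<eta> m) = \<theta> m" if m: "m \<in> carrier M" for m
  proof -
    have \<eta>m: "\<eta> m \<in> carrier (obj (augmented I) (-1))" using m I'(5) by (auto simp: augmented_def)
    then have "\<eta> m \<in> carrier (obj I 0)" by (auto simp: augmented_def cocycles_def)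
    then have hm: "h 0 (\<eta> m) \<in> carrier (obj T 0)" using lmod_hom_closed[OF h[of 0]] by (simp add: augmented_def)
    have "\<ominus>\<^bsub>obj T 0\<^esub> \<theta> m = diff T (-1) \<zero>\<^bsub>obj T (-1)\<^esub> \<ominus>\<^bsub>obj T 0\<^esub> h 0 (\<eta> m)"
      using rel[OF \<eta>m] inv[OF m] by (simp add: g_def low augmented_def)
    then have "\<ominus>\<^bsub>obj T 0\<^esub> \<theta> m = \<ominus>\<^bsub>obj T 0\<^esub> h 0 (\<eta> m)"
      using lmod_hom_zero[OF dT[OF refl, of "-1"] oT oT] hm by (simp add: T0.minus_eq)
    then show ?thesis using hm lmod_hom_closed[OF T'(5) m] by (metis T0.M.minus_minus)
  qed
  ultimately have "comparison R M I \<eta> T \<theta> h" by (simp add: comparison_def chain_map_def)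
  then show ?thesis by blast
qed

text \<open>The difference \<open>c - c'\<close>, continued by zero to degree \<open>-1\<close>, is a chain map on the augmented complex, hence
  equal to \<open>d s + s d\<close>. The second term vanishes on cocycles.\<close>

lemma comparison_unique:
  assumes M: "left_module R M" and I: "injective_resolution R M I \<eta>" and T: "tate_resolution R M T \<theta>"
    and c: "comparison R M I \<eta> T \<theta> c" and c': "comparison R M I \<eta> T \<theta> c'"
  shows "\<exists>s\<in>lmod_hom R (obj I n) (obj T (n - 1)).
    \<forall>z\<in>cocycles I n. c n z \<ominus>\<^bsub>obj T n\<^esub> c' n z = diff T (n - 1) (s z)"
proof -
  note I' = injective_resolutionD[OF I] and T' = tate_resolutionD[OF M T]
  note oI = complex_obj[OF I'(1)] and oT = complex_obj[OF T'(1)]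
  note A = augmented[OF I'(1)]
  note dT = complex_diff[OF T'(1)]
  have cm: "chain_map R I T c" "chain_map R I T c'" using c c' by (auto simp: comparison_def)
  note ch = chain_map_hom[OF cm(1)] chain_map_hom[OF cm(2)]
  define g where "g q = (if q \<ge> 0 then \<lambda>x. c q x \<ominus>\<^bsub>obj T q\<^esub> c' q x else (\<lambda>_. \<zero>\<^bsub>obj T q\<^esub>))" for q
  have g: "g q \<in> lmod_hom R (obj (augmented I) q) (obj T (q + 0))" for q
    using lmod_hom_sub[OF oT ch] lmod_hom_const_zero[OF oT] by (auto simp: g_def augmented_def)
  have cocycle: "diff T (q + 0) (g q x) = koszul (obj T (q + 0 + 1)) 0 (g (q + 1) (diff (augmented I) q x))"
    if x: "x \<in> carrier (obj (augmented I) q)" for q x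
  proof -
    interpret Tq: left_module R "obj T (q + 1)" by (rule oT)
    have d_zero: "diff T q \<zero>\<^bsub>obj T q\<^esub> = \<zero>\<^bsub>obj T (q + 1)\<^esub>"
      by (rule lmod_hom_zero[OF dT[OF refl] oT oT])
    consider "q \<ge> 0" | "q = -1" | "q < -1" by linarith
    then show ?thesis
    proof cases
      case 1
      then have x: "x \<in> carrier (obj I q)" using x by (simp add: augmented_def)
      show ?thesis
        using 1 lmod_hom_diff[OF dT[OF refl] oT oT lmod_hom_closed[OF ch(1) x] lmod_hom_closed[OF ch(2) x]]
        by (simp add: g_def augmented_def koszul_def chain_map_diff[OF cm(1) x] chain_map_diff[OF cm(2) x])
    next
      case 2
      then obtain m where m: "m \<in> carrier M" "x = \<eta> m" using x I'(5) by (auto simp: augmented_def)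
      then have "c 0 x = \<theta> m" "c' 0 x = \<theta> m" using c c' by (auto simp: comparison_def)
      then show ?thesis
        using 2 d_zero Tq.M.minus_eq_zero_iff[of "\<theta> m" "\<theta> m"] lmod_hom_closed[OF T'(5) m(1)]
        by (simp add: g_def augmented_def koszul_def)
    next
      case 3
      then show ?thesis using d_zero by (simp add: g_def koszul_def)
    qed
  qed
  have "\<exists>h. null_homotopy R (augmented I) T 0 g h \<and> (\<forall>q\<le>-1. \<forall>x. h q x = \<zero>\<^bsub>obj T (q + 0 - 1)\<^esub>)"
    by (rule null_homotopy_into_injectives[OF A(1) T'(1) T'(3) A(3)[OF I'(6)] A(2) g cocycle])
  then obtain h where H: "null_homotopy R (augmented I) T 0 g h"
    "\<And>q x. q \<le> -1 \<Longrightarrow> h q x = \<zero>\<^bsub>obj T (q + 0 - 1)\<^esub>" by blast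
  have h: "\<And>q. h q \<in> lmod_hom R (obj (augmented I) q) (obj T (q - 1))" using null_homotopy_hom[OF H(1)] by simp
  have rel: "\<And>q x. x \<in> carrier (obj (augmented I) q) \<Longrightarrow> g q x = diff T (q - 1) (h q x)
       \<ominus>\<^bsub>obj T q\<^esub> koszul (obj T q) (- 1) (h (q + 1) (diff (augmented I) q x))"
    using null_homotopy_eq[OF H(1)] by simp
  interpret Tn: left_module R "obj T n" by (rule oT)
  have dn: "diff T (n - 1) \<in> lmod_hom R (obj T (n - 1)) (obj T n)" by (rule dT) simp
  show ?thesis
  proof (cases "n \<ge> 0")
    case True
    then have hn: "h n \<in> lmod_hom R (obj I n) (obj T (n - 1))" using h[of n] by (simp add: augmented_def)
    have "c n z \<ominus>\<^bsub>obj T n\<^esub> c' n z = diff T (n - 1) (h n z)" if z: "z \<in> cocycles I n" for z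
    proof -
      have z': "z \<in> carrier (obj I n)" "diff I n z = \<zero>\<^bsub>obj I (n + 1)\<^esub>" using z by (auto simp: cocycles_def)
      have "h (n + 1) \<zero>\<^bsub>obj I (n + 1)\<^esub> = \<zero>\<^bsub>obj T n\<^esub>"
        using lmod_hom_zero[OF h[of "n + 1"] complex_obj[OF A(1)] oT] True by (simp add: augmented_def)
      then show ?thesis
        using rel[of z n] True z' koszul_zero[OF Tn.M.abelian_group_axioms]
          lmod_hom_closed[OF lmod_hom_comp[OF hn dn], of z]
        by (simp add: g_def augmented_def Tn.minus_eq)
    qed
    then show ?thesis using hn by blast
  next
    case False
    have "c n z \<ominus>\<^bsub>obj T n\<^esub> c' n z = diff T (n - 1) \<zero>\<^bsub>obj T (n - 1)\<^esub>" if "z \<in> cocycles I n" for z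
    proof -
      have "z = \<zero>\<^bsub>obj I n\<^esub>" using that I'(2)[of n] False by (auto simp: cocycles_def)
      then show ?thesis
        using lmod_hom_zero[OF ch(1)[of n] oI oT] lmod_hom_zero[OF ch(2)[of n] oI oT]
          lmod_hom_zero[OF dn oT oT] by (simp add: Tn.minus_eq)
    qed
    then show ?thesis
      by (intro bexI[OF _ lmod_hom_const_zero[OF oT]]) simp
  qed
qed

section \<open>The cone of a comparison map\<close>

definition pair_module :: "('r, 'm) module \<Rightarrow> ('r, 'n) module \<Rightarrow> ('r, 'm \<times> 'n) module"
  where "pair_module M N =
    \<lparr>carrier = carrier M \<times> carrier N, mult = undefined, one = undefined, zero = (\<zero>\<^bsub>M\<^esub>, \<zero>\<^bsub>N\<^esub>),
     add = (\<lambda>x y. (fst x \<oplus>\<^bsub>M\<^esub> fst y, snd x \<oplus>\<^bsub>N\<^esub> snd y)),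
     smult = (\<lambda>a x. (a \<odot>\<^bsub>M\<^esub> fst x, a \<odot>\<^bsub>N\<^esub> snd x))\<rparr>"

lemma pair_module_simps [simp]:
  "carrier (pair_module M N) = carrier M \<times> carrier N"
  "\<zero>\<^bsub>pair_module M N\<^esub> = (\<zero>\<^bsub>M\<^esub>, \<zero>\<^bsub>N\<^esub>)"
  "x \<oplus>\<^bsub>pair_module M N\<^esub> y = (fst x \<oplus>\<^bsub>M\<^esub> fst y, snd x \<oplus>\<^bsub>N\<^esub> snd y)"
  "a \<odot>\<^bsub>pair_module M N\<^esub> x = (a \<odot>\<^bsub>M\<^esub> fst x, a \<odot>\<^bsub>N\<^esub> snd x)"
  by (simp_all add: pair_module_def)

lemma left_module_pair:
  assumes "left_module R M" "left_module R N" shows "left_module R (pair_module M N)"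
proof -
  interpret M: left_module R M by fact
  interpret N: left_module R N by fact
  show ?thesis
  proof (rule left_moduleI)
    show "abelian_group (pair_module M N)"
    proof (rule abelian_groupI)
      fix x assume "x \<in> carrier (pair_module M N)"
      then show "\<exists>y\<in>carrier (pair_module M N). y \<oplus>\<^bsub>pair_module M N\<^esub> x = \<zero>\<^bsub>pair_module M N\<^esub>"
        by (intro bexI[of _ "(\<ominus>\<^bsub>M\<^esub> fst x, \<ominus>\<^bsub>N\<^esub> snd x)"]) (auto simp: M.l_neg N.l_neg)
    qed (auto simp: M.a_ac N.a_ac)
  qed (auto simp: M.R.ring_axioms M.smult_l_distr M.smult_r_distr M.smult_assoc1
      N.smult_l_distr N.smult_r_distr N.smult_assoc1)
qed

lemma pair_module_uminus:
  assumes "left_module R M" "left_module R N" and x: "x \<in> carrier (pair_module M N)"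
  shows "\<ominus>\<^bsub>pair_module M N\<^esub> x = (\<ominus>\<^bsub>M\<^esub> fst x, \<ominus>\<^bsub>N\<^esub> snd x)"
proof -
  interpret M: left_module R M by fact
  interpret N: left_module R N by fact
  interpret P: left_module R "pair_module M N" by (rule left_module_pair) fact+
  show ?thesis by (rule P.minus_equality) (use x in \<open>auto simp: M.l_neg N.l_neg\<close>)
qed

definition cone :: "('r, 'm) cochain \<Rightarrow> ('r, 'n) cochain \<Rightarrow> (int \<Rightarrow> 'm \<Rightarrow> 'n) \<Rightarrow> ('r, 'm \<times> 'n) cochain"
  where "cone C D f =
    \<lparr>obj = (\<lambda>n. pair_module (obj C (n + 1)) (obj D n)),
     diff = (\<lambda>n x. (\<ominus>\<^bsub>obj C (n + 2)\<^esub> diff C (n + 1) (fst x), f (n + 1) (fst x) \<oplus>\<^bsub>obj D (n + 1)\<^esub> diff D n (snd x)))\<rparr>"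

lemma cone_complex:
  assumes C: "cochain_complex R C" and D: "cochain_complex R D" and f: "chain_map R C D f"
  shows "cochain_complex R (cone C D f)"
  unfolding cochain_complex_def
proof (intro conjI allI ballI)
  note oC = complex_obj[OF C] and oD = complex_obj[OF D]
  fix n
  interpret C: left_module R "obj C (n + 2)" by (rule oC)
  interpret D: left_module R "obj D (n + 1)" by (rule oD)
  interpret C': left_module R "obj C (n + 3)" by (rule oC)
  interpret D': left_module R "obj D (n + 2)" by (rule oD)
  note fh = chain_map_hom[OF f, of "n + 1"] chain_map_hom[OF f, of "n + 2"]
  have dC: "diff C (n + 1) \<in> lmod_hom R (obj C (n + 1)) (obj C (n + 2))"
      "diff C (n + 2) \<in> lmod_hom R (obj C (n + 2)) (obj C (n + 3))"
    and dD: "diff D n \<in> lmod_hom R (obj D n) (obj D (n + 1))"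
      "diff D (n + 1) \<in> lmod_hom R (obj D (n + 1)) (obj D (n + 2))"
    by (auto intro!: complex_diff[OF C] complex_diff[OF D])
  show "left_module R (obj (cone C D f) n)"
    by (simp add: cone_def left_module_pair oC oD)
  show "diff (cone C D f) n \<in> lmod_hom R (obj (cone C D f) n) (obj (cone C D f) (n + 1))"
    by (rule lmod_homI)
       (use dC dD in \<open>auto simp: cone_def add.assoc lmod_hom_closed[OF fh(1)] lmod_hom_closed[OF dC(1)]
        lmod_hom_closed[OF dD(1)] lmod_hom_add[OF fh(1)] lmod_hom_add[OF dC(1)] lmod_hom_add[OF dD(1)]
        lmod_hom_smult[OF fh(1)] lmod_hom_smult[OF dC(1)] lmod_hom_smult[OF dD(1)] C.minus_add C.smult_r_minus
        D.smult_r_distr D.a_ac\<close>)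
  fix x assume "x \<in> carrier (obj (cone C D f) n)"
  then have x: "fst x \<in> carrier (obj C (n + 1))" "snd x \<in> carrier (obj D n)" by (auto simp: cone_def)
  have cl: "diff C (n + 1) (fst x) \<in> carrier (obj C (n + 2))" "f (n + 1) (fst x) \<in> carrier (obj D (n + 1))"
    "diff D n (snd x) \<in> carrier (obj D (n + 1))" "diff D (n + 1) (f (n + 1) (fst x)) \<in> carrier (obj D (n + 2))"
    using x by (auto intro!: lmod_hom_closed[OF dC(1)] lmod_hom_closed[OF dD(1)] lmod_hom_closed[OF fh(1)]
      lmod_hom_closed[OF dD(2)])
  have fd: "f (n + 2) (diff C (n + 1) (fst x)) = diff D (n + 1) (f (n + 1) (fst x))"
    using chain_map_diff[OF f x(1)] by (simp add: ac_simps)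
  have 1: "diff C (n + 2) (\<ominus>\<^bsub>obj C (n + 2)\<^esub> diff C (n + 1) (fst x)) = \<zero>\<^bsub>obj C (n + 3)\<^esub>"
    using complex_diff_diff[OF C x(1), of "n + 2" "n + 3"] lmod_hom_minus[OF dC(2) oC oC cl(1)]
      C'.M.uminus_zero by simp
  have 2: "f (n + 2) (\<ominus>\<^bsub>obj C (n + 2)\<^esub> diff C (n + 1) (fst x)) =
      \<ominus>\<^bsub>obj D (n + 2)\<^esub> diff D (n + 1) (f (n + 1) (fst x))"
    using lmod_hom_minus[OF fh(2) oC oD cl(1)] fd by simp
  have 3: "diff D (n + 1) (f (n + 1) (fst x) \<oplus>\<^bsub>obj D (n + 1)\<^esub> diff D n (snd x)) =
      diff D (n + 1) (f (n + 1) (fst x))"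
    using lmod_hom_add[OF dD(2) cl(2,3)] complex_diff_diff[OF D x(2), of "n + 1" "n + 2"] cl by simp
  show "diff (cone C D f) (n + 1) (diff (cone C D f) n x) = \<zero>\<^bsub>obj (cone C D f) (n + 2)\<^esub>"
    using 1 2 3 cl C'.M.uminus_zero by (simp add: cone_def add.commute[of _ n] add.assoc D'.l_neg)
qed

text \<open>The components in negative degrees are the zero submodules of those of \<open>T\<close>, so that the operations and
  the differential of \<open>T\<close> can be kept.\<close>

definition truncated :: "('r, 'm) cochain \<Rightarrow> ('r, 'm) cochain"
  where "truncated T =
    \<lparr>obj = (\<lambda>n. if n \<ge> 0 then obj T n else (obj T n)\<lparr>carrier := {\<zero>\<^bsub>obj T n\<^esub>}\<rparr>), diff = diff T\<rparr>"

lemma truncated_complex: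
  assumes T: "cochain_complex R T" shows "cochain_complex R (truncated T)"
  unfolding cochain_complex_def
proof (intro conjI allI ballI)
  note oT = complex_obj[OF T]
  fix n
  note d = complex_diff[OF T refl, of n]
  have d0: "diff T n \<zero>\<^bsub>obj T n\<^esub> = \<zero>\<^bsub>obj T (n + 1)\<^esub>" by (rule lmod_hom_zero[OF d oT oT])
  interpret left_module R "obj T n" by (rule oT)
  interpret T': left_module R "obj T (n + 1)" by (rule oT)
  show "left_module R (obj (truncated T) n)"
    by (simp add: truncated_def oT left_module_submod[OF oT] submod_zero[OF oT])
  show "diff (truncated T) n \<in> lmod_hom R (obj (truncated T) n) (obj (truncated T) (n + 1))"
    using d d0 by (cases "n \<ge> 0") (auto simp: truncated_def intro!: lmod_homI)
  fix x assume x: "x \<in> carrier (obj (truncated T) n)"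
  then have "x \<in> carrier (obj T n)" by (auto simp: truncated_def split: if_splits)
  from complex_diff_diff[OF T this refl refl]
  show "diff (truncated T) (n + 1) (diff (truncated T) n x) = \<zero>\<^bsub>obj (truncated T) (n + 2)\<^esub>"
    by (simp add: truncated_def)
qed

text \<open>In negative degrees \<open>I\<close> is zero, so \<open>c\<close> takes values in the truncation.\<close>

lemma comparison_truncated:
  assumes I: "injective_resolution R M I \<eta>" and T: "cochain_complex R T" and c: "chain_map R I T c"
  shows "chain_map R I (truncated T) c"
  unfolding chain_map_def
proof (intro conjI allI ballI)
  note I' = injective_resolutionD[OF I]
  fix n
  note cn = chain_map_hom[OF c, of n]
  interpret I: left_module R "obj I n" by (rule complex_obj[OF I'(1)])
  interpret T: left_module R "obj T n" by (rule complex_obj[OF T])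
  show "c n \<in> lmod_hom R (obj I n) (obj (truncated T) n)"
  proof (cases "n \<ge> 0")
    case False
    then have "c n x = \<zero>\<^bsub>obj T n\<^esub>" if "x \<in> carrier (obj I n)" for x
      using that I'(2)[of n] lmod_hom_zero[OF cn complex_obj[OF I'(1)] complex_obj[OF T]] by auto
    then show ?thesis
      using False by (auto simp: truncated_def intro!: lmod_homI)
  qed (use cn in \<open>simp add: truncated_def\<close>)
  fix x assume "x \<in> carrier (obj I n)"
  then show "c (n + 1) (diff I n x) = diff (truncated T) n (c n x)"
    using chain_map_diff[OF c] by (simp add: truncated_def)
qed

text \<open>Both \<open>I\<close> and the truncation resolve \<open>M\<close>, and \<open>c\<close> lies over the identity of \<open>M\<close>. Let \<open>(a, t)\<close> be a cocycle
  of the cone. If \<open>n \<ge> 0\<close> then \<open>a = d b\<close>, and \<open>t + c b\<close> is a cocycle of \<open>T\<close>. It is a coboundary in the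
  truncation if \<open>n > 0\<close>; for \<open>n = 0\<close> it has the form \<open>\<theta> m = c \<eta> m\<close>, and \<open>b\<close> is corrected by \<open>\<eta> m\<close>. If
  \<open>n = -1\<close> then \<open>a = \<eta> m\<close> with \<open>\<theta> m = 0\<close>.\<close>

lemma cone_exact:
  assumes M: "left_module R M" and I: "injective_resolution R M I \<eta>" and T: "tate_resolution R M T \<theta>"
    and c: "comparison R M I \<eta> T \<theta> c"
  shows "cocycles (cone I (truncated T) c) n \<subseteq> coboundaries (cone I (truncated T) c) n"
proof
  note I' = injective_resolutionD[OF I] and T' = tate_resolutionD[OF M T]
  note oI = complex_obj[OF I'(1)] and oT = complex_obj[OF T'(1)]
  have cm: "chain_map R I T c" and c\<eta>: "\<And>m. m \<in> carrier M \<Longrightarrow> c 0 (\<eta> m) = \<theta> m"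
    using c by (auto simp: comparison_def)
  interpret M: left_module R M by fact
  interpret Tn: left_module R "obj T n" by (rule oT)
  interpret In: left_module R "obj I n" by (rule oI)
  interpret I1: left_module R "obj I (n + 1)" by (rule oI)
  interpret I2: left_module R "obj I (n + 2)" by (rule oI)
  interpret T1: left_module R "obj T (n + 1)" by (rule oT)
  note cn = chain_map_hom[OF cm, of n]
  have dI: "diff I n \<in> lmod_hom R (obj I n) (obj I (n + 1))"
    and dI1: "diff I (n + 1) \<in> lmod_hom R (obj I (n + 1)) (obj I (n + 2))"
    and dT: "diff T n \<in> lmod_hom R (obj T n) (obj T (n + 1))"
    by (auto intro!: complex_diff[OF I'(1)] complex_diff[OF T'(1)])
  fix x assume x: "x \<in> cocycles (cone I (truncated T) c) n"
  obtain a t where x_eq: "x = (a, t)" by (cases x)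
  have a: "a \<in> carrier (obj I (n + 1))" and t: "t \<in> carrier (obj (truncated T) n)" "t \<in> carrier (obj T n)"
    and da: "diff I (n + 1) a = \<zero>\<^bsub>obj I (n + 2)\<^esub>"
    and ct: "c (n + 1) a \<oplus>\<^bsub>obj T (n + 1)\<^esub> diff T n t = \<zero>\<^bsub>obj T (n + 1)\<^esub>"
  proof -
    show a: "a \<in> carrier (obj I (n + 1))" and "t \<in> carrier (obj (truncated T) n)"
      using x by (auto simp: x_eq cocycles_def cone_def)
    then show "t \<in> carrier (obj T n)" by (auto simp: truncated_def split: if_splits)
    have "\<ominus>\<^bsub>obj I (n + 2)\<^esub> diff I (n + 1) a = \<zero>\<^bsub>obj I (n + 2)\<^esub>"
      using x by (auto simp: x_eq cocycles_def cone_def add.assoc)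
    then show "diff I (n + 1) a = \<zero>\<^bsub>obj I (n + 2)\<^esub>"
      using I2.M.minus_minus[OF lmod_hom_closed[OF dI1 a]] I2.M.uminus_zero by auto
    show "c (n + 1) a \<oplus>\<^bsub>obj T (n + 1)\<^esub> diff T n t = \<zero>\<^bsub>obj T (n + 1)\<^esub>"
      using x by (auto simp: x_eq cocycles_def cone_def truncated_def split: if_splits)
  qed
  have idx: "n - 1 + 2 = n + 1" by simp
  \<comment> \<open>Here \<open>x\<close> is the boundary of \<open>(-b, s)\<close>.\<close>
  have bd: "x \<in> coboundaries (cone I (truncated T) c) n"
    if b: "b \<in> carrier (obj I n)" "diff I n b = a" and s: "s \<in> carrier (obj (truncated T) (n - 1))"
      and ds: "diff T (n - 1) s = t \<oplus>\<^bsub>obj T n\<^esub> c n b" for b s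
  proof -
    have "diff (cone I (truncated T) c) (n - 1) (\<ominus>\<^bsub>obj I n\<^esub> b, s) =
        (a, \<ominus>\<^bsub>obj T n\<^esub> c n b \<oplus>\<^bsub>obj T n\<^esub> (t \<oplus>\<^bsub>obj T n\<^esub> c n b))"
      using b ds a lmod_hom_minus[OF dI oI oI b(1)] lmod_hom_minus[OF cn oI oT b(1)]
      by (simp add: cone_def truncated_def idx)
    also have "\<dots> = x"
      using t lmod_hom_closed[OF cn b(1)] by (simp add: x_eq Tn.a_ac Tn.r_neg Tn.r_neg1 Tn.r_neg2)
    finally have "x = diff (cone I (truncated T) c) (n - 1) (\<ominus>\<^bsub>obj I n\<^esub> b, s)" by simp
    moreover have "(\<ominus>\<^bsub>obj I n\<^esub> b, s) \<in> carrier (obj (cone I (truncated T) c) (n - 1))"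
      using b s by (simp add: cone_def)
    ultimately show ?thesis by (auto simp: coboundaries_def)
  qed
  have "t = \<zero>\<^bsub>obj T n\<^esub>" if "n < 0" using t(1) that by (simp add: truncated_def)
  have zero_s: "\<zero>\<^bsub>obj T (n - 1)\<^esub> \<in> carrier (obj (truncated T) (n - 1))"
    using left_module.axioms(2)[OF oT[of "n - 1"]]
    by (auto simp: truncated_def abelian_group_def abelian_monoid.zero_closed)
  have d_zero: "diff T (n - 1) \<zero>\<^bsub>obj T (n - 1)\<^esub> = \<zero>\<^bsub>obj T n\<^esub>"
    by (rule lmod_hom_zero[OF complex_diff[OF T'(1)] oT oT]) simp
  consider "n < 0" | "n \<ge> 0" by linarith
  then show "x \<in> coboundaries (cone I (truncated T) c) n"
  proof cases
    case 1
    have a0: "a = \<zero>\<^bsub>obj I (n + 1)\<^esub>"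
    proof (cases "n = -1")
      case True
      then have "a \<in> cocycles I 0" using a da by (simp add: cocycles_def)
      then obtain m where m: "m \<in> carrier M" "a = \<eta> m" using I'(5) by auto
      have "diff T n \<zero>\<^bsub>obj T n\<^esub> = \<zero>\<^bsub>obj T (n + 1)\<^esub>" by (rule lmod_hom_zero[OF dT oT oT])
      then have "\<theta> m = \<zero>\<^bsub>obj T 0\<^esub>"
        using ct True m c\<eta> lmod_hom_closed[OF T'(5) m(1)] \<open>n < 0 \<Longrightarrow> t = \<zero>\<^bsub>obj T n\<^esub>\<close> T1.r_zero by simp
      then have "m = \<zero>\<^bsub>M\<^esub>"
        using inj_onD[OF T'(6) _ m(1) M.M.zero_closed] lmod_hom_zero[OF T'(5) M oT] by simp
      then show ?thesis using m lmod_hom_zero[OF I'(3) M oI] True by simp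
    next
      case False
      then show ?thesis using I'(2)[of "n + 1"] 1 a by simp
    qed
    show ?thesis
      by (rule bd[OF In.M.zero_closed _ zero_s])
         (use 1 a0 d_zero \<open>n < 0 \<Longrightarrow> t = \<zero>\<^bsub>obj T n\<^esub>\<close> lmod_hom_zero[OF dI oI oI]
            lmod_hom_zero[OF cn oI oT] in simp_all)
  next
    case 2
    have "a \<in> coboundaries I (n + 1)" using I'(6)[of "n + 1"] 2 a da by (auto simp: cocycles_def add.assoc)
    then obtain b where b: "b \<in> carrier (obj I n)" "diff I n b = a" by (auto simp: coboundaries_def)
    have cb: "c n b \<in> carrier (obj T n)" by (rule lmod_hom_closed[OF cn b(1)])
    have "diff T n (t \<oplus>\<^bsub>obj T n\<^esub> c n b) = diff T n t \<oplus>\<^bsub>obj T (n + 1)\<^esub> c (n + 1) a"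
      using lmod_hom_add[OF dT t(2) cb] chain_map_diff[OF cm b(1)] b(2) by simp
    also have "\<dots> = \<zero>\<^bsub>obj T (n + 1)\<^esub>"
      using ct T1.a_comm lmod_hom_closed[OF dT t(2)] lmod_hom_closed[OF chain_map_hom[OF cm] a] by simp
    finally have "t \<oplus>\<^bsub>obj T n\<^esub> c n b \<in> cocycles T n" using t(2) cb by (simp add: cocycles_def)
    show ?thesis
    proof (cases "n = 0")
      case True
      then obtain m where m: "m \<in> carrier M" "t \<oplus>\<^bsub>obj T n\<^esub> c n b = \<theta> m"
        using T'(7) \<open>t \<oplus>\<^bsub>obj T n\<^esub> c n b \<in> cocycles T n\<close> by auto
      have \<eta>m: "\<eta> m \<in> cocycles I 0" using m(1) I'(5) by auto
      then have \<eta>m': "\<eta> m \<in> carrier (obj I n)" "diff I n (\<eta> m) = \<zero>\<^bsub>obj I (n + 1)\<^esub>"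
        using True by (auto simp: cocycles_def)
      have "c n (\<eta> m) = t \<oplus>\<^bsub>obj T n\<^esub> c n b" using True c\<eta>[OF m(1)] m(2) by simp
      then have "t \<oplus>\<^bsub>obj T n\<^esub> c n (b \<ominus>\<^bsub>obj I n\<^esub> \<eta> m) = \<zero>\<^bsub>obj T n\<^esub>"
        using lmod_hom_diff[OF cn oI oT b(1) \<eta>m'(1)] t(2) cb
        by (simp add: Tn.minus_eq Tn.a_assoc[symmetric] Tn.r_neg)
      moreover have "diff I n (b \<ominus>\<^bsub>obj I n\<^esub> \<eta> m) = a"
        using lmod_hom_diff[OF dI oI oI b(1) \<eta>m'(1)] \<eta>m'(2) b(2) a by (simp add: I1.minus_eq)
      ultimately show ?thesis
        using bd[of "b \<ominus>\<^bsub>obj I n\<^esub> \<eta> m", OF _ _ zero_s] b(1) \<eta>m'(1) d_zero by simp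
    next
      case False
      have "t \<oplus>\<^bsub>obj T n\<^esub> c n b \<in> coboundaries T n"
        using T'(4) \<open>t \<oplus>\<^bsub>obj T n\<^esub> c n b \<in> cocycles T n\<close> by simp
      then obtain s where "s \<in> carrier (obj T (n - 1))" "diff T (n - 1) s = t \<oplus>\<^bsub>obj T n\<^esub> c n b"
        by (auto simp: coboundaries_def)
      then show ?thesis using bd[OF b] 2 False by (simp add: truncated_def)
    qed
  qed
qed

lemma hom_from_cone_acyclic:
  fixes R :: "('r, 'c) ring_scheme" and I :: "('r, 'i) cochain" and T :: "('r, 't) cochain"
  assumes one: "\<one>\<^bsub>R\<^esub> \<noteq> \<zero>\<^bsub>R\<^esub>"
    and M: "left_module R M" and I: "injective_resolution R M I \<eta>" and T: "tate_resolution R M T \<theta>"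
    and c: "comparison R M I \<eta> T \<theta> c"
    and \<beta>: "\<And>q. \<beta> q \<in> lmod_hom R (obj T q) (obj T (q + n))"
    and \<gamma>: "\<And>q. \<gamma> q \<in> lmod_hom R (obj I q) (obj T (q + n - 1))"
    and d\<beta>: "\<And>q t. t \<in> carrier (obj T q) \<Longrightarrow>
      diff T (q + n) (\<beta> q t) = koszul (obj T (q + n + 1)) n (\<beta> (q + 1) (diff T q t))"
    and d\<gamma>: "\<And>q a. a \<in> carrier (obj I q) \<Longrightarrow> \<beta> q (c q a) =
      diff T (q + n - 1) (\<gamma> q a) \<ominus>\<^bsub>obj T (q + n)\<^esub> koszul (obj T (q + n)) (n - 1) (\<gamma> (q + 1) (diff I q a))"
  shows "\<exists>\<beta>' \<gamma>'. null_homotopy R T T n \<beta> \<beta>' \<and>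
    (\<forall>q. \<gamma>' q \<in> lmod_hom R (obj I q) (obj T (q + n - 2))) \<and>
    (\<forall>q. \<forall>a\<in>carrier (obj I q). \<gamma> q a = \<beta>' q (c q a) \<ominus>\<^bsub>obj T (q + n - 1)\<^esub>
      (diff T (q + n - 2) (\<gamma>' q a) \<ominus>\<^bsub>obj T (q + n - 1)\<^esub>
       koszul (obj T (q + n - 1)) n (\<gamma>' (q + 1) (diff I q a))))"
proof -
  note I' = injective_resolutionD[OF I] and T' = tate_resolutionD[OF M T]
  note oI = complex_obj[OF I'(1)] and oT = complex_obj[OF T'(1)]
  have agT: "abelian_group (obj T m)" for m by (rule left_module_abelian_group[OF oT])
  have kz: "koszul (obj T m) k \<in> lmod_hom R (obj T m) (obj T m)" for m k by (rule koszul_hom[OF oT])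
  have dI: "diff I q \<in> lmod_hom R (obj I q) (obj I (q + 1))" for q by (rule complex_diff[OF I'(1) refl])
  have dT: "diff T q \<in> lmod_hom R (obj T q) (obj T (q + 1))" for q by (rule complex_diff[OF T'(1) refl])
  have dT1: "diff T (q - 1) \<in> lmod_hom R (obj T (q - 1)) (obj T q)" for q by (rule complex_diff[OF T'(1)]) simp
  have cm: "chain_map R I T c" using c by (simp add: comparison_def)
  note ch = chain_map_hom[OF cm]
  have \<gamma>1: "\<gamma> (q + 1) \<in> lmod_hom R (obj I (q + 1)) (obj T (q + n))" for q
    using \<gamma>[of "q + 1"] by (simp add: algebra_simps)
  let ?J = "truncated T"
  let ?X = "cone I ?J c"
  have J: "cochain_complex R ?J" by (rule truncated_complex[OF T'(1)])
  have cJ: "chain_map R I ?J c" by (rule comparison_truncated[OF I T'(1) cm])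
  have X: "cochain_complex R ?X" by (rule cone_complex[OF I'(1) J cJ])
  have X_carrier: "carrier (obj ?X q) = carrier (obj I (q + 1)) \<times> carrier (obj ?J q)" for q
    by (simp add: cone_def)
  have J_sub: "t \<in> carrier (obj T q)" if "t \<in> carrier (obj ?J q)" for t q
    using that left_module.axioms(2)[OF oT[of q]]
    by (auto simp: truncated_def abelian_group_def abelian_monoid.zero_closed split: if_splits)
  have J_zero: "\<zero>\<^bsub>obj T q\<^esub> \<in> carrier (obj ?J q)" "\<zero>\<^bsub>obj ?J q\<^esub> = \<zero>\<^bsub>obj T q\<^esub>" for q
    using left_module.axioms(2)[OF oT[of q]]
    by (auto simp: truncated_def abelian_group_def abelian_monoid.zero_closed)
  have J_add: "x \<oplus>\<^bsub>obj ?J q\<^esub> y = x \<oplus>\<^bsub>obj T q\<^esub> y" "a \<odot>\<^bsub>obj ?J q\<^esub> x = a \<odot>\<^bsub>obj T q\<^esub> x"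
      "diff ?J q = diff T q" for x y a q
    by (auto simp: truncated_def)
  have X_diff: "diff ?X q (a, t) = (\<ominus>\<^bsub>obj I (q + 2)\<^esub> diff I (q + 1) a,
      c (q + 1) a \<oplus>\<^bsub>obj T (q + 1)\<^esub> diff T q t)" for q a t
    by (simp add: cone_def J_add)

  \<comment> \<open>\<open>(\<beta>, \<gamma>)\<close> as one map on the cone; the sign of \<open>\<gamma>\<close> compensates the sign in the cone.\<close>
  define g where "g q x = koszul (obj T (q + n)) n (\<gamma> (q + 1) (fst x)) \<oplus>\<^bsub>obj T (q + n)\<^esub> \<beta> q (snd x)" for q x
  have g: "g q \<in> lmod_hom R (obj ?X q) (obj T (q + n))" for q
  proof -
    interpret Tq: left_module R "obj T (q + n)" by (rule oT)
    note k\<gamma> = lmod_hom_comp[OF \<gamma>1[of q] kz[of _ n]]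
    show ?thesis unfolding g_def
    proof (rule lmod_homI)
      fix x assume "x \<in> carrier (obj ?X q)"
      then have x: "fst x \<in> carrier (obj I (q + 1))" "snd x \<in> carrier (obj T q)"
        using J_sub by (auto simp: X_carrier)
      note cl = lmod_hom_closed[OF k\<gamma> x(1)] lmod_hom_closed[OF \<beta> x(2)]
      show "koszul (obj T (q + n)) n (\<gamma> (q + 1) (fst x)) \<oplus>\<^bsub>obj T (q + n)\<^esub> \<beta> q (snd x) \<in> carrier (obj T (q + n))"
        using cl by simp
      { fix y assume "y \<in> carrier (obj ?X q)"
        then have y: "fst y \<in> carrier (obj I (q + 1))" "snd y \<in> carrier (obj T q)"
          using J_sub by (auto simp: X_carrier)
        show "koszul (obj T (q + n)) n (\<gamma> (q + 1) (fst (x \<oplus>\<^bsub>obj ?X q\<^esub> y))) \<oplus>\<^bsub>obj T (q + n)\<^esub>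
              \<beta> q (snd (x \<oplus>\<^bsub>obj ?X q\<^esub> y)) =
            koszul (obj T (q + n)) n (\<gamma> (q + 1) (fst x)) \<oplus>\<^bsub>obj T (q + n)\<^esub> \<beta> q (snd x) \<oplus>\<^bsub>obj T (q + n)\<^esub>
            (koszul (obj T (q + n)) n (\<gamma> (q + 1) (fst y)) \<oplus>\<^bsub>obj T (q + n)\<^esub> \<beta> q (snd y))"
          using cl lmod_hom_closed[OF k\<gamma> y(1)] lmod_hom_closed[OF \<beta> y(2)] lmod_hom_add[OF k\<gamma> x(1) y(1)]
            lmod_hom_add[OF \<beta> x(2) y(2)]
          by (simp add: cone_def J_add Tq.a_ac) }
      fix a assume a: "a \<in> carrier R"
      show "koszul (obj T (q + n)) n (\<gamma> (q + 1) (fst (a \<odot>\<^bsub>obj ?X q\<^esub> x))) \<oplus>\<^bsub>obj T (q + n)\<^esub>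
          \<beta> q (snd (a \<odot>\<^bsub>obj ?X q\<^esub> x)) =
        a \<odot>\<^bsub>obj T (q + n)\<^esub> (koszul (obj T (q + n)) n (\<gamma> (q + 1) (fst x)) \<oplus>\<^bsub>obj T (q + n)\<^esub> \<beta> q (snd x))"
        using cl lmod_hom_smult[OF k\<gamma> a x(1)] lmod_hom_smult[OF \<beta> a x(2)] a
        by (simp add: cone_def J_add Tq.smult_r_distr)
    qed
  qed
  have g_cocycle: "diff T (q + n) (g q x) = koszul (obj T (q + n + 1)) n (g (q + 1) (diff ?X q x))"
    if x: "x \<in> carrier (obj ?X q)" for q x
  proof -
    obtain a t where x_eq: "x = (a, t)" by (cases x)
    have a: "a \<in> carrier (obj I (q + 1))" and t: "t \<in> carrier (obj T q)"
      using x J_sub by (auto simp: x_eq X_carrier)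
    interpret Tq: left_module R "obj T (q + n)" by (rule oT)
    interpret T1: left_module R "obj T (q + n + 1)" by (rule oT)
    have idx: "q + 1 + n = q + n + 1" "q + 1 + 1 = q + 2" "q + 1 + n - 1 = q + n"
        "q + n + 1 - 1 = q + n" by simp_all
    have da: "diff I (q + 1) a \<in> carrier (obj I (q + 2))" using lmod_hom_closed[OF dI a] by (simp add: add.assoc)
    have \<gamma>2: "\<gamma> (q + 2) \<in> lmod_hom R (obj I (q + 2)) (obj T (q + n + 1))"
      using \<gamma>1[of "q + 1"] by (simp only: idx)
    have \<beta>1: "\<beta> (q + 1) \<in> lmod_hom R (obj T (q + 1)) (obj T (q + n + 1))"
      using \<beta>[of "q + 1"] by (simp only: idx)
    have ca: "c (q + 1) a \<in> carrier (obj T (q + 1))" by (rule lmod_hom_closed[OF ch a])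
    have dt: "diff T q t \<in> carrier (obj T (q + 1))" by (rule lmod_hom_closed[OF dT t])
    have cl: "\<gamma> (q + 1) a \<in> carrier (obj T (q + n))" "\<beta> q t \<in> carrier (obj T (q + n))"
      "\<gamma> (q + 2) (diff I (q + 1) a) \<in> carrier (obj T (q + n + 1))"
      "\<beta> (q + 1) (c (q + 1) a) \<in> carrier (obj T (q + n + 1))"
      "\<beta> (q + 1) (diff T q t) \<in> carrier (obj T (q + n + 1))"
      "diff T (q + n) (\<gamma> (q + 1) a) \<in> carrier (obj T (q + n + 1))"
      by (rule lmod_hom_closed[OF \<gamma>1 a] lmod_hom_closed[OF \<beta> t] lmod_hom_closed[OF \<gamma>2 da]
          lmod_hom_closed[OF \<beta>1 ca] lmod_hom_closed[OF \<beta>1 dt] lmod_hom_closed[OF lmod_hom_comp[OF \<gamma>1 dT] a])+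
    have "diff T (q + n) (g q x) = koszul (obj T (q + n + 1)) n (diff T (q + n) (\<gamma> (q + 1) a))
        \<oplus>\<^bsub>obj T (q + n + 1)\<^esub> koszul (obj T (q + n + 1)) n (\<beta> (q + 1) (diff T q t))"
      using lmod_hom_add[OF dT koszul_closed[OF agT cl(1)] cl(2)] hom_koszul[OF dT oT oT cl(1)] d\<beta>[OF t]
      by (simp add: g_def x_eq)
    moreover have "\<beta> (q + 1) (c (q + 1) a) = diff T (q + n) (\<gamma> (q + 1) a) \<ominus>\<^bsub>obj T (q + n + 1)\<^esub>
        koszul (obj T (q + n + 1)) (n - 1) (\<gamma> (q + 2) (diff I (q + 1) a))"
      using d\<gamma>[OF a] by (simp only: idx)
    moreover have "g (q + 1) (diff ?X q x) =
        koszul (obj T (q + n + 1)) n (\<ominus>\<^bsub>obj T (q + n + 1)\<^esub> \<gamma> (q + 2) (diff I (q + 1) a)) \<oplus>\<^bsub>obj T (q + n + 1)\<^esub>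
        (\<beta> (q + 1) (c (q + 1) a) \<oplus>\<^bsub>obj T (q + n + 1)\<^esub> \<beta> (q + 1) (diff T q t))"
      using lmod_hom_minus[OF \<gamma>2 oI oT da] lmod_hom_add[OF \<beta>1 ca dt]
      by (simp only: g_def x_eq X_diff fst_conv snd_conv idx)
    ultimately show ?thesis
      using cl by (simp add: koszul_def T1.minus_eq T1.minus_add T1.a_ac T1.r_neg T1.r_neg1 T1.r_neg2)
  qed
  have "\<exists>h. null_homotopy R ?X T n g h \<and> (\<forall>q\<le>-1. \<forall>x. h q x = \<zero>\<^bsub>obj T (q + n - 1)\<^esub>)"
  proof (rule null_homotopy_into_injectives[OF X T'(1) T'(3) cone_exact[OF M I T c] _ g g_cocycle])
    fix q :: int assume "q < -1"
    then show "carrier (obj ?X q) = {\<zero>\<^bsub>obj ?X q\<^esub>}"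
      using I'(2)[of "q + 1"] by (simp add: cone_def truncated_def)
  qed
  then obtain h where h: "null_homotopy R ?X T n g h" by blast
  have hh: "h q \<in> lmod_hom R (obj ?X q) (obj T (q + n - 1))" for q by (rule null_homotopy_hom[OF h refl])
  have hh1: "h (q + 1) \<in> lmod_hom R (obj ?X (q + 1)) (obj T (q + n))" for q
    by (rule null_homotopy_hom[OF h]) simp
  have oX: "left_module R (obj ?X q)" for q by (rule complex_obj[OF X])
  have inl: "(\<lambda>a. (a, \<zero>\<^bsub>obj T q\<^esub>)) \<in> lmod_hom R (obj I (q + 1)) (obj ?X q)" for q
  proof -
    interpret Tq: left_module R "obj T q" by (rule oT)
    show ?thesis by (rule lmod_homI) (auto simp: cone_def J_zero J_add)
  qed
  have inr: "(\<lambda>t. (\<zero>\<^bsub>obj I (q + 1)\<^esub>, t)) \<in> lmod_hom R (obj ?J q) (obj ?X q)" for q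
  proof -
    interpret Iq: left_module R "obj I (q + 1)" by (rule oI)
    interpret Jq: left_module R "obj ?J q" by (rule complex_obj[OF J])
    show ?thesis by (rule lmod_homI) (auto simp: cone_def)
  qed
  have h_split: "h q (a, t) = h q (a, \<zero>\<^bsub>obj T q\<^esub>) \<oplus>\<^bsub>obj T (q + n - 1)\<^esub> h q (\<zero>\<^bsub>obj I (q + 1)\<^esub>, t)"
    if a: "a \<in> carrier (obj I (q + 1))" and t: "t \<in> carrier (obj ?J q)" for q a t
  proof -
    interpret Tq: left_module R "obj T q" by (rule oT)
    interpret Iq: left_module R "obj I (q + 1)" by (rule oI)
    show ?thesis
      using lmod_hom_add[OF hh lmod_hom_closed[OF inl a] lmod_hom_closed[OF inr t]] a J_sub[OF t]
      by (simp add: cone_def J_add)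
  qed

  \<comment> \<open>the components of \<open>h\<close>, with \<open>\<beta>1\<close> continued by zero to the negative part of \<open>T\<close>\<close>
  define \<beta>1 where "\<beta>1 q = (if q \<ge> 0 then \<lambda>t. h q (\<zero>\<^bsub>obj I (q + 1)\<^esub>, t) else (\<lambda>_. \<zero>\<^bsub>obj T (q + n - 1)\<^esub>))" for q
  have \<beta>1h: "\<beta>1 q \<in> lmod_hom R (obj T q) (obj T (q + n - 1))" for q
    using lmod_hom_comp[OF inr hh, of q] lmod_hom_const_zero[OF oT] by (auto simp: \<beta>1_def truncated_def)
  have \<beta>1h1: "\<beta>1 (q + 1) \<in> lmod_hom R (obj T (q + 1)) (obj T (q + n))" for q
    using \<beta>1h[of "q + 1"] by (simp add: algebra_simps)
  have h_snd: "h q (\<zero>\<^bsub>obj I (q + 1)\<^esub>, t) = \<beta>1 q t" if "t \<in> carrier (obj ?J q)" for q t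
  proof (cases "q \<ge> 0")
    case False
    then have "t = \<zero>\<^bsub>obj T q\<^esub>" using that by (simp add: truncated_def)
    then show ?thesis
      using False lmod_hom_zero[OF hh oX oT, of q] by (simp add: \<beta>1_def cone_def J_zero)
  qed (simp add: \<beta>1_def)
  define \<gamma>' where "\<gamma>' q a = koszul (obj T (q + n - 2)) (n - 1) (h (q - 1) (a, \<zero>\<^bsub>obj T (q - 1)\<^esub>))" for q a
  have \<gamma>'h: "\<gamma>' q \<in> lmod_hom R (obj I q) (obj T (q + n - 2))" for q
  proof -
    have "h (q - 1) \<in> lmod_hom R (obj ?X (q - 1)) (obj T (q + n - 2))"
      by (rule null_homotopy_hom[OF h]) simp
    from lmod_hom_comp[OF lmod_hom_comp[OF inl this] kz[of _ "n - 1"]]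
    show ?thesis by (simp add: \<gamma>'_def[abs_def])
  qed
  \<comment> \<open>what is left of \<open>\<beta>\<close>; it vanishes in degrees \<open>\<ge> 0\<close>\<close>
  define b where "b q t = \<beta> q t \<ominus>\<^bsub>obj T (q + n)\<^esub> (diff T (q + n - 1) (\<beta>1 q t)
      \<ominus>\<^bsub>obj T (q + n)\<^esub> koszul (obj T (q + n)) (n - 1) (\<beta>1 (q + 1) (diff T q t)))" for q t
  note d\<beta>1 = lmod_hom_comp[OF \<beta>1h dT1] and \<beta>1d = lmod_hom_comp[OF dT \<beta>1h1]
  have bh: "b q \<in> lmod_hom R (obj T q) (obj T (q + n))" for q
    unfolding b_def[abs_def]
    by (rule lmod_hom_sub[OF oT \<beta> lmod_hom_sub[OF oT d\<beta>1 lmod_hom_comp[OF \<beta>1d kz]]])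
  have b_zero: "b q t = \<zero>\<^bsub>obj T (q + n)\<^esub>" if q: "q \<ge> 0" and t: "t \<in> carrier (obj T q)" for q t
  proof -
    interpret Tq: left_module R "obj T (q + n)" by (rule oT)
    interpret I1: left_module R "obj I (q + 1)" by (rule oI)
    interpret I2: left_module R "obj I (q + 2)" by (rule oI)
    interpret S: left_module R "obj T (q + 1)" by (rule oT)
    have tJ: "t \<in> carrier (obj ?J q)" using q t by (simp add: truncated_def)
    have dtJ: "diff T q t \<in> carrier (obj ?J (q + 1))"
      using lmod_hom_closed[OF dT t] q by (simp add: truncated_def)
    have z1: "diff I (q + 1) \<zero>\<^bsub>obj I (q + 1)\<^esub> = \<zero>\<^bsub>obj I (q + 2)\<^esub>"
      using lmod_hom_zero[OF dI oI oI, of "q + 1"] by (simp add: add.assoc)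
    have z2: "\<gamma> (q + 1) \<zero>\<^bsub>obj I (q + 1)\<^esub> = \<zero>\<^bsub>obj T (q + n)\<^esub>" by (rule lmod_hom_zero[OF \<gamma>1 oI oT])
    have z3: "c (q + 1) \<zero>\<^bsub>obj I (q + 1)\<^esub> = \<zero>\<^bsub>obj T (q + 1)\<^esub>" by (rule lmod_hom_zero[OF ch oI oT])
    have "diff ?X q (\<zero>\<^bsub>obj I (q + 1)\<^esub>, t) = (\<zero>\<^bsub>obj I (q + 1 + 1)\<^esub>, diff T q t)"
      using z1 z3 lmod_hom_closed[OF dT t] by (simp add: X_diff I2.M.uminus_zero add.assoc)
    moreover have "g q (\<zero>\<^bsub>obj I (q + 1)\<^esub>, t) = \<beta> q t"
      using z2 lmod_hom_closed[OF \<beta> t] by (simp add: g_def koszul_zero agT)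
    moreover have "(\<zero>\<^bsub>obj I (q + 1)\<^esub>, t) \<in> carrier (obj ?X q)" using lmod_hom_closed[OF inr tJ] .
    ultimately have "\<beta> q t = diff T (q + n - 1) (\<beta>1 q t)
        \<ominus>\<^bsub>obj T (q + n)\<^esub> koszul (obj T (q + n)) (n - 1) (\<beta>1 (q + 1) (diff T q t))"
      using null_homotopy_eq[OF h, of "(\<zero>\<^bsub>obj I (q + 1)\<^esub>, t)" q] h_snd[OF tJ] h_snd[OF dtJ] by simp
    then show ?thesis
      using Tq.M.minus_eq_zero_iff lmod_hom_closed[OF \<beta> t] by (simp add: b_def)
  qed
  have b_cocycle: "diff T (q + n) (b q t) = koszul (obj T (q + n + 1)) n (b (q + 1) (diff T q t))"
    if t: "t \<in> carrier (obj T q)" for q t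
  proof -
    interpret Tq: left_module R "obj T (q + n)" by (rule oT)
    interpret T1: left_module R "obj T (q + n + 1)" by (rule oT)
    have idx: "q + 1 + n = q + n + 1" "q + 1 + n - 1 = q + n" "q + n + 1 - 1 = q + n" by simp_all
    have dt: "diff T q t \<in> carrier (obj T (q + 1))" by (rule lmod_hom_closed[OF dT t])
    have \<beta>s: "\<beta> (q + 1) \<in> lmod_hom R (obj T (q + 1)) (obj T (q + n + 1))"
      using \<beta>[of "q + 1"] by (simp only: idx)
    have ddt: "\<beta>1 (q + 1 + 1) (diff T (q + 1) (diff T q t)) = \<zero>\<^bsub>obj T (q + n + 1)\<^esub>"
      using complex_diff_diff[OF T'(1) t, of "q + 1" "q + 1 + 1"] lmod_hom_zero[OF \<beta>1h1 oT oT, of "q + 1"]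
      by (simp add: idx)
    have dd: "diff T (q + n) (diff T (q + n - 1) (\<beta>1 q t)) = \<zero>\<^bsub>obj T (q + n + 1)\<^esub>"
      by (rule complex_diff_diff[OF T'(1) lmod_hom_closed[OF \<beta>1h t]]) auto
    have cl: "\<beta> q t \<in> carrier (obj T (q + n))" "diff T (q + n - 1) (\<beta>1 q t) \<in> carrier (obj T (q + n))"
      "\<beta>1 (q + 1) (diff T q t) \<in> carrier (obj T (q + n))"
      "\<beta> (q + 1) (diff T q t) \<in> carrier (obj T (q + n + 1))"
      "diff T (q + n) (\<beta>1 (q + 1) (diff T q t)) \<in> carrier (obj T (q + n + 1))"
      by (rule lmod_hom_closed[OF \<beta> t] lmod_hom_closed[OF d\<beta>1 t] lmod_hom_closed[OF \<beta>1d t]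
          lmod_hom_closed[OF \<beta>s dt] lmod_hom_closed[OF lmod_hom_comp[OF \<beta>1d dT] t])+
    note kcl = koszul_closed[OF agT cl(3), of "n - 1"]
    have "diff T (q + n) (b q t) = koszul (obj T (q + n + 1)) n (\<beta> (q + 1) (diff T q t)) \<ominus>\<^bsub>obj T (q + n + 1)\<^esub>
        (\<zero>\<^bsub>obj T (q + n + 1)\<^esub> \<ominus>\<^bsub>obj T (q + n + 1)\<^esub>
         koszul (obj T (q + n + 1)) (n - 1) (diff T (q + n) (\<beta>1 (q + 1) (diff T q t))))"
      using cl kcl by (simp add: b_def lmod_hom_diff[OF dT oT oT] hom_koszul[OF dT oT oT] dd d\<beta>[OF t])
    moreover have "b (q + 1) (diff T q t) = \<beta> (q + 1) (diff T q t) \<ominus>\<^bsub>obj T (q + n + 1)\<^esub>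
        (diff T (q + n) (\<beta>1 (q + 1) (diff T q t)) \<ominus>\<^bsub>obj T (q + n + 1)\<^esub> \<zero>\<^bsub>obj T (q + n + 1)\<^esub>)"
      by (simp only: b_def idx ddt koszul_zero[OF agT])
    ultimately show ?thesis
      using cl by (simp add: koszul_def T1.minus_eq T1.minus_add T1.a_ac)
  qed
  have "\<exists>s. null_homotopy R T T n b s \<and> (\<forall>q\<ge>0. \<forall>x. s q x = \<zero>\<^bsub>obj T (q + n - 1)\<^esub>)"
    by (rule null_homotopy_from_projectives[OF T'(1) T'(1) T'(2) one _ bh b_cocycle b_zero])
       (simp_all add: T'(4))
  then obtain s where s: "null_homotopy R T T n b s" and s0: "\<And>q x. q \<ge> 0 \<Longrightarrow> s q x = \<zero>\<^bsub>obj T (q + n - 1)\<^esub>"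
    by blast
  have sh: "s q \<in> lmod_hom R (obj T q) (obj T (q + n - 1))" for q by (rule null_homotopy_hom[OF s refl])
  have sh1: "s (q + 1) \<in> lmod_hom R (obj T (q + 1)) (obj T (q + n))" for q
    by (rule null_homotopy_hom[OF s]) simp
  \<comment> \<open>As \<open>s\<close> vanishes on the image of \<open>c\<close>, adding it does not disturb the equation for \<open>\<gamma>\<close>.\<close>
  define \<beta>' where "\<beta>' q t = \<beta>1 q t \<oplus>\<^bsub>obj T (q + n - 1)\<^esub> s q t" for q t
  have \<beta>'h: "\<beta>' q \<in> lmod_hom R (obj T q) (obj T (q + n - 1))" for q
    unfolding \<beta>'_def[abs_def] by (rule lmod_hom_plus[OF oT \<beta>1h sh])
  have "null_homotopy R T T n \<beta> \<beta>'"
    unfolding null_homotopy_def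
  proof (intro conjI allI ballI \<beta>'h)
    fix q t assume t: "t \<in> carrier (obj T q)"
    interpret Tq: left_module R "obj T (q + n)" by (rule oT)
    have cl: "\<beta> q t \<in> carrier (obj T (q + n))" "diff T (q + n - 1) (\<beta>1 q t) \<in> carrier (obj T (q + n))"
      "\<beta>1 (q + 1) (diff T q t) \<in> carrier (obj T (q + n))"
      "diff T (q + n - 1) (s q t) \<in> carrier (obj T (q + n))"
      "s (q + 1) (diff T q t) \<in> carrier (obj T (q + n))"
      by (rule lmod_hom_closed[OF \<beta> t] lmod_hom_closed[OF d\<beta>1 t] lmod_hom_closed[OF \<beta>1d t]
          lmod_hom_closed[OF lmod_hom_comp[OF sh dT1] t] lmod_hom_closed[OF lmod_hom_comp[OF dT sh1] t])+
    have 1: "diff T (q + n - 1) (\<beta>' q t) =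
        diff T (q + n - 1) (\<beta>1 q t) \<oplus>\<^bsub>obj T (q + n)\<^esub> diff T (q + n - 1) (s q t)"
      unfolding \<beta>'_def by (rule lmod_hom_add[OF dT1 lmod_hom_closed[OF \<beta>1h t] lmod_hom_closed[OF sh t]])
    have idx: "q + 1 + n - 1 = q + n" by simp
    have 2: "\<beta>' (q + 1) (diff T q t) =
        \<beta>1 (q + 1) (diff T q t) \<oplus>\<^bsub>obj T (q + n)\<^esub> s (q + 1) (diff T q t)"
      by (simp only: \<beta>'_def idx)
    define B where "B = diff T (q + n - 1) (\<beta>1 q t)
      \<ominus>\<^bsub>obj T (q + n)\<^esub> koszul (obj T (q + n)) (n - 1) (\<beta>1 (q + 1) (diff T q t))"
    have B: "B \<in> carrier (obj T (q + n))" using cl by (simp add: B_def koszul_closed[OF agT])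
    have "\<beta> q t = b q t \<oplus>\<^bsub>obj T (q + n)\<^esub> B"
    proof -
      have "b q t = \<beta> q t \<ominus>\<^bsub>obj T (q + n)\<^esub> B" by (simp only: b_def B_def)
      then show ?thesis using cl B by (simp add: Tq.minus_eq Tq.a_assoc Tq.l_neg)
    qed
    also have "b q t = diff T (q + n - 1) (s q t)
       \<ominus>\<^bsub>obj T (q + n)\<^esub> koszul (obj T (q + n)) (n - 1) (s (q + 1) (diff T q t))"
      by (rule null_homotopy_eq[OF s t])
    finally show "\<beta> q t = diff T (q + n - 1) (\<beta>' q t)
       \<ominus>\<^bsub>obj T (q + n)\<^esub> koszul (obj T (q + n)) (n - 1) (\<beta>' (q + 1) (diff T q t))"
      using cl by (simp add: 1 2 B_def koszul_def Tq.minus_eq Tq.minus_add Tq.a_ac)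
  qed
  moreover have "\<gamma> q a = \<beta>' q (c q a) \<ominus>\<^bsub>obj T (q + n - 1)\<^esub>
      (diff T (q + n - 2) (\<gamma>' q a) \<ominus>\<^bsub>obj T (q + n - 1)\<^esub>
       koszul (obj T (q + n - 1)) n (\<gamma>' (q + 1) (diff I q a)))"
    if a: "a \<in> carrier (obj I q)" for q a
  proof -
    interpret Tq: left_module R "obj T (q + n - 1)" by (rule oT)
    interpret S: left_module R "obj T q" by (rule oT)
    interpret S1: left_module R "obj T (q - 1)" by (rule oT)
    interpret Iq: left_module R "obj I q" by (rule oI)
    have idx: "q - 1 + 1 = q" "q - 1 + 2 = q + 1" "q - 1 + n = q + n - 1" "q - 1 + n - 1 = q + n - 2"
        "q + 1 - 1 = q" "q + 1 + n - 2 = q + n - 1" "q + n - 2 + 1 = q + n - 1" "q + n - 1 - 1 = q + n - 2"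
      by simp_all
    have ca: "c q a \<in> carrier (obj T q)" and caJ: "c q a \<in> carrier (obj ?J q)"
      by (rule lmod_hom_closed[OF ch a] lmod_hom_closed[OF chain_map_hom[OF cJ] a])+
    have da: "diff I q a \<in> carrier (obj I (q + 1))" by (rule lmod_hom_closed[OF dI a])
    have x: "(a, \<zero>\<^bsub>obj T (q - 1)\<^esub>) \<in> carrier (obj ?X (q - 1))"
      using a by (simp add: X_carrier J_zero idx)
    have dz: "diff T (q - 1) \<zero>\<^bsub>obj T (q - 1)\<^esub> = \<zero>\<^bsub>obj T q\<^esub>" by (rule lmod_hom_zero[OF dT1 oT oT])
    have dx: "diff ?X (q - 1) (a, \<zero>\<^bsub>obj T (q - 1)\<^esub>) = (\<ominus>\<^bsub>obj I (q + 1)\<^esub> diff I q a, c q a)"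
      using dz ca by (simp add: X_diff idx)
    have \<beta>_z: "\<beta> (q - 1) \<zero>\<^bsub>obj T (q - 1)\<^esub> = \<zero>\<^bsub>obj T (q + n - 1)\<^esub>"
      using lmod_hom_zero[OF \<beta> oT oT, of "q - 1"] by (simp only: idx)
    have \<beta>'c: "\<beta>' q (c q a) = \<beta>1 q (c q a)"
    proof (cases "q \<ge> 0")
      case True
      then show ?thesis using lmod_hom_closed[OF \<beta>1h ca] by (simp add: \<beta>'_def s0)
    next
      case False
      then have "c q a = \<zero>\<^bsub>obj T q\<^esub>" using caJ by (simp add: truncated_def)
      then show ?thesis
        using lmod_hom_zero[OF sh oT oT] lmod_hom_closed[OF \<beta>1h ca] by (simp add: \<beta>'_def)
    qed
    have cl: "\<gamma> q a \<in> carrier (obj T (q + n - 1))" "\<beta>1 q (c q a) \<in> carrier (obj T (q + n - 1))"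
      "h q (diff I q a, \<zero>\<^bsub>obj T q\<^esub>) \<in> carrier (obj T (q + n - 1))"
      "h (q - 1) (a, \<zero>\<^bsub>obj T (q - 1)\<^esub>) \<in> carrier (obj T (q + n - 2))"
      using lmod_hom_closed[OF \<gamma> a] lmod_hom_closed[OF \<beta>1h ca] lmod_hom_closed[OF lmod_hom_comp[OF inl hh] da]
        lmod_hom_closed[OF hh x] by (simp_all only: idx)
    have dcl: "diff T (q + n - 2) (h (q - 1) (a, \<zero>\<^bsub>obj T (q - 1)\<^esub>)) \<in> carrier (obj T (q + n - 1))"
      using lmod_hom_closed[OF dT cl(4)] by (simp only: idx)
    have 1: "koszul (obj T (q + n - 1)) n (\<gamma> q a) = diff T (q + n - 2) (h (q - 1) (a, \<zero>\<^bsub>obj T (q - 1)\<^esub>))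
        \<ominus>\<^bsub>obj T (q + n - 1)\<^esub> koszul (obj T (q + n - 1)) (n - 1) (h q (\<ominus>\<^bsub>obj I (q + 1)\<^esub> diff I q a, c q a))"
      using null_homotopy_eq[OF h x] cl(1)
      by (simp only: g_def dx idx fst_conv snd_conv \<beta>_z Tq.r_zero koszul_closed[OF agT])
    have 2: "h q (\<ominus>\<^bsub>obj I (q + 1)\<^esub> diff I q a, c q a) =
        \<ominus>\<^bsub>obj T (q + n - 1)\<^esub> h q (diff I q a, \<zero>\<^bsub>obj T q\<^esub>) \<oplus>\<^bsub>obj T (q + n - 1)\<^esub> \<beta>1 q (c q a)"
    proof -
      interpret I1: left_module R "obj I (q + 1)" by (rule oI)
      show ?thesis
        using h_split[OF I1.M.a_inv_closed[OF da] caJ] h_snd[OF caJ]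
          lmod_hom_minus[OF lmod_hom_comp[OF inl hh] oI oT da] by simp
    qed
    have 3: "diff T (q + n - 2) (\<gamma>' q a) =
        koszul (obj T (q + n - 1)) (n - 1) (diff T (q + n - 2) (h (q - 1) (a, \<zero>\<^bsub>obj T (q - 1)\<^esub>)))"
      using hom_koszul[OF dT oT oT cl(4)] by (simp only: \<gamma>'_def idx)
    have 4: "\<gamma>' (q + 1) (diff I q a) = koszul (obj T (q + n - 1)) (n - 1) (h q (diff I q a, \<zero>\<^bsub>obj T q\<^esub>))"
      by (simp only: \<gamma>'_def idx)
    have "\<gamma> q a = koszul (obj T (q + n - 1)) n (koszul (obj T (q + n - 1)) n (\<gamma> q a))"
      using cl(1) by (simp add: koszul_def)
    also note 1
    finally show ?thesis
      using cl dcl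
      by (simp add: 2 3 4 \<beta>'c koszul_def Tq.minus_eq Tq.minus_add Tq.a_ac)
  qed
  ultimately show ?thesis using \<gamma>'h by blast
qed

section \<open>Complexes of homomorphisms over a group algebra\<close>

locale finite_group_over_field =
  fixes G :: "('g, 'b) monoid_scheme" and K :: "('k, 'c) ring_scheme"
  assumes group: "group G" and finite: "finite (carrier G)" and field: "field K"
begin

abbreviation kG :: "('g \<Rightarrow> 'k) ring" where "kG \<equiv> group_algebra K G"

sublocale G: group G by (rule group)
sublocale K: field K by (rule field)
sublocale kG: ring kG by (rule ring_group_algebra[OF group finite field])

lemma trivial_module: "left_module kG (trivial_module K G)"
  by (rule left_module_trivial_module[OF group finite field])

lemma group_algebra_ext:
  "a \<in> carrier kG \<Longrightarrow> b \<in> carrier kG \<Longrightarrow> (\<And>g. g \<in> carrier G \<Longrightarrow> a g = b g) \<Longrightarrow> a = b"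
  by (rule PiE_ext[of a "carrier G" "\<lambda>_. carrier K"]) (auto simp: group_algebra_def)

lemma group_algebra_one_neq_zero: "\<one>\<^bsub>kG\<^esub> \<noteq> \<zero>\<^bsub>kG\<^esub>"
proof
  assume "\<one>\<^bsub>kG\<^esub> = \<zero>\<^bsub>kG\<^esub>"
  then have "\<one>\<^bsub>kG\<^esub> \<one>\<^bsub>G\<^esub> = \<zero>\<^bsub>kG\<^esub> \<one>\<^bsub>G\<^esub>" by simp
  then show False by (simp add: group_algebra_def)
qed

lemma scalar_closed: "c \<in> carrier K \<Longrightarrow> scalar K G c \<in> carrier kG"
  by (auto simp: scalar_def group_algebra_def)

lemma scalar_one: "scalar K G \<one>\<^bsub>K\<^esub> = \<one>\<^bsub>kG\<^esub>"
  by (simp add: scalar_def group_algebra_def)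

lemma scalar_add:
  "c \<in> carrier K \<Longrightarrow> d \<in> carrier K \<Longrightarrow> scalar K G (c \<oplus>\<^bsub>K\<^esub> d) = scalar K G c \<oplus>\<^bsub>kG\<^esub> scalar K G d"
  by (auto simp: scalar_def group_algebra_def fun_eq_iff)

lemma scalar_mult_left:
  assumes c: "c \<in> carrier K" and a: "a \<in> carrier kG" and g: "g \<in> carrier G"
  shows "(scalar K G c \<otimes>\<^bsub>kG\<^esub> a) g = c \<otimes>\<^bsub>K\<^esub> a g"
proof -
  have a': "\<And>x. x \<in> carrier G \<Longrightarrow> a x \<in> carrier K" using a by (auto simp: group_algebra_def)
  have "(scalar K G c \<otimes>\<^bsub>kG\<^esub> a) g =
      (\<Oplus>\<^bsub>K\<^esub>h\<in>carrier G. scalar K G c h \<otimes>\<^bsub>K\<^esub> a (inv\<^bsub>G\<^esub> h \<otimes>\<^bsub>G\<^esub> g))"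
    using g by (simp add: group_algebra_def)
  also have "\<dots> = (\<Oplus>\<^bsub>K\<^esub>h\<in>carrier G. if \<one>\<^bsub>G\<^esub> = h then c \<otimes>\<^bsub>K\<^esub> a (inv\<^bsub>G\<^esub> h \<otimes>\<^bsub>G\<^esub> g) else \<zero>\<^bsub>K\<^esub>)"
    by (rule K.finsum_cong') (use g c a' in \<open>auto simp: scalar_def\<close>)
  also have "\<dots> = c \<otimes>\<^bsub>K\<^esub> a g"
    using K.finsum_singleton[OF G.one_closed finite, of "\<lambda>h. c \<otimes>\<^bsub>K\<^esub> a (inv\<^bsub>G\<^esub> h \<otimes>\<^bsub>G\<^esub> g)"] g c a' by simp
  finally show ?thesis .
qed

lemma scalar_mult_right:
  assumes c: "c \<in> carrier K" and a: "a \<in> carrier kG" and g: "g \<in> carrier G"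
  shows "(a \<otimes>\<^bsub>kG\<^esub> scalar K G c) g = c \<otimes>\<^bsub>K\<^esub> a g"
proof -
  have a': "\<And>x. x \<in> carrier G \<Longrightarrow> a x \<in> carrier K" using a by (auto simp: group_algebra_def)
  have iff: "inv\<^bsub>G\<^esub> h \<otimes>\<^bsub>G\<^esub> g = \<one>\<^bsub>G\<^esub> \<longleftrightarrow> g = h" if "h \<in> carrier G" for h
    using that g by (metis G.inv_equality G.inv_inv G.inv_closed G.l_inv)
  have "(a \<otimes>\<^bsub>kG\<^esub> scalar K G c) g =
      (\<Oplus>\<^bsub>K\<^esub>h\<in>carrier G. a h \<otimes>\<^bsub>K\<^esub> scalar K G c (inv\<^bsub>G\<^esub> h \<otimes>\<^bsub>G\<^esub> g))"
    using g by (simp add: group_algebra_def)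
  also have "\<dots> = (\<Oplus>\<^bsub>K\<^esub>h\<in>carrier G. if g = h then a h \<otimes>\<^bsub>K\<^esub> c else \<zero>\<^bsub>K\<^esub>)"
    by (rule K.finsum_cong') (use g c a' in \<open>auto simp: scalar_def iff\<close>)
  also have "\<dots> = c \<otimes>\<^bsub>K\<^esub> a g"
    using K.finsum_singleton[OF g finite, of "\<lambda>h. a h \<otimes>\<^bsub>K\<^esub> c"] g c a' by (simp add: K.m_comm)
  finally show ?thesis .
qed

text \<open>This is what makes multiplication by a scalar a \<open>kG\<close>-homomorphism, and the sets of homomorphisms
  vector spaces over \<open>K\<close>.\<close>

lemma scalar_central:
  assumes "c \<in> carrier K" and "a \<in> carrier kG"
  shows "scalar K G c \<otimes>\<^bsub>kG\<^esub> a = a \<otimes>\<^bsub>kG\<^esub> scalar K G c"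
  by (rule group_algebra_ext)
     (use assms scalar_closed in \<open>auto simp: scalar_mult_left scalar_mult_right\<close>)

lemma scalar_mult:
  assumes "c \<in> carrier K" and "d \<in> carrier K"
  shows "scalar K G (c \<otimes>\<^bsub>K\<^esub> d) = scalar K G c \<otimes>\<^bsub>kG\<^esub> scalar K G d"
  by (rule group_algebra_ext)
     (use assms scalar_closed in \<open>auto simp: scalar_mult_left\<close>, auto simp: scalar_def assms)

lemma hom_module_simps:
  "carrier (hom_module K G M N) = lmod_hom kG M N \<inter> extensional (carrier M)"
  "\<zero>\<^bsub>hom_module K G M N\<^esub> = (\<lambda>x\<in>carrier M. \<zero>\<^bsub>N\<^esub>)"
  "f \<oplus>\<^bsub>hom_module K G M N\<^esub> g = (\<lambda>x\<in>carrier M. f x \<oplus>\<^bsub>N\<^esub> g x)"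
  "c \<odot>\<^bsub>hom_module K G M N\<^esub> f = (\<lambda>x\<in>carrier M. scalar K G c \<odot>\<^bsub>N\<^esub> f x)"
  by (simp_all add: hom_module_def)

lemma restrict_hom:
  assumes "left_module kG M" and "f \<in> lmod_hom kG M N"
  shows "restrict f (carrier M) \<in> carrier (hom_module K G M N)"
  using lmod_hom_cong[OF assms, of "restrict f (carrier M)"] by (simp add: hom_module_simps)

lemma lmod_hom_scalar:
  assumes N: "left_module kG N" and f: "f \<in> lmod_hom kG M N" and c: "c \<in> carrier K"
  shows "(\<lambda>x. scalar K G c \<odot>\<^bsub>N\<^esub> f x) \<in> lmod_hom kG M N"
proof -
  interpret N: left_module kG N by fact
  note sc = scalar_closed[OF c]
  show ?thesis
  proof (rule lmod_homI)
    fix a x assume a: "a \<in> carrier kG" and x: "x \<in> carrier M"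
    show "scalar K G c \<odot>\<^bsub>N\<^esub> f (a \<odot>\<^bsub>M\<^esub> x) = a \<odot>\<^bsub>N\<^esub> (scalar K G c \<odot>\<^bsub>N\<^esub> f x)"
      using a sc lmod_hom_closed[OF f x] scalar_central[OF c a]
      by (simp add: lmod_hom_smult[OF f a x] N.smult_assoc1[symmetric])
  qed (use sc in \<open>auto simp: lmod_hom_closed[OF f] lmod_hom_add[OF f] N.smult_r_distr\<close>)
qed

lemma hom_module_eqI:
  assumes "f \<in> carrier (hom_module K G M N)" "g \<in> carrier (hom_module K G M N)"
    and "\<And>x. x \<in> carrier M \<Longrightarrow> f x = g x"
  shows "f = g"
  using assms by (intro extensionalityI[of f "carrier M" g]) (auto simp: hom_module_simps)

lemma left_module_hom_module:
  assumes M: "left_module kG M" and N: "left_module kG N"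
  shows "left_module K (hom_module K G M N)"
proof -
  interpret M: left_module kG M by fact
  interpret N: left_module kG N by fact
  let ?H = "hom_module K G M N"
  have hom: "f \<in> lmod_hom kG M N" if "f \<in> carrier ?H" for f using that by (simp add: hom_module_simps)
  have ncl: "f x \<in> carrier N" if "f \<in> carrier ?H" "x \<in> carrier M" for f x
    using lmod_hom_closed[OF hom[OF that(1)] that(2)] .
  have add: "f \<oplus>\<^bsub>?H\<^esub> g \<in> carrier ?H" if "f \<in> carrier ?H" "g \<in> carrier ?H" for f g
    using restrict_hom[OF M lmod_hom_plus[OF N hom[OF that(1)] hom[OF that(2)]]] by (simp add: hom_module_simps)
  have smult: "c \<odot>\<^bsub>?H\<^esub> f \<in> carrier ?H" if "c \<in> carrier K" "f \<in> carrier ?H" for c f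
    using restrict_hom[OF M lmod_hom_scalar[OF N hom[OF that(2)] that(1)]] by (simp add: hom_module_simps)
  have zero: "\<zero>\<^bsub>?H\<^esub> \<in> carrier ?H"
    using restrict_hom[OF M lmod_hom_const_zero[OF N]] by (simp add: hom_module_simps)
  have ev: "(f \<oplus>\<^bsub>?H\<^esub> g) x = f x \<oplus>\<^bsub>N\<^esub> g x" "\<zero>\<^bsub>?H\<^esub> x = \<zero>\<^bsub>N\<^esub>" "(c \<odot>\<^bsub>?H\<^esub> f) x = scalar K G c \<odot>\<^bsub>N\<^esub> f x"
    if "x \<in> carrier M" for f g x c using that by (simp_all add: hom_module_simps)
  show ?thesis
  proof (rule left_moduleI)
    show "abelian_group ?H"
    proof (rule abelian_groupI)
      fix f assume f: "f \<in> carrier ?H"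
      let ?g = "\<lambda>x\<in>carrier M. \<ominus>\<^bsub>N\<^esub> f x"
      have g: "?g \<in> carrier ?H" by (rule restrict_hom[OF M lmod_hom_uminus[OF N hom[OF f]]])
      show "\<exists>g\<in>carrier ?H. g \<oplus>\<^bsub>?H\<^esub> f = \<zero>\<^bsub>?H\<^esub>"
        by (rule bexI[OF _ g], rule hom_module_eqI) (use f g in \<open>auto simp: ev ncl N.l_neg intro!: add zero\<close>)
    qed (auto intro!: add zero hom_module_eqI simp: ev ncl N.a_ac)
  qed (auto intro!: add smult hom_module_eqI
        simp: ev ncl N.smult_l_distr N.smult_r_distr N.smult_assoc1 scalar_add scalar_mult scalar_one scalar_closed K.ring_axioms)
qed

lemma prod_module_simps:
  "carrier (prod_module F) = {\<phi>. \<forall>q. \<phi> q \<in> carrier (F q)}"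
  "\<zero>\<^bsub>prod_module F\<^esub> = (\<lambda>q. \<zero>\<^bsub>F q\<^esub>)"
  "\<phi> \<oplus>\<^bsub>prod_module F\<^esub> \<psi> = (\<lambda>q. \<phi> q \<oplus>\<^bsub>F q\<^esub> \<psi> q)"
  "c \<odot>\<^bsub>prod_module F\<^esub> \<phi> = (\<lambda>q. c \<odot>\<^bsub>F q\<^esub> \<phi> q)"
  by (simp_all add: prod_module_def)

lemma left_module_prod_module:
  assumes F: "\<And>q. left_module K (F q)" shows "left_module K (prod_module F)"
proof -
  interpret F: left_module K "F q" for q by (rule F)
  show ?thesis
  proof (rule left_moduleI)
    show "abelian_group (prod_module F)"
    proof (rule abelian_groupI)
      fix \<phi> assume "\<phi> \<in> carrier (prod_module F)"
      then show "\<exists>\<psi>\<in>carrier (prod_module F). \<psi> \<oplus>\<^bsub>prod_module F\<^esub> \<phi> = \<zero>\<^bsub>prod_module F\<^esub>"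
        by (intro bexI[of _ "\<lambda>q. \<ominus>\<^bsub>F q\<^esub> \<phi> q"]) (auto simp: prod_module_simps F.l_neg)
    qed (auto simp: prod_module_simps F.a_ac)
  qed (auto simp: prod_module_simps F.smult_l_distr F.smult_r_distr F.smult_assoc1 K.ring_axioms)
qed

end

text \<open>The graded homomorphisms between two complexes; the endomorphism algebra of a complex is the case
  in which both coincide.\<close>

definition hom_cochain ::
    "('k, 'c) ring_scheme \<Rightarrow> ('g, 'b) monoid_scheme \<Rightarrow> ('g \<Rightarrow> 'k, 'm) cochain \<Rightarrow> ('g \<Rightarrow> 'k, 'n) cochain \<Rightarrow>
     ('k, int \<Rightarrow> 'm \<Rightarrow> 'n) cochain"
  where "hom_cochain K G C D =
    \<lparr>obj = (\<lambda>n. prod_module (\<lambda>q. hom_module K G (obj C q) (obj D (q + n)))),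
     diff = (\<lambda>n \<phi> q. \<lambda>x\<in>carrier (obj C q).
       diff D (q + n) (\<phi> q x)
         \<ominus>\<^bsub>obj D (q + n + 1)\<^esub> koszul (obj D (q + n + 1)) n (\<phi> (q + 1) (diff C q x)))\<rparr>"
definition hom_comp ::
    "('r, 'm) cochain \<Rightarrow> int \<Rightarrow> (int \<Rightarrow> 'n \<Rightarrow> 'o) \<Rightarrow> (int \<Rightarrow> 'm \<Rightarrow> 'n) \<Rightarrow> int \<Rightarrow> 'm \<Rightarrow> 'o"
  where "hom_comp C q \<phi> \<psi> = (\<lambda>i. compose (carrier (obj C i)) (\<phi> (i + q)) (\<psi> i))"

lemma End_dga_eq:
  "obj (End_dga K G C) = obj (hom_cochain K G C C)"
  "diff (End_dga K G C) = diff (hom_cochain K G C C)"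
  "gmult (End_dga K G C) p q = hom_comp C q"
  by (simp_all add: End_dga_def hom_cochain_def hom_comp_def fun_eq_iff)

context finite_group_over_field
begin

abbreviation H :: "('g \<Rightarrow> 'k, 'm) cochain \<Rightarrow> ('g \<Rightarrow> 'k, 'n) cochain \<Rightarrow> int \<Rightarrow> ('k, int \<Rightarrow> 'm \<Rightarrow> 'n) module"
  where "H C D n \<equiv> obj (hom_cochain K G C D) n"

abbreviation D :: "('g \<Rightarrow> 'k, 'm) cochain \<Rightarrow> ('g \<Rightarrow> 'k, 'n) cochain \<Rightarrow> int \<Rightarrow> (int \<Rightarrow> 'm \<Rightarrow> 'n) \<Rightarrow> int \<Rightarrow> 'm \<Rightarrow> 'n"
  where "D X Y n \<equiv> diff (hom_cochain K G X Y) n"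

lemma hom_cochain_module:
  assumes "cochain_complex kG X" "cochain_complex kG Y" shows "left_module K (H X Y n)"
  unfolding hom_cochain_def cochain.simps
  by (intro left_module_prod_module left_module_hom_module complex_obj assms)

lemma hom_cochain_carrier:
  "\<phi> \<in> carrier (H X Y n) \<longleftrightarrow>
    (\<forall>q. \<phi> q \<in> lmod_hom kG (obj X q) (obj Y (q + n)) \<and> \<phi> q \<in> extensional (carrier (obj X q)))"
  by (auto simp: hom_cochain_def prod_module_simps hom_module_simps)

lemma hom_cochain_hom:
  "\<phi> \<in> carrier (H X Y n) \<Longrightarrow> m = q + n \<Longrightarrow> \<phi> q \<in> lmod_hom kG (obj X q) (obj Y m)"
  by (simp add: hom_cochain_carrier)

lemma hom_cochain_closed:
  "\<phi> \<in> carrier (H X Y n) \<Longrightarrow> x \<in> carrier (obj X q) \<Longrightarrow> m = q + n \<Longrightarrow> \<phi> q x \<in> carrier (obj Y m)"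
  by (rule lmod_hom_closed[OF hom_cochain_hom])

lemma hom_cochain_eqI:
  assumes "\<phi> \<in> carrier (H X Y n)" "\<psi> \<in> carrier (H X Y m)"
    and "\<And>q x. x \<in> carrier (obj X q) \<Longrightarrow> \<phi> q x = \<psi> q x"
  shows "\<phi> = \<psi>"
proof
  fix q show "\<phi> q = \<psi> q"
    using assms by (intro extensionalityI[of "\<phi> q" "carrier (obj X q)" "\<psi> q"]) (auto simp: hom_cochain_carrier)
qed

lemma hom_cochain_restrict:
  assumes X: "cochain_complex kG X" and "\<And>q. \<phi> q \<in> lmod_hom kG (obj X q) (obj Y (q + n))"
  shows "(\<lambda>q. restrict (\<phi> q) (carrier (obj X q))) \<in> carrier (H X Y n)"
  using restrict_hom[OF complex_obj[OF X] assms(2)] by (simp add: hom_cochain_carrier hom_module_simps)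

lemma hom_cochain_eval:
  assumes "x \<in> carrier (obj X q)"
  shows "(\<phi> \<oplus>\<^bsub>H X Y n\<^esub> \<psi>) q x = \<phi> q x \<oplus>\<^bsub>obj Y (q + n)\<^esub> \<psi> q x"
    and "\<zero>\<^bsub>H X Y n\<^esub> q x = \<zero>\<^bsub>obj Y (q + n)\<^esub>"
    and "(a \<odot>\<^bsub>H X Y n\<^esub> \<phi>) q x = scalar K G a \<odot>\<^bsub>obj Y (q + n)\<^esub> \<phi> q x"
    and "D X Y n \<phi> q x = diff Y (q + n) (\<phi> q x)
         \<ominus>\<^bsub>obj Y (q + n + 1)\<^esub> koszul (obj Y (q + n + 1)) n (\<phi> (q + 1) (diff X q x))"
  using assms by (simp_all add: hom_cochain_def prod_module_simps hom_module_simps)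

lemma hom_cochain_eval_uminus:
  assumes X: "cochain_complex kG X" and Y: "cochain_complex kG Y"
    and \<phi>: "\<phi> \<in> carrier (H X Y n)" and x: "x \<in> carrier (obj X q)"
  shows "(\<ominus>\<^bsub>H X Y n\<^esub> \<phi>) q x = \<ominus>\<^bsub>obj Y (q + n)\<^esub> \<phi> q x"
proof -
  interpret H: left_module K "H X Y n" by (rule hom_cochain_module[OF X Y])
  interpret Y: left_module kG "obj Y (q + n)" by (rule complex_obj[OF Y])
  have m: "\<ominus>\<^bsub>H X Y n\<^esub> \<phi> \<in> carrier (H X Y n)" using \<phi> by simp
  have "(\<ominus>\<^bsub>H X Y n\<^esub> \<phi> \<oplus>\<^bsub>H X Y n\<^esub> \<phi>) q x = \<zero>\<^bsub>H X Y n\<^esub> q x" using \<phi> by (simp add: H.M.l_neg)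
  then have "(\<ominus>\<^bsub>H X Y n\<^esub> \<phi>) q x \<oplus>\<^bsub>obj Y (q + n)\<^esub> \<phi> q x = \<zero>\<^bsub>obj Y (q + n)\<^esub>"
    using x by (simp add: hom_cochain_eval)
  then show ?thesis
    using Y.M.minus_equality[OF _ hom_cochain_closed[OF \<phi> x refl] hom_cochain_closed[OF m x refl]] by simp
qed

lemma hom_cochain_eval_diff:
  assumes X: "cochain_complex kG X" and Y: "cochain_complex kG Y"
    and \<psi>: "\<psi> \<in> carrier (H X Y n)" and x: "x \<in> carrier (obj X q)"
  shows "(\<phi> \<ominus>\<^bsub>H X Y n\<^esub> \<psi>) q x = \<phi> q x \<ominus>\<^bsub>obj Y (q + n)\<^esub> \<psi> q x"
  using x by (simp add: a_minus_def hom_cochain_eval hom_cochain_eval_uminus[OF X Y \<psi> x])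

lemma hom_cochain_eval_koszul:
  assumes X: "cochain_complex kG X" and Y: "cochain_complex kG Y"
    and \<phi>: "\<phi> \<in> carrier (H X Y n)" and x: "x \<in> carrier (obj X q)"
  shows "koszul (H X Y n) k \<phi> q x = koszul (obj Y (q + n)) k (\<phi> q x)"
  by (simp add: koszul_def hom_cochain_eval_uminus[OF assms])

lemma hom_cochain_diff_closed:
  assumes X: "cochain_complex kG X" and Y: "cochain_complex kG Y" and \<phi>: "\<phi> \<in> carrier (H X Y n)"
    and m: "m = n + 1"
  shows "D X Y n \<phi> \<in> carrier (H X Y m)"
proof -
  have \<phi>1: "\<phi> (q + 1) \<in> lmod_hom kG (obj X (q + 1)) (obj Y (q + n + 1))" for q
    by (rule hom_cochain_hom[OF \<phi>]) simp
  define \<psi> where "\<psi> q x = diff Y (q + n) (\<phi> q x)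
         \<ominus>\<^bsub>obj Y (q + n + 1)\<^esub> koszul (obj Y (q + n + 1)) n (\<phi> (q + 1) (diff X q x))" for q x
  have "\<psi> q \<in> lmod_hom kG (obj X q) (obj Y (q + n + 1))" for q
    unfolding \<psi>_def[abs_def]
    by (rule lmod_hom_sub[OF complex_obj[OF Y] lmod_hom_comp[OF hom_cochain_hom[OF \<phi> refl] complex_diff[OF Y refl]]
        lmod_hom_comp[OF lmod_hom_comp[OF complex_diff[OF X refl] \<phi>1] koszul_hom[OF complex_obj[OF Y]]]])
  then have "\<psi> q \<in> lmod_hom kG (obj X q) (obj Y (q + m))" for q by (simp add: m add.assoc)
  from hom_cochain_restrict[OF X this] show ?thesis by (simp add: \<psi>_def[abs_def] hom_cochain_def)
qed

lemma hom_cochain_complex: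
  assumes X: "cochain_complex kG X" and Y: "cochain_complex kG Y"
  shows "cochain_complex K (hom_cochain K G X Y)"
  unfolding cochain_complex_def
proof (intro conjI allI ballI)
  fix n
  show "left_module K (H X Y n)" by (rule hom_cochain_module[OF X Y])
  interpret Hn: left_module K "H X Y n" by (rule hom_cochain_module[OF X Y])
  interpret H1: left_module K "H X Y (n + 1)" by (rule hom_cochain_module[OF X Y])
  interpret H2: left_module K "H X Y (n + 2)" by (rule hom_cochain_module[OF X Y])
  note cl = hom_cochain_diff_closed[OF X Y]
  show "D X Y n \<in> lmod_hom K (H X Y n) (H X Y (n + 1))"
  proof (rule lmod_homI)
    fix \<phi> \<psi> assume \<phi>: "\<phi> \<in> carrier (H X Y n)" and \<psi>: "\<psi> \<in> carrier (H X Y n)"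
    show "D X Y n (\<phi> \<oplus>\<^bsub>H X Y n\<^esub> \<psi>) = D X Y n \<phi> \<oplus>\<^bsub>H X Y (n + 1)\<^esub> D X Y n \<psi>"
    proof (rule hom_cochain_eqI[OF cl[OF Hn.a_closed[OF \<phi> \<psi>] refl] H1.a_closed[OF cl[OF \<phi> refl] cl[OF \<psi> refl]]])
      fix q x assume x: "x \<in> carrier (obj X q)"
      interpret Y1: left_module kG "obj Y (q + n + 1)" by (rule complex_obj[OF Y])
      note dx = lmod_hom_closed[OF complex_diff[OF X refl] x]
      note dY = complex_diff[OF Y refl, of "q + n"]
      note ncl = hom_cochain_closed[OF \<phi> x refl] hom_cochain_closed[OF \<psi> x refl]
        hom_cochain_closed[OF \<phi> dx, of "q + n + 1"] hom_cochain_closed[OF \<psi> dx, of "q + n + 1"]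
      have idx: "q + 1 + n = q + n + 1" "q + (n + 1) = q + n + 1" by simp_all
      show "D X Y n (\<phi> \<oplus>\<^bsub>H X Y n\<^esub> \<psi>) q x = (D X Y n \<phi> \<oplus>\<^bsub>H X Y (n + 1)\<^esub> D X Y n \<psi>) q x"
        using ncl lmod_hom_closed[OF dY ncl(1)] lmod_hom_closed[OF dY ncl(2)]
        by (simp add: hom_cochain_eval[OF x] hom_cochain_eval[OF dx] idx lmod_hom_add[OF dY] koszul_def
            Y1.minus_eq Y1.minus_add Y1.a_ac)
    qed
  next
    fix a \<phi> assume a: "a \<in> carrier K" and \<phi>: "\<phi> \<in> carrier (H X Y n)"
    show "D X Y n (a \<odot>\<^bsub>H X Y n\<^esub> \<phi>) = a \<odot>\<^bsub>H X Y (n + 1)\<^esub> D X Y n \<phi>"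
    proof (rule hom_cochain_eqI[OF cl[OF Hn.smult_closed[OF a \<phi>] refl] H1.smult_closed[OF a cl[OF \<phi> refl]]])
      fix q x assume x: "x \<in> carrier (obj X q)"
      interpret Y1: left_module kG "obj Y (q + n + 1)" by (rule complex_obj[OF Y])
      note dx = lmod_hom_closed[OF complex_diff[OF X refl] x]
      note dY = complex_diff[OF Y refl, of "q + n"]
      note ncl = hom_cochain_closed[OF \<phi> x refl] hom_cochain_closed[OF \<phi> dx, of "q + n + 1"]
      have idx: "q + 1 + n = q + n + 1" "q + (n + 1) = q + n + 1" by simp_all
      show "D X Y n (a \<odot>\<^bsub>H X Y n\<^esub> \<phi>) q x = (a \<odot>\<^bsub>H X Y (n + 1)\<^esub> D X Y n \<phi>) q x"
        using ncl lmod_hom_closed[OF dY ncl(1)] scalar_closed[OF a]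
        by (simp add: hom_cochain_eval[OF x] hom_cochain_eval[OF dx] idx lmod_hom_smult[OF dY] koszul_def
            Y1.minus_eq Y1.smult_r_distr Y1.smult_r_minus)
    qed
  qed (rule cl[OF _ refl])
  fix \<phi> assume \<phi>: "\<phi> \<in> carrier (H X Y n)"
  show "D X Y (n + 1) (D X Y n \<phi>) = \<zero>\<^bsub>H X Y (n + 2)\<^esub>"
  proof (rule hom_cochain_eqI[OF _ H2.zero_closed])
    show "D X Y (n + 1) (D X Y n \<phi>) \<in> carrier (H X Y (n + 2))" by (intro cl[OF cl[OF \<phi> refl]]) simp
    fix q x assume x: "x \<in> carrier (obj X q)"
    interpret Y0: left_module kG "obj Y (q + n)" by (rule complex_obj[OF Y])
    interpret Y1: left_module kG "obj Y (q + n + 1)" by (rule complex_obj[OF Y])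
    interpret Y2: left_module kG "obj Y (q + n + 2)" by (rule complex_obj[OF Y])
    have dx: "diff X q x \<in> carrier (obj X (q + 1))" by (rule lmod_hom_closed[OF complex_diff[OF X refl] x])
    have ddx: "diff X (q + 1) (diff X q x) = \<zero>\<^bsub>obj X (q + 1 + 1)\<^esub>"
      by (rule complex_diff_diff[OF X x]) simp_all
    have \<phi>z: "\<phi> (q + 1 + 1) \<zero>\<^bsub>obj X (q + 1 + 1)\<^esub> = \<zero>\<^bsub>obj Y (q + n + 2)\<^esub>"
      by (rule lmod_hom_zero[OF hom_cochain_hom[OF \<phi>] complex_obj[OF X] complex_obj[OF Y]]) simp
    have dY: "diff Y (q + n) \<in> lmod_hom kG (obj Y (q + n)) (obj Y (q + n + 1))"
      and dY1: "diff Y (q + n + 1) \<in> lmod_hom kG (obj Y (q + n + 1)) (obj Y (q + n + 2))"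
      by (auto intro!: complex_diff[OF Y])
    have ncl: "\<phi> q x \<in> carrier (obj Y (q + n))" "\<phi> (q + 1) (diff X q x) \<in> carrier (obj Y (q + n + 1))"
      by (rule hom_cochain_closed[OF \<phi> x] hom_cochain_closed[OF \<phi> dx], simp)+
    note dcl = lmod_hom_closed[OF dY ncl(1)] lmod_hom_closed[OF dY1 ncl(2)]
    have idx: "q + 1 + n = q + n + 1" "q + (n + 1) = q + n + 1" "q + n + 1 + 1 = q + n + 2" "q + (n + 2) = q + n + 2"
      by simp_all
    have dd: "diff Y (q + n + 1) (diff Y (q + n) (\<phi> q x)) = \<zero>\<^bsub>obj Y (q + n + 2)\<^esub>"
      by (rule complex_diff_diff[OF Y ncl(1)]) simp_all
    have "D X Y (n + 1) (D X Y n \<phi>) q x =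
        diff Y (q + n + 1) (diff Y (q + n) (\<phi> q x)
          \<ominus>\<^bsub>obj Y (q + n + 1)\<^esub> koszul (obj Y (q + n + 1)) n (\<phi> (q + 1) (diff X q x)))
        \<ominus>\<^bsub>obj Y (q + n + 2)\<^esub> koszul (obj Y (q + n + 2)) (n + 1)
          (diff Y (q + n + 1) (\<phi> (q + 1) (diff X q x)) \<ominus>\<^bsub>obj Y (q + n + 2)\<^esub>
             koszul (obj Y (q + n + 2)) n \<zero>\<^bsub>obj Y (q + n + 2)\<^esub>)"
      by (simp only: hom_cochain_eval(4)[OF x] hom_cochain_eval(4)[OF dx] idx ddx \<phi>z)
    also have "\<dots> = \<zero>\<^bsub>obj Y (q + n + 2)\<^esub>"
      using ncl dcl
      by (simp add: lmod_hom_diff[OF dY1 complex_obj[OF Y] complex_obj[OF Y]]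
          hom_koszul[OF dY1 complex_obj[OF Y] complex_obj[OF Y]] koszul_closed[OF Y1.M.abelian_group_axioms]
          koszul_zero[OF Y2.M.abelian_group_axioms] dd)
        (simp add: koszul_def Y2.minus_eq Y2.r_neg Y2.l_neg)
    finally show "D X Y (n + 1) (D X Y n \<phi>) q x = \<zero>\<^bsub>H X Y (n + 2)\<^esub> q x"
      by (simp only: hom_cochain_eval(2)[OF x] idx)
  qed
qed

end

lemma (in abelian_group) add_cancel_outer:
  "x \<in> carrier G \<Longrightarrow> y \<in> carrier G \<Longrightarrow> x \<oplus> (y \<oplus> \<ominus> x) = y"
  "x \<in> carrier G \<Longrightarrow> y \<in> carrier G \<Longrightarrow> \<ominus> x \<oplus> (y \<oplus> x) = y"
  by (simp_all add: a_comm[of y] r_neg1 r_neg2)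

context finite_group_over_field
begin

lemma hom_comp_eval: "x \<in> carrier (obj X i) \<Longrightarrow> hom_comp X q \<phi> \<psi> i x = \<phi> (i + q) (\<psi> i x)"
  by (simp add: hom_comp_def compose_def)

lemma hom_comp_closed:
  assumes X: "cochain_complex kG X" and \<phi>: "\<phi> \<in> carrier (H Y Z p)" and \<psi>: "\<psi> \<in> carrier (H X Y q)"
    and r: "r = p + q"
  shows "hom_comp X q \<phi> \<psi> \<in> carrier (H X Z r)"
proof -
  have "\<phi> (i + q) \<in> lmod_hom kG (obj Y (i + q)) (obj Z (i + r))" for i
    by (rule hom_cochain_hom[OF \<phi>]) (simp add: r)
  from hom_cochain_restrict[OF X lmod_hom_comp[OF hom_cochain_hom[OF \<psi> refl] this]]
  show ?thesis by (simp add: hom_comp_def compose_def)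
qed

lemma hom_comp_hom_left:
  assumes X: "cochain_complex kG X" and Y: "cochain_complex kG Y" and Z: "cochain_complex kG Z"
    and \<psi>: "\<psi> \<in> carrier (H X Y q)" and r: "r = p + q"
  shows "(\<lambda>\<phi>. hom_comp X q \<phi> \<psi>) \<in> lmod_hom K (H Y Z p) (H X Z r)"
proof -
  interpret A: left_module K "H Y Z p" by (rule hom_cochain_module[OF Y Z])
  interpret C: left_module K "H X Z r" by (rule hom_cochain_module[OF X Z])
  note cl = hom_comp_closed[OF X _ \<psi> r]
  have idx: "i + r = i + q + p" for i by (simp add: r)
  show ?thesis
  proof (rule lmod_homI)
    fix \<phi> \<phi>' assume \<phi>: "\<phi> \<in> carrier (H Y Z p)" and \<phi>': "\<phi>' \<in> carrier (H Y Z p)"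
    show "hom_comp X q (\<phi> \<oplus>\<^bsub>H Y Z p\<^esub> \<phi>') \<psi> = hom_comp X q \<phi> \<psi> \<oplus>\<^bsub>H X Z r\<^esub> hom_comp X q \<phi>' \<psi>"
      by (rule hom_cochain_eqI[OF cl[OF A.a_closed[OF \<phi> \<phi>']] C.a_closed[OF cl[OF \<phi>] cl[OF \<phi>']]])
         (simp add: hom_comp_eval hom_cochain_eval hom_cochain_closed[OF \<psi>] idx)
  next
    fix a \<phi> assume a: "a \<in> carrier K" and \<phi>: "\<phi> \<in> carrier (H Y Z p)"
    show "hom_comp X q (a \<odot>\<^bsub>H Y Z p\<^esub> \<phi>) \<psi> = a \<odot>\<^bsub>H X Z r\<^esub> hom_comp X q \<phi> \<psi>"
      by (rule hom_cochain_eqI[OF cl[OF A.smult_closed[OF a \<phi>]] C.smult_closed[OF a cl[OF \<phi>]]])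
         (simp add: hom_comp_eval hom_cochain_eval hom_cochain_closed[OF \<psi>] idx)
  qed (rule cl)
qed

lemma hom_comp_hom_right:
  assumes X: "cochain_complex kG X" and Y: "cochain_complex kG Y" and Z: "cochain_complex kG Z"
    and \<phi>: "\<phi> \<in> carrier (H Y Z p)" and r: "r = p + q"
  shows "hom_comp X q \<phi> \<in> lmod_hom K (H X Y q) (H X Z r)"
proof -
  interpret A: left_module K "H X Y q" by (rule hom_cochain_module[OF X Y])
  interpret C: left_module K "H X Z r" by (rule hom_cochain_module[OF X Z])
  note cl = hom_comp_closed[OF X \<phi> _ r]
  have idx: "i + r = i + q + p" for i by (simp add: r)
  note \<phi>h = hom_cochain_hom[OF \<phi> refl]
  show ?thesis
  proof (rule lmod_homI)
    fix \<psi> \<psi>' assume \<psi>: "\<psi> \<in> carrier (H X Y q)" and \<psi>': "\<psi>' \<in> carrier (H X Y q)"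
    show "hom_comp X q \<phi> (\<psi> \<oplus>\<^bsub>H X Y q\<^esub> \<psi>') = hom_comp X q \<phi> \<psi> \<oplus>\<^bsub>H X Z r\<^esub> hom_comp X q \<phi> \<psi>'"
      by (rule hom_cochain_eqI[OF cl[OF A.a_closed[OF \<psi> \<psi>']] C.a_closed[OF cl[OF \<psi>] cl[OF \<psi>']]])
         (simp add: hom_comp_eval hom_cochain_eval lmod_hom_add[OF \<phi>h] hom_cochain_closed[OF \<psi>]
           hom_cochain_closed[OF \<psi>'] idx)
  next
    fix a \<psi> assume a: "a \<in> carrier K" and \<psi>: "\<psi> \<in> carrier (H X Y q)"
    show "hom_comp X q \<phi> (a \<odot>\<^bsub>H X Y q\<^esub> \<psi>) = a \<odot>\<^bsub>H X Z r\<^esub> hom_comp X q \<phi> \<psi>"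
      by (rule hom_cochain_eqI[OF cl[OF A.smult_closed[OF a \<psi>]] C.smult_closed[OF a cl[OF \<psi>]]])
         (simp add: hom_comp_eval hom_cochain_eval lmod_hom_smult[OF \<phi>h] hom_cochain_closed[OF \<psi>]
           scalar_closed[OF a] idx)
  qed (rule cl)
qed

lemma hom_comp_assoc:
  assumes W: "cochain_complex kG W" and X: "cochain_complex kG X"
    and \<phi>: "\<phi> \<in> carrier (H Y Z p)" and \<psi>: "\<psi> \<in> carrier (H X Y q)" and \<chi>: "\<chi> \<in> carrier (H W X r)"
    and s: "s = q + r"
  shows "hom_comp W r (hom_comp X q \<phi> \<psi>) \<chi> = hom_comp W s \<phi> (hom_comp W r \<psi> \<chi>)"
  by (rule hom_cochain_eqI[OF hom_comp_closed[OF W hom_comp_closed[OF X \<phi> \<psi> refl] \<chi> refl]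
        hom_comp_closed[OF W \<phi> hom_comp_closed[OF W \<psi> \<chi> s] refl]])
     (simp add: hom_comp_eval hom_cochain_closed[OF \<chi>] s ac_simps)

definition hom_id :: "('g \<Rightarrow> 'k, 'm) cochain \<Rightarrow> int \<Rightarrow> 'm \<Rightarrow> 'm"
  where "hom_id X = (\<lambda>q. \<lambda>x\<in>carrier (obj X q). x)"

lemma hom_id_closed: "cochain_complex kG X \<Longrightarrow> hom_id X \<in> carrier (H X X 0)"
  unfolding hom_id_def
  by (rule hom_cochain_restrict) (simp_all add: lmod_hom_id)

lemma hom_id_left:
  assumes X: "cochain_complex kG X" and Y: "cochain_complex kG Y" and \<phi>: "\<phi> \<in> carrier (H X Y n)"
  shows "hom_comp X n (hom_id Y) \<phi> = \<phi>"
  by (rule hom_cochain_eqI[OF hom_comp_closed[OF X hom_id_closed[OF Y] \<phi> refl] \<phi>])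
     (simp add: hom_comp_eval hom_id_def hom_cochain_closed[OF \<phi>])

lemma hom_id_right:
  assumes X: "cochain_complex kG X" and \<phi>: "\<phi> \<in> carrier (H X Y n)"
  shows "hom_comp X 0 \<phi> (hom_id X) = \<phi>"
  by (rule hom_cochain_eqI[OF hom_comp_closed[OF X \<phi> hom_id_closed[OF X] refl] \<phi>])
     (simp add: hom_comp_eval hom_id_def)

text \<open>The term \<open>\<phi> d \<psi>\<close> occurs with opposite signs in the two summands.\<close>

lemma hom_comp_leibniz:
  assumes X: "cochain_complex kG X" and Y: "cochain_complex kG Y" and Z: "cochain_complex kG Z"
    and \<phi>: "\<phi> \<in> carrier (H Y Z p)" and \<psi>: "\<psi> \<in> carrier (H X Y q)"
    and r: "r = p + q" and r1: "r1 = p + q + 1" and q1: "q1 = q + 1"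
  shows "D X Z r (hom_comp X q \<phi> \<psi>) =
    hom_comp X q (D Y Z p \<phi>) \<psi> \<oplus>\<^bsub>H X Z r1\<^esub> koszul (H X Z r1) p (hom_comp X q1 \<phi> (D X Y q \<psi>))"
proof (rule hom_cochain_eqI)
  interpret HXZ: left_module K "H X Z r1" by (rule hom_cochain_module[OF X Z])
  have d\<phi>: "D Y Z p \<phi> \<in> carrier (H Y Z (p + 1))" and d\<psi>: "D X Y q \<psi> \<in> carrier (H X Y q1)"
    by (rule hom_cochain_diff_closed[OF Y Z \<phi> refl] hom_cochain_diff_closed[OF X Y \<psi> q1])+
  have c1: "hom_comp X q (D Y Z p \<phi>) \<psi> \<in> carrier (H X Z r1)"
    by (rule hom_comp_closed[OF X d\<phi> \<psi>]) (simp add: r1)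
  have c2: "hom_comp X q1 \<phi> (D X Y q \<psi>) \<in> carrier (H X Z r1)"
    by (rule hom_comp_closed[OF X \<phi> d\<psi>]) (simp add: r1 q1)
  show "D X Z r (hom_comp X q \<phi> \<psi>) \<in> carrier (H X Z r1)"
    by (rule hom_cochain_diff_closed[OF X Z hom_comp_closed[OF X \<phi> \<psi> r]]) (simp add: r r1)
  show "hom_comp X q (D Y Z p \<phi>) \<psi> \<oplus>\<^bsub>H X Z r1\<^esub> koszul (H X Z r1) p (hom_comp X q1 \<phi> (D X Y q \<psi>)) \<in> carrier (H X Z r1)"
    using c1 koszul_closed[OF HXZ.M.abelian_group_axioms c2] by simp
  fix i x assume x: "x \<in> carrier (obj X i)"
  let ?m = "i + q + p + 1"
  interpret Z1: left_module kG "obj Z ?m" by (rule complex_obj[OF Z])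
  have dx: "diff X i x \<in> carrier (obj X (i + 1))" by (rule lmod_hom_closed[OF complex_diff[OF X refl] x])
  have \<psi>x: "\<psi> i x \<in> carrier (obj Y (i + q))" by (rule hom_cochain_closed[OF \<psi> x refl])
  have \<psi>dx: "\<psi> (i + 1) (diff X i x) \<in> carrier (obj Y (i + q + 1))" by (rule hom_cochain_closed[OF \<psi> dx]) simp
  have d\<psi>x: "diff Y (i + q) (\<psi> i x) \<in> carrier (obj Y (i + q + 1))"
    by (rule lmod_hom_closed[OF complex_diff[OF Y refl] \<psi>x])
  have \<phi>1: "\<phi> (i + q + 1) \<in> lmod_hom kG (obj Y (i + q + 1)) (obj Z ?m)" by (rule hom_cochain_hom[OF \<phi>]) simp
  have dcl: "diff Z (i + q + p) (\<phi> (i + q) (\<psi> i x)) \<in> carrier (obj Z ?m)"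
    by (rule lmod_hom_closed[OF complex_diff[OF Z] hom_cochain_closed[OF \<phi> \<psi>x refl]]) simp
  have agY: "abelian_group (obj Y (i + q + 1))" by (rule left_module_abelian_group[OF complex_obj[OF Y]])
  have idx: "i + r = i + q + p" "i + r + 1 = ?m" "i + r1 = ?m" "i + 1 + q = i + q + 1" "i + q1 = i + q + 1"
    by (simp_all add: r r1 q1)
  have e1: "D X Z r (hom_comp X q \<phi> \<psi>) i x = diff Z (i + q + p) (\<phi> (i + q) (\<psi> i x)) \<ominus>\<^bsub>obj Z ?m\<^esub>
      koszul (obj Z ?m) r (\<phi> (i + q + 1) (\<psi> (i + 1) (diff X i x)))"
    by (simp only: hom_cochain_eval(4)[OF x] hom_comp_eval[OF x] hom_comp_eval[OF dx] idx)
  have e2: "hom_comp X q (D Y Z p \<phi>) \<psi> i x = diff Z (i + q + p) (\<phi> (i + q) (\<psi> i x)) \<ominus>\<^bsub>obj Z ?m\<^esub>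
      koszul (obj Z ?m) p (\<phi> (i + q + 1) (diff Y (i + q) (\<psi> i x)))"
    by (simp only: hom_comp_eval[OF x] hom_cochain_eval(4)[OF \<psi>x])
  have e3: "hom_comp X q1 \<phi> (D X Y q \<psi>) i x = \<phi> (i + q + 1) (diff Y (i + q) (\<psi> i x)) \<ominus>\<^bsub>obj Z ?m\<^esub>
      koszul (obj Z ?m) q (\<phi> (i + q + 1) (\<psi> (i + 1) (diff X i x)))"
    using lmod_hom_diff[OF \<phi>1 complex_obj[OF Y] complex_obj[OF Z] d\<psi>x koszul_closed[OF agY \<psi>dx]]
      hom_koszul[OF \<phi>1 complex_obj[OF Y] complex_obj[OF Z] \<psi>dx]
    by (simp only: hom_comp_eval[OF x] hom_cochain_eval(4)[OF x] idx)
  show "D X Z r (hom_comp X q \<phi> \<psi>) i x =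
      (hom_comp X q (D Y Z p \<phi>) \<psi> \<oplus>\<^bsub>H X Z r1\<^esub> koszul (H X Z r1) p (hom_comp X q1 \<phi> (D X Y q \<psi>))) i x"
    unfolding hom_cochain_eval(1)[OF x] hom_cochain_eval_koszul[OF X Z c2 x] e1 e2 e3 idx
    using dcl lmod_hom_closed[OF \<phi>1 d\<psi>x] lmod_hom_closed[OF \<phi>1 \<psi>dx]
    by (cases "even p"; cases "even q")
       (simp_all add: r koszul_def Z1.minus_eq Z1.minus_add Z1.a_ac Z1.r_neg Z1.r_neg1 Z1.r_neg2
         Z1.add_cancel_outer)
qed

lemma End_dga:
  assumes X: "cochain_complex kG X" shows "dg_algebra K (End_dga K G X)"
proof -
  have one: "gone (End_dga K G X) = hom_id X" by (simp add: End_dga_def hom_id_def)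
  note C = hom_cochain_complex[OF X X]
  show ?thesis
  proof (rule dg_algebra.intro)
    show "field K" by (rule field)
    show "cochain_complex K (End_dga K G X)"
      using C by (simp add: cochain_complex_def End_dga_eq)
    show "gone (End_dga K G X) \<in> carrier (obj (End_dga K G X) 0)"
      by (simp add: one End_dga_eq hom_id_closed[OF X])
  qed (simp_all add: End_dga_eq one hom_id_left[OF X X] hom_id_right[OF X] hom_comp_hom_left[OF X X X] hom_comp_hom_right[OF X X X]
      hom_comp_assoc[OF X X] hom_comp_leibniz[OF X X X])
qed

end

section \<open>The triangular differential graded algebra of a cochain map\<close>

lemma fst_hom: "fst \<in> lmod_hom R (pair_module M N) M"
  by (auto simp: lmod_hom_def)

lemma snd_hom: "snd \<in> lmod_hom R (pair_module M N) N"
  by (auto simp: lmod_hom_def)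

lemma pair_hom:
  "f \<in> lmod_hom R L M \<Longrightarrow> g \<in> lmod_hom R L N \<Longrightarrow> (\<lambda>x. (f x, g x)) \<in> lmod_hom R L (pair_module M N)"
  by (auto simp: lmod_hom_def Pi_def)

lemma koszul_pair:
  assumes "left_module R M" "left_module R N" "x \<in> carrier M" "y \<in> carrier N"
  shows "koszul (pair_module M N) n (x, y) = (koszul M n x, koszul N n y)"
  using pair_module_uminus[OF assms(1,2), of "(x, y)"] assms(3,4) by (simp add: koszul_def)

text \<open>The last component of the Leibniz rule for triangular matrices, with \<open>t\<^sub>1, \<dots>, t\<^sub>7\<close> standing for
  \<open>\<beta> \<beta>' c\<close>, \<open>c \<alpha> \<alpha>'\<close>, \<open>(d \<beta>) \<gamma>'\<close>, \<open>\<beta> (d \<gamma>')\<close>, \<open>(d \<gamma>) \<alpha>'\<close>, \<open>\<gamma> (d \<alpha>')\<close> and \<open>\<beta> c \<alpha>'\<close>. The last of these arises twice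
  on the right, with opposite signs.\<close>

lemma triangular_leibniz_identity:
  assumes M: "abelian_group M"
    and t: "t1 \<in> carrier M" "t2 \<in> carrier M" "t3 \<in> carrier M" "t4 \<in> carrier M" "t5 \<in> carrier M"
      "t6 \<in> carrier M" "t7 \<in> carrier M"
  shows "(t1 \<ominus>\<^bsub>M\<^esub> t2) \<ominus>\<^bsub>M\<^esub> (koszul M p (t3 \<oplus>\<^bsub>M\<^esub> koszul M p t4) \<oplus>\<^bsub>M\<^esub> (t5 \<oplus>\<^bsub>M\<^esub> koszul M (p - 1) t6)) =
    (koszul M (p + 1) t3 \<oplus>\<^bsub>M\<^esub> ((t7 \<ominus>\<^bsub>M\<^esub> t2) \<ominus>\<^bsub>M\<^esub> t5)) \<oplus>\<^bsub>M\<^esub>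
    koszul M p (koszul M p ((t1 \<ominus>\<^bsub>M\<^esub> t7) \<ominus>\<^bsub>M\<^esub> t4) \<oplus>\<^bsub>M\<^esub> t6)"
proof -
  interpret abelian_group M by (rule M)
  \<comment> \<open>With \<open>t1 - t7\<close> as a variable no cancellation is left and the identity is a rearrangement.\<close>
  define u where "u = t1 \<ominus>\<^bsub>M\<^esub> t7"
  have u: "u \<in> carrier M" and t1: "t1 = u \<oplus>\<^bsub>M\<^esub> t7"
    using t by (simp_all add: u_def minus_eq a_assoc l_neg)
  show ?thesis
    unfolding u_def[symmetric] unfolding t1
    using t u by (cases "even p") (simp_all add: koszul_def minus_eq minus_add a_ac)
qed

context finite_group_over_field
begin

context
  fixes X :: "('g \<Rightarrow> 'k, 'i) cochain" and Y :: "('g \<Rightarrow> 'k, 't) cochain" and c :: "int \<Rightarrow> 'i \<Rightarrow> 't"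
  assumes X: "cochain_complex kG X" and Y: "cochain_complex kG Y"
    and c: "c \<in> carrier (H X Y 0)" and dc: "D X Y 0 c = \<zero>\<^bsub>H X Y 1\<^esub>"
begin

text \<open>The endomorphisms of the cone of \<open>c\<close> that preserve \<open>Y\<close>, written as matrices with diagonal entries
  \<open>\<alpha>\<close>, \<open>\<beta>\<close> and one off-diagonal entry \<open>\<gamma>\<close>. The shift in the cone lowers the degree of \<open>\<gamma>\<close> by one and is
  the origin of the sign in the product.\<close>

definition triangular :: "('k, (int \<Rightarrow> 'i \<Rightarrow> 'i) \<times> (int \<Rightarrow> 't \<Rightarrow> 't) \<times> (int \<Rightarrow> 'i \<Rightarrow> 't)) dga"
  where "triangular =
    \<lparr>obj = (\<lambda>n. pair_module (H X X n) (pair_module (H Y Y n) (H X Y (n - 1)))),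
     diff = (\<lambda>n (\<alpha>, \<beta>, \<gamma>). (D X X n \<alpha>, D Y Y n \<beta>,
       (hom_comp X 0 \<beta> c \<ominus>\<^bsub>H X Y n\<^esub> hom_comp X n c \<alpha>) \<ominus>\<^bsub>H X Y n\<^esub> D X Y (n - 1) \<gamma>)),
     gmult = (\<lambda>p q (\<alpha>, \<beta>, \<gamma>) (\<alpha>', \<beta>', \<gamma>'). (hom_comp X q \<alpha> \<alpha>', hom_comp Y q \<beta> \<beta>',
       koszul (H X Y (p + q - 1)) p (hom_comp X (q - 1) \<beta> \<gamma>') \<oplus>\<^bsub>H X Y (p + q - 1)\<^esub> hom_comp X q \<gamma> \<alpha>')),
     gone = (hom_id X, hom_id Y, \<zero>\<^bsub>H X Y (- 1)\<^esub>)\<rparr>"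

lemma triangular_simps:
  "obj triangular n = pair_module (H X X n) (pair_module (H Y Y n) (H X Y (n - 1)))"
  "diff triangular n (\<alpha>, \<beta>, \<gamma>) = (D X X n \<alpha>, D Y Y n \<beta>,
     (hom_comp X 0 \<beta> c \<ominus>\<^bsub>H X Y n\<^esub> hom_comp X n c \<alpha>) \<ominus>\<^bsub>H X Y n\<^esub> D X Y (n - 1) \<gamma>)"
  "gmult triangular p q (\<alpha>, \<beta>, \<gamma>) (\<alpha>', \<beta>', \<gamma>') = (hom_comp X q \<alpha> \<alpha>', hom_comp Y q \<beta> \<beta>',
     koszul (H X Y (p + q - 1)) p (hom_comp X (q - 1) \<beta> \<gamma>') \<oplus>\<^bsub>H X Y (p + q - 1)\<^esub> hom_comp X q \<gamma> \<alpha>')"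
  "gone triangular = (hom_id X, hom_id Y, \<zero>\<^bsub>H X Y (- 1)\<^esub>)"
  by (simp_all add: triangular_def)

lemma H_modules: "left_module K (H X X n)" "left_module K (H Y Y n)" "left_module K (H X Y n)"
  by (rule hom_cochain_module[OF X X] hom_cochain_module[OF Y Y] hom_cochain_module[OF X Y])+

interpretation M: left_module K "H X Y n" for n by (rule H_modules)

lemma H_group: "abelian_group (H X Y n)" by (rule left_module_abelian_group[OF H_modules(3)])

lemma D_hom: "m = n + 1 \<Longrightarrow> D X X n \<in> lmod_hom K (H X X n) (H X X m)"
  "m = n + 1 \<Longrightarrow> D Y Y n \<in> lmod_hom K (H Y Y n) (H Y Y m)"
  "m = n + 1 \<Longrightarrow> D X Y n \<in> lmod_hom K (H X Y n) (H X Y m)"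
  by (rule complex_diff[OF hom_cochain_complex[OF X X]] complex_diff[OF hom_cochain_complex[OF Y Y]]
      complex_diff[OF hom_cochain_complex[OF X Y]], assumption)+

lemma comp_c_left: "(\<lambda>\<beta>. hom_comp X 0 \<beta> c) \<in> lmod_hom K (H Y Y n) (H X Y n)"
  by (rule hom_comp_hom_left[OF X Y Y c]) simp

lemma comp_c_right: "hom_comp X n c \<in> lmod_hom K (H X X n) (H X Y n)"
  by (rule hom_comp_hom_right[OF X X Y c]) simp

lemma D_comp_c_left:
  assumes \<beta>: "\<beta> \<in> carrier (H Y Y n)"
  shows "D X Y n (hom_comp X 0 \<beta> c) = hom_comp X 0 (D Y Y n \<beta>) c"
proof -
  have "hom_comp X 1 \<beta> (D X Y 0 c) = \<zero>\<^bsub>H X Y (n + 1)\<^esub>"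
    unfolding dc by (rule lmod_hom_zero[OF hom_comp_hom_right[OF X Y Y \<beta>] H_modules(3) H_modules(3)]) simp
  moreover have "hom_comp X 0 (D Y Y n \<beta>) c \<in> carrier (H X Y (n + 1))"
    by (rule lmod_hom_closed[OF comp_c_left lmod_hom_closed[OF D_hom(2)[OF refl] \<beta>]])
  ultimately show ?thesis
    using hom_comp_leibniz[OF X Y Y \<beta> c, of n "n + 1" 1] by (simp add: koszul_zero[OF H_group])
qed

lemma D_comp_c_right:
  assumes \<alpha>: "\<alpha> \<in> carrier (H X X n)"
  shows "D X Y n (hom_comp X n c \<alpha>) = hom_comp X (n + 1) c (D X X n \<alpha>)"
proof -
  have "hom_comp X n (D X Y 0 c) \<alpha> = \<zero>\<^bsub>H X Y (n + 1)\<^esub>"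
    unfolding dc by (rule lmod_hom_zero[OF hom_comp_hom_left[OF X X Y \<alpha>] H_modules(3) H_modules(3)]) simp
  moreover have "hom_comp X (n + 1) c (D X X n \<alpha>) \<in> carrier (H X Y (n + 1))"
    by (rule lmod_hom_closed[OF comp_c_right lmod_hom_closed[OF D_hom(1)[OF refl] \<alpha>]])
  ultimately show ?thesis
    using hom_comp_leibniz[OF X X Y c \<alpha>, of n "n + 1" "n + 1"] by (simp add: koszul_def)
qed

lemma triangular_complex: "cochain_complex K triangular"
  unfolding cochain_complex_def
proof (intro conjI allI ballI)
  fix n
  show "left_module K (obj triangular n)"
    unfolding triangular_simps by (intro left_module_pair H_modules)
  have "(\<lambda>x. (D X X n (fst x), D Y Y n (fst (snd x)),
      (hom_comp X 0 (fst (snd x)) c \<ominus>\<^bsub>H X Y n\<^esub> hom_comp X n c (fst x)) \<ominus>\<^bsub>H X Y n\<^esub> D X Y (n - 1) (snd (snd x))))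
      \<in> lmod_hom K (obj triangular n) (obj triangular (n + 1))"
    unfolding triangular_simps add_diff_cancel_right'
    by (intro pair_hom lmod_hom_sub H_modules lmod_hom_comp[OF fst_hom D_hom(1)[OF refl]]
        lmod_hom_comp[OF lmod_hom_comp[OF snd_hom fst_hom] D_hom(2)[OF refl]]
        lmod_hom_comp[OF lmod_hom_comp[OF snd_hom fst_hom] comp_c_left]
        lmod_hom_comp[OF fst_hom comp_c_right]
        lmod_hom_comp[OF lmod_hom_comp[OF snd_hom snd_hom] D_hom(3)]) simp
  then show "diff triangular n \<in> lmod_hom K (obj triangular n) (obj triangular (n + 1))"
    by (simp add: triangular_def case_prod_unfold)
  fix x assume "x \<in> carrier (obj triangular n)"
  then obtain \<alpha> \<beta> \<gamma> where x: "x = (\<alpha>, \<beta>, \<gamma>)" and \<alpha>: "\<alpha> \<in> carrier (H X X n)"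
    and \<beta>: "\<beta> \<in> carrier (H Y Y n)" and \<gamma>: "\<gamma> \<in> carrier (H X Y (n - 1))"
    by (auto simp: triangular_simps)
  let ?b = "hom_comp X 0 \<beta> c" and ?a = "hom_comp X n c \<alpha>" and ?g = "D X Y (n - 1) \<gamma>"
  have cl: "?b \<in> carrier (H X Y n)" "?a \<in> carrier (H X Y n)" "?g \<in> carrier (H X Y n)"
    using lmod_hom_closed[OF comp_c_left \<beta>] lmod_hom_closed[OF comp_c_right \<alpha>]
      lmod_hom_closed[OF D_hom(3) \<gamma>, of n] by simp_all
  have dcl: "D X Y n ?b \<in> carrier (H X Y (n + 1))" "D X Y n ?a \<in> carrier (H X Y (n + 1))"
    using lmod_hom_closed[OF D_hom(3)[OF refl]] cl by simp_all
  have idx: "n + 2 - 1 = n + 1" by simp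
  have dd: "D X Y n ?g = \<zero>\<^bsub>H X Y (n + 1)\<^esub>"
    using complex_diff_diff[OF hom_cochain_complex[OF X Y] \<gamma>, of n "n + 1"] by simp
  have "D X Y n ((?b \<ominus>\<^bsub>H X Y n\<^esub> ?a) \<ominus>\<^bsub>H X Y n\<^esub> ?g) = D X Y n ?b \<ominus>\<^bsub>H X Y (n + 1)\<^esub> D X Y n ?a"
    using cl dcl
    by (simp add: lmod_hom_diff[OF D_hom(3)[OF refl] H_modules(3) H_modules(3)] dd) (simp add: M.minus_eq)
  then show "diff triangular (n + 1) (diff triangular n x) = \<zero>\<^bsub>obj triangular (n + 2)\<^esub>"
    using complex_diff_diff[OF hom_cochain_complex[OF X X] \<alpha> refl refl]
      complex_diff_diff[OF hom_cochain_complex[OF Y Y] \<beta> refl refl] dcl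
    by (simp add: x triangular_simps D_comp_c_left[OF \<beta>] D_comp_c_right[OF \<alpha>] M.minus_eq M.r_neg idx)
qed

lemma triangular_dga: "dg_algebra K triangular"
proof (rule dg_algebra.intro)
  show "field K" by (rule field)
  show "cochain_complex K triangular" by (rule triangular_complex)
next
  fix y q p assume "y \<in> carrier (obj triangular q)"
  then obtain \<alpha>' \<beta>' \<gamma>' where y: "y = (\<alpha>', \<beta>', \<gamma>')" and \<alpha>': "\<alpha>' \<in> carrier (H X X q)"
    and \<beta>': "\<beta>' \<in> carrier (H Y Y q)" and \<gamma>': "\<gamma>' \<in> carrier (H X Y (q - 1))"
    by (auto simp: triangular_simps)
  have "(\<lambda>x. (hom_comp X q (fst x) \<alpha>', hom_comp Y q (fst (snd x)) \<beta>',
      koszul (H X Y (p + q - 1)) p (hom_comp X (q - 1) (fst (snd x)) \<gamma>') \<oplus>\<^bsub>H X Y (p + q - 1)\<^esub>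
        hom_comp X q (snd (snd x)) \<alpha>'))
      \<in> lmod_hom K (obj triangular p) (obj triangular (p + q))"
    unfolding triangular_simps
    by (intro pair_hom lmod_hom_plus H_modules lmod_hom_comp[OF fst_hom hom_comp_hom_left[OF X X X \<alpha>' refl]]
        lmod_hom_comp[OF lmod_hom_comp[OF snd_hom fst_hom] hom_comp_hom_left[OF Y Y Y \<beta>' refl]]
        lmod_hom_comp[OF lmod_hom_comp[OF lmod_hom_comp[OF snd_hom fst_hom] hom_comp_hom_left[OF X Y Y \<gamma>']]
          koszul_hom[OF H_modules(3)]]
        lmod_hom_comp[OF lmod_hom_comp[OF snd_hom snd_hom] hom_comp_hom_left[OF X X Y \<alpha>']]) simp_all
  then show "(\<lambda>x. gmult triangular p q x y) \<in> lmod_hom K (obj triangular p) (obj triangular (p + q))"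
    by (simp add: y triangular_def case_prod_unfold)
next
  fix x p q assume "x \<in> carrier (obj triangular p)"
  then obtain \<alpha> \<beta> \<gamma> where x: "x = (\<alpha>, \<beta>, \<gamma>)" and \<alpha>: "\<alpha> \<in> carrier (H X X p)"
    and \<beta>: "\<beta> \<in> carrier (H Y Y p)" and \<gamma>: "\<gamma> \<in> carrier (H X Y (p - 1))"
    by (auto simp: triangular_simps)
  have "(\<lambda>y. (hom_comp X q \<alpha> (fst y), hom_comp Y q \<beta> (fst (snd y)),
      koszul (H X Y (p + q - 1)) p (hom_comp X (q - 1) \<beta> (snd (snd y))) \<oplus>\<^bsub>H X Y (p + q - 1)\<^esub>
        hom_comp X q \<gamma> (fst y)))
      \<in> lmod_hom K (obj triangular q) (obj triangular (p + q))"
    unfolding triangular_simps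
    by (intro pair_hom lmod_hom_plus H_modules lmod_hom_comp[OF fst_hom hom_comp_hom_right[OF X X X \<alpha> refl]]
        lmod_hom_comp[OF lmod_hom_comp[OF snd_hom fst_hom] hom_comp_hom_right[OF Y Y Y \<beta> refl]]
        lmod_hom_comp[OF lmod_hom_comp[OF lmod_hom_comp[OF snd_hom snd_hom] hom_comp_hom_right[OF X Y Y \<beta>]]
          koszul_hom[OF H_modules(3)]]
        lmod_hom_comp[OF fst_hom hom_comp_hom_right[OF X X Y \<gamma>]]) simp_all
  then show "(\<lambda>y. gmult triangular p q x y) \<in> lmod_hom K (obj triangular q) (obj triangular (p + q))"
    by (simp add: x triangular_def case_prod_unfold)
next
  fix x p y q z r
  assume "x \<in> carrier (obj triangular p)" "y \<in> carrier (obj triangular q)" "z \<in> carrier (obj triangular r)"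
  then obtain \<alpha> \<beta> \<gamma> \<alpha>' \<beta>' \<gamma>' \<alpha>'' \<beta>'' \<gamma>'' where eq: "x = (\<alpha>, \<beta>, \<gamma>)" "y = (\<alpha>', \<beta>', \<gamma>')" "z = (\<alpha>'', \<beta>'', \<gamma>'')"
    and x: "\<alpha> \<in> carrier (H X X p)" "\<beta> \<in> carrier (H Y Y p)" "\<gamma> \<in> carrier (H X Y (p - 1))"
    and y: "\<alpha>' \<in> carrier (H X X q)" "\<beta>' \<in> carrier (H Y Y q)" "\<gamma>' \<in> carrier (H X Y (q - 1))"
    and z: "\<alpha>'' \<in> carrier (H X X r)" "\<beta>'' \<in> carrier (H Y Y r)" "\<gamma>'' \<in> carrier (H X Y (r - 1))"
    by (auto simp: triangular_simps)
  let ?M = "H X Y (p + q + r - 1)"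
  let ?t1 = "hom_comp X (q + (r - 1)) \<beta> (hom_comp X (r - 1) \<beta>' \<gamma>'')"
  let ?t2 = "hom_comp X (q - 1 + r) \<beta> (hom_comp X r \<gamma>' \<alpha>'')"
  let ?t3 = "hom_comp X (q + r) \<gamma> (hom_comp X r \<alpha>' \<alpha>'')"
  have idx: "p + (q + r) - 1 = p + q + r - 1" by simp
  have e1: "hom_comp X (r - 1) (hom_comp Y q \<beta> \<beta>') \<gamma>'' = ?t1"
    by (rule hom_comp_assoc[OF X Y x(2) y(2) z(3) refl])
  have g1: "hom_comp X (q - 1) \<beta> \<gamma>' \<in> carrier (H X Y (p + q - 1))"
    by (rule hom_comp_closed[OF X x(2) y(3)]) simp
  have g2: "hom_comp X q \<gamma> \<alpha>' \<in> carrier (H X Y (p + q - 1))"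
    by (rule hom_comp_closed[OF X x(3) y(1)]) simp
  have h: "(\<lambda>\<gamma>. hom_comp X r \<gamma> \<alpha>'') \<in> lmod_hom K (H X Y (p + q - 1)) ?M"
    by (rule hom_comp_hom_left[OF X X Y z(1)]) simp
  have e2: "hom_comp X r (koszul (H X Y (p + q - 1)) p (hom_comp X (q - 1) \<beta> \<gamma>') \<oplus>\<^bsub>H X Y (p + q - 1)\<^esub> hom_comp X q \<gamma> \<alpha>') \<alpha>''
      = koszul ?M p ?t2 \<oplus>\<^bsub>?M\<^esub> ?t3"
    using lmod_hom_add[OF h koszul_closed[OF H_group g1] g2] hom_koszul[OF h H_modules(3) H_modules(3) g1]
      hom_comp_assoc[OF X X x(2) y(3) z(1) refl] hom_comp_assoc[OF X X x(3) y(1) z(1) refl] by simp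
  have g3: "hom_comp X (r - 1) \<beta>' \<gamma>'' \<in> carrier (H X Y (q + r - 1))"
    by (rule hom_comp_closed[OF X y(2) z(3)]) simp
  have g4: "hom_comp X r \<gamma>' \<alpha>'' \<in> carrier (H X Y (q + r - 1))"
    by (rule hom_comp_closed[OF X y(3) z(1)]) simp
  have h': "hom_comp X (q + r - 1) \<beta> \<in> lmod_hom K (H X Y (q + r - 1)) ?M"
    by (rule hom_comp_hom_right[OF X Y Y x(2)]) simp
  have idx': "q + (r - 1) = q + r - 1" "q - 1 + r = q + r - 1" by simp_all
  have e3: "hom_comp X (q + r - 1) \<beta> (koszul (H X Y (q + r - 1)) q (hom_comp X (r - 1) \<beta>' \<gamma>'') \<oplus>\<^bsub>H X Y (q + r - 1)\<^esub> hom_comp X r \<gamma>' \<alpha>'')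
      = koszul ?M q ?t1 \<oplus>\<^bsub>?M\<^esub> ?t2"
    using lmod_hom_add[OF h' koszul_closed[OF H_group g3] g4] hom_koszul[OF h' H_modules(3) H_modules(3) g3]
    by (simp only: idx')
  have t: "?t1 \<in> carrier ?M" "?t2 \<in> carrier ?M" "?t3 \<in> carrier ?M"
  proof -
    show "?t3 \<in> carrier ?M"
      by (rule hom_comp_closed[OF X x(3) hom_comp_closed[OF X y(1) z(1) refl]]) simp
  qed (use lmod_hom_closed[OF h' g3] lmod_hom_closed[OF h' g4] in \<open>simp_all only: idx'\<close>)
  have "koszul ?M (p + q) ?t1 \<oplus>\<^bsub>?M\<^esub> (koszul ?M p ?t2 \<oplus>\<^bsub>?M\<^esub> ?t3) =
      koszul ?M p (koszul ?M q ?t1 \<oplus>\<^bsub>?M\<^esub> ?t2) \<oplus>\<^bsub>?M\<^esub> ?t3"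
    using t by (cases "even p"; cases "even q") (simp_all add: koszul_def M.minus_add M.a_ac)
  then show "gmult triangular (p + q) r (gmult triangular p q x y) z =
      gmult triangular p (q + r) x (gmult triangular q r y z)"
    unfolding eq triangular_simps e1 e2 e3 idx
    using hom_comp_assoc[OF X X x(1) y(1) z(1) refl] hom_comp_assoc[OF Y Y x(2) y(2) z(2) refl] by simp
next
  show "gone triangular \<in> carrier (obj triangular 0)"
    by (simp add: triangular_simps hom_id_closed X Y)
next
  fix x p assume "x \<in> carrier (obj triangular p)"
  then obtain \<alpha> \<beta> \<gamma> where eq: "x = (\<alpha>, \<beta>, \<gamma>)"
    and x: "\<alpha> \<in> carrier (H X X p)" "\<beta> \<in> carrier (H Y Y p)" "\<gamma> \<in> carrier (H X Y (p - 1))"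
    by (auto simp: triangular_simps)
  have z1: "hom_comp X p \<zero>\<^bsub>H X Y (- 1)\<^esub> \<alpha> = \<zero>\<^bsub>H X Y (p - 1)\<^esub>"
    by (rule lmod_hom_zero[OF hom_comp_hom_left[OF X X Y x(1)] H_modules(3) H_modules(3)]) simp
  have z2: "hom_comp X (- 1) \<beta> \<zero>\<^bsub>H X Y (- 1)\<^esub> = \<zero>\<^bsub>H X Y (p - 1)\<^esub>"
    by (rule lmod_hom_zero[OF hom_comp_hom_right[OF X Y Y x(2)] H_modules(3) H_modules(3)]) simp
  show "gmult triangular 0 p (gone triangular) x = x"
    using x by (simp add: eq triangular_simps hom_id_left[OF X X] hom_id_left[OF Y Y] hom_id_left[OF X Y] z1 koszul_def)
  show "gmult triangular p 0 x (gone triangular) = x"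
    using x by (simp add: eq triangular_simps hom_id_right[OF X] hom_id_right[OF Y] z2 koszul_zero[OF H_group])
next
  fix x p y q
  assume "x \<in> carrier (obj triangular p)" "y \<in> carrier (obj triangular q)"
  then obtain \<alpha> \<beta> \<gamma> \<alpha>' \<beta>' \<gamma>' where eq: "x = (\<alpha>, \<beta>, \<gamma>)" "y = (\<alpha>', \<beta>', \<gamma>')"
    and x: "\<alpha> \<in> carrier (H X X p)" "\<beta> \<in> carrier (H Y Y p)" "\<gamma> \<in> carrier (H X Y (p - 1))"
    and y: "\<alpha>' \<in> carrier (H X X q)" "\<beta>' \<in> carrier (H Y Y q)" "\<gamma>' \<in> carrier (H X Y (q - 1))"
    by (auto simp: triangular_simps)
  let ?M = "H X Y (p + q)"
  let ?t1 = "hom_comp X 0 (hom_comp Y q \<beta> \<beta>') c"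
  let ?t2 = "hom_comp X (p + q) c (hom_comp X q \<alpha> \<alpha>')"
  let ?t3 = "hom_comp X (q - 1) (D Y Y p \<beta>) \<gamma>'"
  let ?t4 = "hom_comp X q \<beta> (D X Y (q - 1) \<gamma>')"
  let ?t5 = "hom_comp X q (D X Y (p - 1) \<gamma>) \<alpha>'"
  let ?t6 = "hom_comp X (q + 1) \<gamma> (D X X q \<alpha>')"
  let ?t7 = "hom_comp X q (hom_comp X 0 \<beta> c) \<alpha>'"
  have D\<gamma>: "D X Y (p - 1) \<gamma> \<in> carrier (H X Y p)" and D\<gamma>': "D X Y (q - 1) \<gamma>' \<in> carrier (H X Y q)"
    by (rule lmod_hom_closed[OF D_hom(3) x(3)] lmod_hom_closed[OF D_hom(3) y(3)], simp)+
  have D\<alpha>': "D X X q \<alpha>' \<in> carrier (H X X (q + 1))" and D\<beta>: "D Y Y p \<beta> \<in> carrier (H Y Y (p + 1))"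
    by (rule lmod_hom_closed[OF D_hom(1)[OF refl] y(1)] lmod_hom_closed[OF D_hom(2)[OF refl] x(2)])+
  have cl: "hom_comp X 0 \<beta> c \<in> carrier (H X Y p)" "hom_comp X p c \<alpha> \<in> carrier (H X Y p)"
    "hom_comp X 0 \<beta>' c \<in> carrier (H X Y q)" "hom_comp X q c \<alpha>' \<in> carrier (H X Y q)"
    by (rule lmod_hom_closed[OF comp_c_left x(2)] lmod_hom_closed[OF comp_c_right x(1)]
        lmod_hom_closed[OF comp_c_left y(2)] lmod_hom_closed[OF comp_c_right y(1)])+
  have t: "?t1 \<in> carrier ?M" "?t2 \<in> carrier ?M" "?t3 \<in> carrier ?M" "?t4 \<in> carrier ?M" "?t5 \<in> carrier ?M"
      "?t6 \<in> carrier ?M" "?t7 \<in> carrier ?M"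
    by (rule lmod_hom_closed[OF comp_c_left hom_comp_closed[OF Y x(2) y(2) refl]]
        lmod_hom_closed[OF comp_c_right hom_comp_closed[OF X x(1) y(1) refl]]
        hom_comp_closed[OF X D\<beta> y(3)] hom_comp_closed[OF X x(2) D\<gamma>'] hom_comp_closed[OF X D\<gamma> y(1)]
        hom_comp_closed[OF X x(3) D\<alpha>'] hom_comp_closed[OF X cl(1) y(1)]; simp)+
  have gcl: "hom_comp X (q - 1) \<beta> \<gamma>' \<in> carrier (H X Y (p + q - 1))" "hom_comp X q \<gamma> \<alpha>' \<in> carrier (H X Y (p + q - 1))"
    by (rule hom_comp_closed[OF X x(2) y(3)] hom_comp_closed[OF X x(3) y(1)], simp)+
  have d: "D X Y (p + q - 1) \<in> lmod_hom K (H X Y (p + q - 1)) ?M" by (rule D_hom(3)) simp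
  have e1: "D X Y (p + q - 1) (koszul (H X Y (p + q - 1)) p (hom_comp X (q - 1) \<beta> \<gamma>')
        \<oplus>\<^bsub>H X Y (p + q - 1)\<^esub> hom_comp X q \<gamma> \<alpha>')
      = koszul ?M p (?t3 \<oplus>\<^bsub>?M\<^esub> koszul ?M p ?t4) \<oplus>\<^bsub>?M\<^esub> (?t5 \<oplus>\<^bsub>?M\<^esub> koszul ?M (p - 1) ?t6)"
  proof -
    have "D X Y (p + q - 1) (hom_comp X (q - 1) \<beta> \<gamma>') = ?t3 \<oplus>\<^bsub>?M\<^esub> koszul ?M p ?t4"
      by (rule hom_comp_leibniz[OF X Y Y x(2) y(3)]) simp_all
    moreover have "D X Y (p + q - 1) (hom_comp X q \<gamma> \<alpha>') = ?t5 \<oplus>\<^bsub>?M\<^esub> koszul ?M (p - 1) ?t6"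
      by (rule hom_comp_leibniz[OF X X Y x(3) y(1)]) simp_all
    ultimately show ?thesis
      by (simp only: lmod_hom_add[OF d koszul_closed[OF H_group gcl(1)] gcl(2)]
          hom_koszul[OF d H_modules(3) H_modules(3) gcl(1)])
  qed
  have h: "(\<lambda>\<gamma>. hom_comp X q \<gamma> \<alpha>') \<in> lmod_hom K (H X Y p) ?M"
    by (rule hom_comp_hom_left[OF X X Y y(1) refl])
  have h': "hom_comp X q \<beta> \<in> lmod_hom K (H X Y q) ?M"
    by (rule hom_comp_hom_right[OF X Y Y x(2) refl])
  have e2: "hom_comp X q ((hom_comp X 0 \<beta> c \<ominus>\<^bsub>H X Y p\<^esub> hom_comp X p c \<alpha>) \<ominus>\<^bsub>H X Y p\<^esub> D X Y (p - 1) \<gamma>) \<alpha>'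
      = (?t7 \<ominus>\<^bsub>?M\<^esub> ?t2) \<ominus>\<^bsub>?M\<^esub> ?t5"
    using lmod_hom_diff[OF h H_modules(3) H_modules(3) M.minus_closed[OF cl(1,2)] D\<gamma>]
      lmod_hom_diff[OF h H_modules(3) H_modules(3) cl(1,2)]
      hom_comp_assoc[OF X X c x(1) y(1) refl] by simp
  have e3: "hom_comp X q \<beta> ((hom_comp X 0 \<beta>' c \<ominus>\<^bsub>H X Y q\<^esub> hom_comp X q c \<alpha>') \<ominus>\<^bsub>H X Y q\<^esub> D X Y (q - 1) \<gamma>')
      = (?t1 \<ominus>\<^bsub>?M\<^esub> ?t7) \<ominus>\<^bsub>?M\<^esub> ?t4"
    using lmod_hom_diff[OF h' H_modules(3) H_modules(3) M.minus_closed[OF cl(3,4)] D\<gamma>']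
      lmod_hom_diff[OF h' H_modules(3) H_modules(3) cl(3,4)]
      hom_comp_assoc[OF X Y x(2) y(2) c, of q] hom_comp_assoc[OF X X x(2) c y(1), of q] by simp
  have idx: "p + 1 + q - 1 = p + q" "p + (q + 1) - 1 = p + q" "p + q + 1 - 1 = p + q" "q + 1 - 1 = q"
    "p + (q - 1) = p + q - 1" by simp_all
  have Ax: "hom_comp X q (D X X p \<alpha>) \<alpha>' \<in> carrier (H X X (p + q + 1))"
      "hom_comp X (q + 1) \<alpha> (D X X q \<alpha>') \<in> carrier (H X X (p + q + 1))"
      "hom_comp Y q (D Y Y p \<beta>) \<beta>' \<in> carrier (H Y Y (p + q + 1))"
      "hom_comp Y (q + 1) \<beta> (D Y Y q \<beta>') \<in> carrier (H Y Y (p + q + 1))"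
    by (rule hom_comp_closed[OF X lmod_hom_closed[OF D_hom(1)[OF refl] x(1)] y(1)]
        hom_comp_closed[OF X x(1) D\<alpha>'] hom_comp_closed[OF Y D\<beta> y(2)]
        hom_comp_closed[OF Y x(2) lmod_hom_closed[OF D_hom(2)[OF refl] y(2)]]; simp)+
  have w: "koszul ?M p ((?t1 \<ominus>\<^bsub>?M\<^esub> ?t7) \<ominus>\<^bsub>?M\<^esub> ?t4) \<oplus>\<^bsub>?M\<^esub> ?t6 \<in> carrier ?M"
    using t by (simp add: koszul_closed[OF H_group])
  have k: "koszul (obj triangular (p + q + 1)) p (gmult triangular p (q + 1) x (diff triangular q y)) =
     (koszul (H X X (p + q + 1)) p (hom_comp X (q + 1) \<alpha> (D X X q \<alpha>')),
      koszul (H Y Y (p + q + 1)) p (hom_comp Y (q + 1) \<beta> (D Y Y q \<beta>')),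
      koszul ?M p (koszul ?M p ((?t1 \<ominus>\<^bsub>?M\<^esub> ?t7) \<ominus>\<^bsub>?M\<^esub> ?t4) \<oplus>\<^bsub>?M\<^esub> ?t6))"
    unfolding eq triangular_simps idx e3
    using koszul_pair[OF H_modules(1) left_module_pair[OF H_modules(2,3)] Ax(2)] koszul_pair[OF H_modules(2,3) Ax(4) w]
      Ax(4) w by simp
  show "diff triangular (p + q) (gmult triangular p q x y) =
      gmult triangular (p + 1) q (diff triangular p x) y \<oplus>\<^bsub>obj triangular (p + q + 1)\<^esub>
      koszul (obj triangular (p + q + 1)) p (gmult triangular p (q + 1) x (diff triangular q y))"
    unfolding k
    unfolding eq triangular_simps idx e1 e2 triangular_leibniz_identity[OF H_group t]
    using hom_comp_leibniz[OF X X X x(1) y(1) refl refl refl] hom_comp_leibniz[OF Y Y Y x(2) y(2) refl refl refl]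
    by simp
qed

end

end

section \<open>Cosets and cohomology classes\<close>

lemma set_add_iff: "x \<in> set_add M A B \<longleftrightarrow> (\<exists>a\<in>A. \<exists>b\<in>B. x = a \<oplus>\<^bsub>M\<^esub> b)"
  by (auto simp: set_add_def')

lemma coset_iff: "x \<in> A +>\<^bsub>M\<^esub> y \<longleftrightarrow> (\<exists>a\<in>A. x = a \<oplus>\<^bsub>M\<^esub> y)"
  by (auto simp: a_r_coset_def')

lemma submod_uminus:
  assumes "left_module K M" "submod K B M" "x \<in> B" shows "\<ominus>\<^bsub>M\<^esub> x \<in> B"
proof -
  interpret M: left_module K M by fact
  have "(\<ominus>\<^bsub>K\<^esub> \<one>\<^bsub>K\<^esub>) \<odot>\<^bsub>M\<^esub> x \<in> B" using assms by (simp add: submod_def)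
  moreover have "x \<in> carrier M" using assms by (auto simp: submod_def)
  ultimately show ?thesis by (simp add: M.smult_l_minus)
qed

text \<open>The maps induced on cohomology and on stable classes are both of this form.\<close>

lemma set_add_image:
  assumes M: "left_module K M" and B: "submod K B M" and w: "w \<in> carrier M" and S: "S \<noteq> {}"
    and F: "\<And>s. s \<in> S \<Longrightarrow> \<exists>b\<in>B. F s = b \<oplus>\<^bsub>M\<^esub> w"
  shows "set_add M B (F ` S) = B +>\<^bsub>M\<^esub> w"
proof -
  interpret M: left_module K M by fact
  have B': "\<And>x. x \<in> B \<Longrightarrow> x \<in> carrier M" "\<And>x y. x \<in> B \<Longrightarrow> y \<in> B \<Longrightarrow> x \<oplus>\<^bsub>M\<^esub> y \<in> B"
    using B by (auto simp: submod_def)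
  show ?thesis
  proof (intro equalityI subsetI)
    fix x assume "x \<in> set_add M B (F ` S)"
    then obtain a s where a: "a \<in> B" "s \<in> S" "x = a \<oplus>\<^bsub>M\<^esub> F s" by (auto simp: set_add_iff)
    obtain b where b: "b \<in> B" "F s = b \<oplus>\<^bsub>M\<^esub> w" using F[OF a(2)] by blast
    have "x = (a \<oplus>\<^bsub>M\<^esub> b) \<oplus>\<^bsub>M\<^esub> w" using a b w B' by (simp add: M.a_assoc)
    then show "x \<in> B +>\<^bsub>M\<^esub> w" using B'(2)[OF a(1) b(1)] by (auto simp: coset_iff)
  next
    fix x assume "x \<in> B +>\<^bsub>M\<^esub> w"
    then obtain a where a: "a \<in> B" "x = a \<oplus>\<^bsub>M\<^esub> w" by (auto simp: coset_iff)
    obtain s where s: "s \<in> S" using S by blast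
    obtain b where b: "b \<in> B" "F s = b \<oplus>\<^bsub>M\<^esub> w" using F[OF s] by blast
    have "x = (a \<oplus>\<^bsub>M\<^esub> \<ominus>\<^bsub>M\<^esub> b) \<oplus>\<^bsub>M\<^esub> F s" using a b w B' by (simp add: M.a_assoc M.r_neg1)
    then show "x \<in> set_add M B (F ` S)"
      using B'(2)[OF a(1) submod_uminus[OF M B b(1)]] s by (auto simp: set_add_iff)
  qed
qed

lemma coset_eqI:
  assumes M: "left_module K M" and B: "submod K B M" and w: "w \<in> carrier M"
    and b: "b \<in> B" and x: "x = b \<oplus>\<^bsub>M\<^esub> w"
  shows "B +>\<^bsub>M\<^esub> x = B +>\<^bsub>M\<^esub> w"
proof -
  have "set_add M B ((\<lambda>s. s) ` {x}) = B +>\<^bsub>M\<^esub> w"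
    by (rule set_add_image[OF M B w]) (use b x in auto)
  then show ?thesis by (auto simp: set_eq_iff set_add_iff coset_iff)
qed

lemma coset_self:
  assumes "left_module K M" "submod K B M" "x \<in> carrier M" shows "x \<in> B +>\<^bsub>M\<^esub> x"
proof -
  interpret M: left_module K M by fact
  show ?thesis using assms by (auto simp: coset_iff submod_def intro!: bexI[of _ "\<zero>\<^bsub>M\<^esub>"])
qed

lemma submod_coboundaries:
  assumes C: "cochain_complex K C" shows "submod K (coboundaries C n) (obj C n)"
proof -
  interpret A: left_module K "obj C (n - 1)" by (rule complex_obj[OF C])
  have d: "diff C (n - 1) \<in> lmod_hom K (obj C (n - 1)) (obj C n)" by (rule complex_diff[OF C]) simp
  show ?thesis
    unfolding submod_def coboundaries_def
    using lmod_hom_zero[OF d complex_obj[OF C] complex_obj[OF C], symmetric]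
    by (auto simp: lmod_hom_closed[OF d] lmod_hom_add[OF d, symmetric] lmod_hom_smult[OF d, symmetric])
qed

lemma coboundary_closed: "cochain_complex K C \<Longrightarrow> b \<in> coboundaries C n \<Longrightarrow> b \<in> carrier (obj C n)"
  using submod_coboundaries[of K C n] by (auto simp: submod_def)

lemma coset_cohomology: "z \<in> cocycles C n \<Longrightarrow> coboundaries C n +>\<^bsub>obj C n\<^esub> z \<in> cohomology C n"
  by (simp add: cohomology_def)

lemma cohomologyE:
  assumes "S \<in> cohomology C n" obtains z where "z \<in> cocycles C n" "S = coboundaries C n +>\<^bsub>obj C n\<^esub> z"
  using assms by (auto simp: cohomology_def)

lemma chain_map_coboundary:
  assumes f: "chain_map K C C' f" and b: "b \<in> coboundaries C n" shows "f n b \<in> coboundaries C' n"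
proof -
  obtain a where a: "a \<in> carrier (obj C (n - 1))" "b = diff C (n - 1) a" using b by (auto simp: coboundaries_def)
  then have "f n b = diff C' (n - 1) (f (n - 1) a)" using chain_map_diff[OF f a(1)] by simp
  then show ?thesis using lmod_hom_closed[OF chain_map_hom[OF f] a(1)] by (auto simp: coboundaries_def)
qed

lemma chain_map_cocycle:
  assumes C: "cochain_complex K C" and C': "cochain_complex K C'" and f: "chain_map K C C' f"
    and z: "z \<in> cocycles C n" shows "f n z \<in> cocycles C' n"
  using z chain_map_diff[OF f, of z n] lmod_hom_closed[OF chain_map_hom[OF f], of z n]
    lmod_hom_zero[OF chain_map_hom[OF f] complex_obj[OF C] complex_obj[OF C'], of "n + 1"]
  by (auto simp: cocycles_def)

lemma cohomology_map_coset:
  assumes C: "cochain_complex K C" and C': "cochain_complex K C'" and f: "chain_map K C C' f"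
    and z: "z \<in> cocycles C n"
  shows "cohomology_map C' f n (coboundaries C n +>\<^bsub>obj C n\<^esub> z) = coboundaries C' n +>\<^bsub>obj C' n\<^esub> f n z"
  unfolding cohomology_map_def
proof (rule set_add_image[OF complex_obj[OF C'] submod_coboundaries[OF C']])
  have z': "z \<in> carrier (obj C n)" using z by (simp add: cocycles_def)
  show "f n z \<in> carrier (obj C' n)" by (rule lmod_hom_closed[OF chain_map_hom[OF f] z'])
  show "coboundaries C n +>\<^bsub>obj C n\<^esub> z \<noteq> {}"
    using coset_self[OF complex_obj[OF C] submod_coboundaries[OF C] z'] by blast
  fix s assume "s \<in> coboundaries C n +>\<^bsub>obj C n\<^esub> z"
  then obtain b where b: "b \<in> coboundaries C n" "s = b \<oplus>\<^bsub>obj C n\<^esub> z" by (auto simp: coset_iff)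
  have "b \<in> carrier (obj C n)" by (rule coboundary_closed[OF C b(1)])
  then have "f n s = f n b \<oplus>\<^bsub>obj C' n\<^esub> f n z" using b lmod_hom_add[OF chain_map_hom[OF f] _ z'] by simp
  then show "\<exists>b\<in>coboundaries C' n. f n s = b \<oplus>\<^bsub>obj C' n\<^esub> f n z"
    using chain_map_coboundary[OF f b(1)] by blast
qed

text \<open>Surjectivity is asked for on cocycles, because a projection of a triangular algebra provides it there.\<close>

lemma quasi_isoI:
  assumes C: "cochain_complex K C" and C': "cochain_complex K C'" and f: "chain_map K C C' f"
    and surj: "\<And>n y. y \<in> cocycles C' n \<Longrightarrow> \<exists>x\<in>cocycles C n. f n x = y"
    and inj: "\<And>n x. x \<in> cocycles C n \<Longrightarrow> f n x \<in> coboundaries C' n \<Longrightarrow> x \<in> coboundaries C n"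
  shows "quasi_iso C C' f"
  unfolding quasi_iso_def
proof
  fix n
  interpret C: left_module K "obj C n" by (rule complex_obj[OF C])
  interpret C': left_module K "obj C' n" by (rule complex_obj[OF C'])
  note map = cohomology_map_coset[OF C C' f]
  note fh = chain_map_hom[OF f, of n]
  show "bij_betw (cohomology_map C' f n) (cohomology C n) (cohomology C' n)"
    unfolding bij_betw_def
  proof
    show "inj_on (cohomology_map C' f n) (cohomology C n)"
    proof (rule inj_onI)
      fix S S' assume "S \<in> cohomology C n" "S' \<in> cohomology C n"
        and eq: "cohomology_map C' f n S = cohomology_map C' f n S'"
      then obtain x y where x: "x \<in> cocycles C n" "S = coboundaries C n +>\<^bsub>obj C n\<^esub> x"
        and y: "y \<in> cocycles C n" "S' = coboundaries C n +>\<^bsub>obj C n\<^esub> y" by (auto elim!: cohomologyE)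
      have xy: "x \<in> carrier (obj C n)" "y \<in> carrier (obj C n)" using x y by (auto simp: cocycles_def)
      note fxy = lmod_hom_closed[OF fh xy(1)] lmod_hom_closed[OF fh xy(2)]
      have "f n x \<in> coboundaries C' n +>\<^bsub>obj C' n\<^esub> f n y"
        using eq coset_self[OF complex_obj[OF C'] submod_coboundaries[OF C'] fxy(1)] x y by (simp add: map)
      then obtain b where b: "b \<in> coboundaries C' n" "f n x = b \<oplus>\<^bsub>obj C' n\<^esub> f n y" by (auto simp: coset_iff)
      have bc: "b \<in> carrier (obj C' n)" by (rule coboundary_closed[OF C' b(1)])
      have "f n (x \<ominus>\<^bsub>obj C n\<^esub> y) = b"
        using lmod_hom_diff[OF fh complex_obj[OF C] complex_obj[OF C'] xy] b fxy bc
        by (simp add: C'.minus_eq C'.a_assoc C'.r_neg)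
      moreover have "x \<ominus>\<^bsub>obj C n\<^esub> y \<in> cocycles C n"
        using submod_cocycles[OF C, of n] submod_uminus[OF complex_obj[OF C] submod_cocycles[OF C] y(1)] x(1)
        by (simp add: submod_def a_minus_def)
      ultimately have "x \<ominus>\<^bsub>obj C n\<^esub> y \<in> coboundaries C n" using inj b(1) by simp
      moreover have "x = (x \<ominus>\<^bsub>obj C n\<^esub> y) \<oplus>\<^bsub>obj C n\<^esub> y" using xy by (simp add: C.minus_eq C.a_assoc C.l_neg)
      ultimately show "S = S'"
        using coset_eqI[OF complex_obj[OF C] submod_coboundaries[OF C] xy(2)] x y by blast
    qed
    show "cohomology_map C' f n ` cohomology C n = cohomology C' n"
    proof (intro equalityI subsetI)
      fix S assume "S \<in> cohomology_map C' f n ` cohomology C n"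
      then obtain z where "z \<in> cocycles C n" "S = cohomology_map C' f n (coboundaries C n +>\<^bsub>obj C n\<^esub> z)"
        by (auto simp: cohomology_def)
      then show "S \<in> cohomology C' n" using chain_map_cocycle[OF C C' f] by (simp add: map coset_cohomology)
    next
      fix S assume "S \<in> cohomology C' n"
      then obtain y where y: "y \<in> cocycles C' n" "S = coboundaries C' n +>\<^bsub>obj C' n\<^esub> y" by (rule cohomologyE)
      obtain x where x: "x \<in> cocycles C n" "f n x = y" using surj[OF y(1)] by blast
      then have "S = cohomology_map C' f n (coboundaries C n +>\<^bsub>obj C n\<^esub> x)" by (simp add: map y)
      then show "S \<in> cohomology_map C' f n ` cohomology C n" using coset_cohomology[OF x(1)] by blast
    qed
  qed
qed


section \<open>Homomorphisms that factor through a projective module\<close>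

context finite_group_over_field
begin

text \<open>The map out of the projective module lifts along the surjection from the free module on \<open>N\<close>. So one
  test module, of the type that the definition of \<open>proj_homs\<close> prescribes, suffices for projective
  modules of every type.\<close>

lemma proj_homs_free:
  fixes M :: "('g \<Rightarrow> 'k, 'm) module" and N :: "('g \<Rightarrow> 'k, 'n) module" and P :: "('g \<Rightarrow> 'k, 'p) module"
  assumes N: "left_module kG N" and P: "projective kG P" and a: "a \<in> lmod_hom kG M P" and b: "b \<in> lmod_hom kG P N"
  shows "\<exists>e\<in>lmod_hom kG M (free_module kG (carrier N)). \<forall>x\<in>carrier M. free_cover kG N (e x) = b (a x)"
proof -
  let ?F = "free_module kG (carrier N)"
  have F: "left_module kG ?F" by (rule left_module_free[OF kG.ring_axioms])
  have "b ` carrier P \<subseteq> free_cover kG N ` carrier ?F"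
  proof
    fix y assume "y \<in> b ` carrier P"
    then have y: "y \<in> carrier N" using lmod_hom_closed[OF b] by auto
    then have "(\<lambda>x. x) y \<in> carrier N" by simp
    then have "free_cover kG N (basis_vector kG y) = y"
      by (rule linear_extension_basis[OF N group_algebra_one_neq_zero])
    then show "y \<in> free_cover kG N ` carrier ?F"
      using basis_vector_closed[OF kG.ring_axioms y] by (metis imageI)
  qed
  from projective_lift[OF P group_algebra_one_neq_zero F N free_cover_hom[OF N] b this]
  obtain g where g: "g \<in> lmod_hom kG P ?F" "\<And>x. x \<in> carrier P \<Longrightarrow> free_cover kG N (g x) = b x" by blast
  then show ?thesis using lmod_hom_closed[OF a] by (intro bexI[OF _ lmod_hom_comp[OF a g(1)]]) simp
qed

lemma proj_homs_iff:
  fixes M :: "('g \<Rightarrow> 'k, 'm) module" and N :: "('g \<Rightarrow> 'k, 'n) module"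
  assumes N: "left_module kG N"
  shows "f \<in> proj_homs K G M N \<longleftrightarrow> f \<in> carrier (hom_module K G M N) \<and>
    (\<exists>e\<in>lmod_hom kG M (free_module kG (carrier N)). \<forall>x\<in>carrier M. f x = free_cover kG N (e x))"
proof (intro iffI conjI; (elim conjE)?)
  assume f: "f \<in> proj_homs K G M N"
  then show "f \<in> carrier (hom_module K G M N)" by (simp add: proj_homs_def)
  from f obtain P :: "('g \<Rightarrow> 'k, 'n \<Rightarrow> 'g \<Rightarrow> 'k) module" and a b where
    P: "projective kG P" "a \<in> lmod_hom kG M P" "b \<in> lmod_hom kG P N" "\<forall>x\<in>carrier M. f x = b (a x)"
    by (auto simp: proj_homs_def)
  from proj_homs_free[OF N P(1-3)] P(4)
  show "\<exists>e\<in>lmod_hom kG M (free_module kG (carrier N)). \<forall>x\<in>carrier M. f x = free_cover kG N (e x)"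
    by metis
next
  assume f: "f \<in> carrier (hom_module K G M N)"
    and "\<exists>e\<in>lmod_hom kG M (free_module kG (carrier N)). \<forall>x\<in>carrier M. f x = free_cover kG N (e x)"
  then obtain e where "e \<in> lmod_hom kG M (free_module kG (carrier N))" "\<forall>x\<in>carrier M. f x = free_cover kG N (e x)"
    by blast
  then show "f \<in> proj_homs K G M N"
    using f projective_free[OF kG.ring_axioms group_algebra_one_neq_zero, of "carrier N"] free_cover_hom[OF N]
    unfolding proj_homs_def by blast
qed

text \<open>Two maps that factor through projective modules factor through the same free module, hence so does
  their sum.\<close>

lemma submod_proj_homs:
  fixes M :: "('g \<Rightarrow> 'k, 'm) module" and N :: "('g \<Rightarrow> 'k, 'n) module"
  assumes M: "left_module kG M" and N: "left_module kG N"
  shows "submod K (proj_homs K G M N) (hom_module K G M N)"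
proof -
  let ?F = "free_module kG (carrier N)" and ?H = "hom_module K G M N"
  have F: "left_module kG ?F" by (rule left_module_free[OF kG.ring_axioms])
  interpret H: left_module K ?H by (rule left_module_hom_module[OF M N])
  note \<pi> = free_cover_hom[OF N]
  show ?thesis
    unfolding submod_def
  proof (intro conjI ballI subsetI)
    fix f assume "f \<in> proj_homs K G M N" then show "f \<in> carrier ?H" by (simp add: proj_homs_iff[OF N])
  next
    show "\<zero>\<^bsub>?H\<^esub> \<in> proj_homs K G M N"
      unfolding proj_homs_iff[OF N]
      using lmod_hom_zero[OF \<pi> F N]
      by (intro conjI H.M.zero_closed bexI[OF _ lmod_hom_const_zero[OF F]]) (simp add: hom_module_simps)
  next
    fix f g assume "f \<in> proj_homs K G M N" "g \<in> proj_homs K G M N"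
    then obtain d e where fg: "f \<in> carrier ?H" "g \<in> carrier ?H"
      and d: "d \<in> lmod_hom kG M ?F" "\<And>x. x \<in> carrier M \<Longrightarrow> f x = free_cover kG N (d x)"
      and e: "e \<in> lmod_hom kG M ?F" "\<And>x. x \<in> carrier M \<Longrightarrow> g x = free_cover kG N (e x)"
      by (auto simp: proj_homs_iff[OF N])
    show "f \<oplus>\<^bsub>?H\<^esub> g \<in> proj_homs K G M N"
      unfolding proj_homs_iff[OF N]
      by (intro conjI H.M.a_closed fg bexI[OF _ lmod_hom_plus[OF F d(1) e(1)]])
         (simp add: hom_module_simps d(2) e(2) lmod_hom_add[OF \<pi>] lmod_hom_closed[OF d(1)] lmod_hom_closed[OF e(1)])
  next
    fix a f assume a: "a \<in> carrier K" and "f \<in> proj_homs K G M N"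
    then obtain d where f: "f \<in> carrier ?H"
      and d: "d \<in> lmod_hom kG M ?F" "\<And>x. x \<in> carrier M \<Longrightarrow> f x = free_cover kG N (d x)"
      by (auto simp: proj_homs_iff[OF N])
    show "a \<odot>\<^bsub>?H\<^esub> f \<in> proj_homs K G M N"
      unfolding proj_homs_iff[OF N]
      by (intro conjI H.smult_closed a f bexI[OF _ lmod_hom_scalar[OF F d(1) a]])
         (simp add: hom_module_simps d(2) lmod_hom_smult[OF \<pi> scalar_closed[OF a]] lmod_hom_closed[OF d(1)])
  qed
qed

end

section \<open>The zigzag between the endomorphism algebras\<close>

context finite_group_over_field
begin

lemma trivial_carrier: "carrier (trivial_module K G) = carrier K"
  by (simp add: trivial_module_def)

lemma hom_complex_complex:
  fixes M :: "('g \<Rightarrow> 'k, 'm) module" and C :: "('g \<Rightarrow> 'k, 'n) cochain"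
  assumes M: "left_module kG M" and C: "cochain_complex kG C"
  shows "cochain_complex K (hom_complex K G M C)"
  unfolding cochain_complex_def
proof (intro conjI allI ballI)
  fix n
  interpret C1: left_module kG "obj C (n + 1)" by (rule complex_obj[OF C])
  have mods: "left_module K (hom_module K G M (obj C m))" for m
    by (rule left_module_hom_module[OF M complex_obj[OF C]])
  interpret H: left_module K "hom_module K G M (obj C m)" for m by (rule mods)
  note d = complex_diff[OF C refl, of n]
  have hom: "f \<in> lmod_hom kG M (obj C m)" if "f \<in> carrier (hom_module K G M (obj C m))" for f m
    using that by (simp add: hom_module_simps)
  have cl: "compose (carrier M) (diff C m) f \<in> carrier (hom_module K G M (obj C (m + 1)))"
    if "f \<in> carrier (hom_module K G M (obj C m))" for f m
    unfolding compose_def by (rule restrict_hom[OF M lmod_hom_comp[OF hom[OF that] complex_diff[OF C refl]]])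
  show "left_module K (obj (hom_complex K G M C) n)" by (simp add: hom_complex_def mods)
  have "compose (carrier M) (diff C n) \<in> lmod_hom K (hom_module K G M (obj C n)) (hom_module K G M (obj C (n + 1)))"
  proof (rule lmod_homI)
    fix f g assume f: "f \<in> carrier (hom_module K G M (obj C n))" and g: "g \<in> carrier (hom_module K G M (obj C n))"
    show "compose (carrier M) (diff C n) (f \<oplus>\<^bsub>hom_module K G M (obj C n)\<^esub> g) =
        compose (carrier M) (diff C n) f \<oplus>\<^bsub>hom_module K G M (obj C (n + 1))\<^esub> compose (carrier M) (diff C n) g"
      using lmod_hom_closed[OF hom[OF f]] lmod_hom_closed[OF hom[OF g]]
      by (auto simp: compose_def hom_module_simps lmod_hom_add[OF d] fun_eq_iff)
  next
    fix a f assume a: "a \<in> carrier K" and f: "f \<in> carrier (hom_module K G M (obj C n))"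
    show "compose (carrier M) (diff C n) (a \<odot>\<^bsub>hom_module K G M (obj C n)\<^esub> f) =
        a \<odot>\<^bsub>hom_module K G M (obj C (n + 1))\<^esub> compose (carrier M) (diff C n) f"
      using lmod_hom_closed[OF hom[OF f]] scalar_closed[OF a]
      by (auto simp: compose_def hom_module_simps lmod_hom_smult[OF d] fun_eq_iff)
  qed (rule cl)
  then show "diff (hom_complex K G M C) n \<in> lmod_hom K (obj (hom_complex K G M C) n) (obj (hom_complex K G M C) (n + 1))"
    by (simp add: hom_complex_def)
  fix f assume f: "f \<in> carrier (obj (hom_complex K G M C) n)"
  then have "diff C (n + 1) (diff C n (f x)) = \<zero>\<^bsub>obj C (n + 2)\<^esub>" if "x \<in> carrier M" for x
    using that complex_diff_diff[OF C _ refl refl] by (auto simp: hom_complex_def hom_module_simps lmod_hom_closed)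
  then show "diff (hom_complex K G M C) (n + 1) (diff (hom_complex K G M C) n f) = \<zero>\<^bsub>obj (hom_complex K G M C) (n + 2)\<^esub>"
    by (auto simp: hom_complex_def compose_def hom_module_simps fun_eq_iff)
qed

lemma End_complex: "cochain_complex kG X \<Longrightarrow> cochain_complex K (End_dga K G X)"
  using dg_algebra.complex[OF End_dga] .

lemma End_cocycle_preserves_cocycles:
  assumes X: "cochain_complex kG X" and \<phi>: "\<phi> \<in> cocycles (End_dga K G X) n" and x: "x \<in> cocycles X q"
  shows "\<phi> q x \<in> cocycles X (q + n)"
proof -
  interpret Xn: left_module kG "obj X (q + n + 1)" by (rule complex_obj[OF X])
  have \<phi>': "\<phi> \<in> carrier (H X X n)" "D X X n \<phi> = \<zero>\<^bsub>H X X (n + 1)\<^esub>"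
    using \<phi> by (auto simp: cocycles_def End_dga_eq)
  have x': "x \<in> carrier (obj X q)" "diff X q x = \<zero>\<^bsub>obj X (q + 1)\<^esub>" using x by (auto simp: cocycles_def)
  have cl: "\<phi> q x \<in> carrier (obj X (q + n))" by (rule hom_cochain_closed[OF \<phi>'(1) x'(1) refl])
  have z: "\<phi> (q + 1) \<zero>\<^bsub>obj X (q + 1)\<^esub> = \<zero>\<^bsub>obj X (q + n + 1)\<^esub>"
    by (rule lmod_hom_zero[OF hom_cochain_hom[OF \<phi>'(1)] complex_obj[OF X] complex_obj[OF X]]) simp
  have idx: "q + (n + 1) = q + n + 1" by simp
  have "D X X n \<phi> q x = \<zero>\<^bsub>obj X (q + n + 1)\<^esub>"
    unfolding \<phi>'(2) hom_cochain_eval(2)[OF x'(1)] idx ..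
  then have "diff X (q + n) (\<phi> q x) = \<zero>\<^bsub>obj X (q + n + 1)\<^esub>"
    using lmod_hom_closed[OF complex_diff[OF X refl] cl]
    by (simp add: hom_cochain_eval(4)[OF x'(1)] x'(2) z koszul_zero[OF Xn.M.abelian_group_axioms] Xn.minus_eq)
  then show ?thesis using cl by (simp add: cocycles_def)
qed

text \<open>Of the two terms of a coboundary, \<open>\<psi> d\<close> vanishes on cocycles.\<close>

lemma End_coboundary_on_cocycle:
  assumes X: "cochain_complex kG X" and b: "b \<in> coboundaries (End_dga K G X) n"
  obtains \<psi> where "\<psi> \<in> carrier (H X X (n - 1))"
    and "\<And>x. x \<in> cocycles X 0 \<Longrightarrow> b 0 x = diff X (n - 1) (\<psi> 0 x)"
proof -
  obtain \<psi> where \<psi>: "\<psi> \<in> carrier (H X X (n - 1))" "b = D X X (n - 1) \<psi>"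
    using b by (auto simp: coboundaries_def End_dga_eq)
  interpret Xn: left_module kG "obj X n" by (rule complex_obj[OF X])
  have "b 0 x = diff X (n - 1) (\<psi> 0 x)" if x: "x \<in> cocycles X 0" for x
  proof -
    have x': "x \<in> carrier (obj X 0)" "diff X 0 x = \<zero>\<^bsub>obj X 1\<^esub>" using x by (auto simp: cocycles_def)
    have z: "\<psi> 1 \<zero>\<^bsub>obj X 1\<^esub> = \<zero>\<^bsub>obj X n\<^esub>"
      by (rule lmod_hom_zero[OF hom_cochain_hom[OF \<psi>(1)] complex_obj[OF X] complex_obj[OF X]]) simp
    have "diff X (n - 1) (\<psi> 0 x) \<in> carrier (obj X n)"
      by (rule lmod_hom_closed[OF complex_diff[OF X] hom_cochain_closed[OF \<psi>(1) x'(1)]]) simp_all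
    then show ?thesis
      by (simp add: \<psi>(2) hom_cochain_eval(4)[OF x'(1)] x'(2) z koszul_zero[OF Xn.M.abelian_group_axioms] Xn.minus_eq)
  qed
  then show thesis using that \<psi>(1) by blast
qed

context
  fixes I :: "('g \<Rightarrow> 'k, 'i) cochain" and \<eta> :: "'k \<Rightarrow> 'i"
    and T :: "('g \<Rightarrow> 'k, 't) cochain" and \<theta> :: "'k \<Rightarrow> 't"
  assumes I: "injective_resolution kG (trivial_module K G) I \<eta>"
    and T: "tate_resolution kG (trivial_module K G) T \<theta>"
begin

abbreviation triv :: "('g \<Rightarrow> 'k, 'k) module" where "triv \<equiv> trivial_module K G"
abbreviation Hk :: "int \<Rightarrow> ('k, 'k \<Rightarrow> 't) module" where "Hk n \<equiv> hom_module K G triv (syzygy T n)"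
abbreviation PH :: "int \<Rightarrow> ('k \<Rightarrow> 't) set" where "PH n \<equiv> proj_homs K G triv (syzygy T n)"

lemmas resI = injective_resolutionD[OF I]
lemmas resT = tate_resolutionD[OF trivial_module T]

lemma \<eta>_cocycle: "x \<in> carrier K \<Longrightarrow> \<eta> x \<in> cocycles I 0"
  using resI(5) by (auto simp: trivial_carrier)

lemma \<theta>_cocycle: "x \<in> carrier K \<Longrightarrow> \<theta> x \<in> cocycles T 0"
  using resT(7) by (auto simp: trivial_carrier)

lemma syzygy_module: "left_module kG (syzygy T n)"
  unfolding syzygy_def by (rule left_module_submod[OF complex_obj[OF resT(1)] submod_cocycles[OF resT(1)]])

lemma Hk_module: "left_module K (Hk n)"
  by (rule left_module_hom_module[OF trivial_module syzygy_module])

lemma PH_submod: "submod K (PH n) (Hk n)"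
  by (rule submod_proj_homs[OF trivial_module syzygy_module])

lemma hom_into_syzygy:
  assumes "f \<in> lmod_hom kG triv (obj T n)" and "\<And>x. x \<in> carrier K \<Longrightarrow> f x \<in> cocycles T n"
  shows "f \<in> lmod_hom kG triv (syzygy T n)"
  by (rule lmod_homI)
     (use assms in \<open>auto simp: syzygy_def trivial_carrier lmod_hom_add[OF assms(1)] lmod_hom_smult[OF assms(1)]\<close>)

text \<open>The difference factors through the projective module that \<open>T\<close> has in degree \<open>n - 1\<close>.\<close>

lemma stably_equal:
  assumes f: "f \<in> carrier (Hk n)" and e: "e \<in> extensional (carrier K)"
    and s: "s \<in> lmod_hom kG triv (obj T (n - 1))"
    and eq: "\<And>x. x \<in> carrier K \<Longrightarrow> e x = diff T (n - 1) (s x) \<oplus>\<^bsub>obj T n\<^esub> f x"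
  shows "\<exists>p\<in>PH n. e = p \<oplus>\<^bsub>Hk n\<^esub> f"
proof -
  have d: "diff T (n - 1) \<in> lmod_hom kG (obj T (n - 1)) (obj T n)" by (rule complex_diff[OF resT(1)]) simp
  have dz: "diff T (n - 1) y \<in> cocycles T n" if "y \<in> carrier (obj T (n - 1))" for y
    using resT(4)[of n] that by (auto simp: coboundaries_def)
  have d': "diff T (n - 1) \<in> lmod_hom kG (obj T (n - 1)) (syzygy T n)"
    by (rule lmod_homI) (auto simp: syzygy_def dz lmod_hom_add[OF d] lmod_hom_smult[OF d])
  define p where "p = restrict (\<lambda>x. diff T (n - 1) (s x)) (carrier triv)"
  have "p \<in> carrier (Hk n)"
    unfolding p_def by (rule restrict_hom[OF trivial_module lmod_hom_comp[OF s d']])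
  moreover obtain g where "g \<in> lmod_hom kG triv (free_module kG (carrier (syzygy T n)))"
    "\<forall>x\<in>carrier triv. free_cover kG (syzygy T n) (g x) = diff T (n - 1) (s x)"
    using proj_homs_free[OF syzygy_module resT(2) s d'] by blast
  ultimately have p: "p \<in> PH n"
    unfolding proj_homs_iff[OF syzygy_module] by (intro conjI bexI[of _ g]) (simp_all add: p_def)
  have "e x = (p \<oplus>\<^bsub>Hk n\<^esub> f) x" for x
    using eq[of x] e by (cases "x \<in> carrier K")
      (auto simp: hom_module_simps p_def trivial_carrier syzygy_def extensional_def)
  then show ?thesis using p by blast
qed

lemma restriction_to_cocycles:
  assumes X: "cochain_complex kG X" and \<xi>: "\<xi> \<in> lmod_hom kG triv (obj X 0)"
    and \<phi>: "\<phi> \<in> carrier (H X X n)"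
  shows "(\<lambda>x. \<phi> 0 (\<xi> x)) \<in> lmod_hom kG triv (obj X n)"
  by (rule lmod_hom_comp[OF \<xi> hom_cochain_hom[OF \<phi>]]) simp

lemma tate_class_closed:
  assumes \<beta>: "\<beta> \<in> cocycles (End_dga K G T) n"
  shows "compose (carrier K) (\<beta> 0) \<theta> \<in> carrier (Hk n)"
proof -
  have "\<beta> \<in> carrier (H T T n)" using \<beta> by (simp add: cocycles_def End_dga_eq)
  from restriction_to_cocycles[OF resT(1) resT(5) this]
  have "(\<lambda>x. \<beta> 0 (\<theta> x)) \<in> lmod_hom kG triv (syzygy T n)"
    using End_cocycle_preserves_cocycles[OF resT(1) \<beta> \<theta>_cocycle] by (intro hom_into_syzygy) simp_all
  from restrict_hom[OF trivial_module this] show ?thesis by (simp add: compose_def trivial_carrier)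
qed

lemma ident_tate_coset:
  assumes \<beta>: "\<beta> \<in> cocycles (End_dga K G T) n"
  shows "ident_tate K G T \<theta> n (coboundaries (End_dga K G T) n +>\<^bsub>obj (End_dga K G T) n\<^esub> \<beta>) =
    PH n +>\<^bsub>Hk n\<^esub> compose (carrier K) (\<beta> 0) \<theta>"
  unfolding ident_tate_def stable_class_map_def
proof (rule set_add_image[OF Hk_module PH_submod tate_class_closed[OF \<beta>]])
  note E = End_complex[OF resT(1)]
  have \<beta>': "\<beta> \<in> carrier (obj (End_dga K G T) n)" using \<beta> by (simp add: cocycles_def)
  show "coboundaries (End_dga K G T) n +>\<^bsub>obj (End_dga K G T) n\<^esub> \<beta> \<noteq> {}"
    using coset_self[OF complex_obj[OF E] submod_coboundaries[OF E] \<beta>'] by blast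
  fix s assume "s \<in> coboundaries (End_dga K G T) n +>\<^bsub>obj (End_dga K G T) n\<^esub> \<beta>"
  then obtain b where b: "b \<in> coboundaries (End_dga K G T) n" "s = b \<oplus>\<^bsub>obj (End_dga K G T) n\<^esub> \<beta>"
    by (auto simp: coset_iff)
  obtain \<psi> where \<psi>: "\<psi> \<in> carrier (H T T (n - 1))"
    and b0: "\<And>x. x \<in> cocycles T 0 \<Longrightarrow> b 0 x = diff T (n - 1) (\<psi> 0 x)"
    using End_coboundary_on_cocycle[OF resT(1) b(1)] by blast
  show "\<exists>p\<in>PH n. compose (carrier K) (s 0) \<theta> = p \<oplus>\<^bsub>Hk n\<^esub> compose (carrier K) (\<beta> 0) \<theta>"
  proof (rule stably_equal[OF tate_class_closed[OF \<beta>] _ restriction_to_cocycles[OF resT(1) resT(5) \<psi>]])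
    fix x assume x: "x \<in> carrier K"
    then have "\<theta> x \<in> carrier (obj T 0)" using \<theta>_cocycle by (auto simp: cocycles_def)
    then have "(b \<oplus>\<^bsub>H T T n\<^esub> \<beta>) 0 (\<theta> x) = b 0 (\<theta> x) \<oplus>\<^bsub>obj T n\<^esub> \<beta> 0 (\<theta> x)"
      by (simp add: hom_cochain_eval)
    then show "compose (carrier K) (s 0) \<theta> x = diff T (n - 1) (\<psi> 0 (\<theta> x)) \<oplus>\<^bsub>obj T n\<^esub> compose (carrier K) (\<beta> 0) \<theta> x"
      using x by (simp add: compose_def b End_dga_eq b0[OF \<theta>_cocycle[OF x]])
  qed (simp add: compose_def)
qed

abbreviation Ext_complex :: "('k, 'k \<Rightarrow> 'i) cochain" where "Ext_complex \<equiv> hom_complex K G triv I"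

lemmas Ext_complex = hom_complex_complex[OF trivial_module resI(1)]

lemma ext_class_cocycle:
  assumes \<alpha>: "\<alpha> \<in> cocycles (End_dga K G I) n"
  shows "compose (carrier K) (\<alpha> 0) \<eta> \<in> cocycles Ext_complex n"
proof -
  have \<alpha>': "\<alpha> \<in> carrier (H I I n)" using \<alpha> by (simp add: cocycles_def End_dga_eq)
  have "compose (carrier K) (\<alpha> 0) \<eta> \<in> carrier (hom_module K G triv (obj I n))"
    using restrict_hom[OF trivial_module restriction_to_cocycles[OF resI(1) resI(3) \<alpha>']]
    by (simp add: compose_def trivial_carrier)
  moreover have "diff I n (\<alpha> 0 (\<eta> x)) = \<zero>\<^bsub>obj I (n + 1)\<^esub>" if "x \<in> carrier K" for x
    using End_cocycle_preserves_cocycles[OF resI(1) \<alpha> \<eta>_cocycle[OF that]] by (simp add: cocycles_def)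
  ultimately show ?thesis
    by (auto simp: cocycles_def hom_complex_def compose_def hom_module_simps trivial_carrier fun_eq_iff)
qed

lemma ident_ext_coset:
  assumes \<alpha>: "\<alpha> \<in> cocycles (End_dga K G I) n"
  shows "ident_ext K G I \<eta> n (coboundaries (End_dga K G I) n +>\<^bsub>obj (End_dga K G I) n\<^esub> \<alpha>) =
    coboundaries Ext_complex n +>\<^bsub>obj Ext_complex n\<^esub> compose (carrier K) (\<alpha> 0) \<eta>"
  unfolding ident_ext_def cohomology_map_def
proof (rule set_add_image[OF complex_obj[OF Ext_complex] submod_coboundaries[OF Ext_complex]])
  note E = End_complex[OF resI(1)]
  have \<alpha>': "\<alpha> \<in> carrier (obj (End_dga K G I) n)" using \<alpha> by (simp add: cocycles_def)
  show "compose (carrier K) (\<alpha> 0) \<eta> \<in> carrier (obj Ext_complex n)"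
    using ext_class_cocycle[OF \<alpha>] by (simp add: cocycles_def)
  show "coboundaries (End_dga K G I) n +>\<^bsub>obj (End_dga K G I) n\<^esub> \<alpha> \<noteq> {}"
    using coset_self[OF complex_obj[OF E] submod_coboundaries[OF E] \<alpha>'] by blast
  fix s assume "s \<in> coboundaries (End_dga K G I) n +>\<^bsub>obj (End_dga K G I) n\<^esub> \<alpha>"
  then obtain b where b: "b \<in> coboundaries (End_dga K G I) n" "s = b \<oplus>\<^bsub>obj (End_dga K G I) n\<^esub> \<alpha>"
    by (auto simp: coset_iff)
  obtain \<psi> where \<psi>: "\<psi> \<in> carrier (H I I (n - 1))"
    and b0: "\<And>x. x \<in> cocycles I 0 \<Longrightarrow> b 0 x = diff I (n - 1) (\<psi> 0 x)"
    using End_coboundary_on_cocycle[OF resI(1) b(1)] by blast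
  let ?p = "diff Ext_complex (n - 1) (compose (carrier K) (\<psi> 0) \<eta>)"
  have "compose (carrier K) (\<psi> 0) \<eta> \<in> carrier (obj Ext_complex (n - 1))"
    using restrict_hom[OF trivial_module restriction_to_cocycles[OF resI(1) resI(3) \<psi>]]
    by (simp add: compose_def trivial_carrier hom_complex_def)
  then have "?p \<in> coboundaries Ext_complex n" by (simp add: coboundaries_def)
  moreover have "compose (carrier K) (s 0) \<eta> = ?p \<oplus>\<^bsub>obj Ext_complex n\<^esub> compose (carrier K) (\<alpha> 0) \<eta>"
  proof
    fix x
    show "compose (carrier K) (s 0) \<eta> x = (?p \<oplus>\<^bsub>obj Ext_complex n\<^esub> compose (carrier K) (\<alpha> 0) \<eta>) x"
    proof (cases "x \<in> carrier K")
      case True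
      then have "\<eta> x \<in> carrier (obj I 0)" using \<eta>_cocycle by (auto simp: cocycles_def)
      then have "(b \<oplus>\<^bsub>H I I n\<^esub> \<alpha>) 0 (\<eta> x) = b 0 (\<eta> x) \<oplus>\<^bsub>obj I n\<^esub> \<alpha> 0 (\<eta> x)"
        by (simp add: hom_cochain_eval)
      then show ?thesis
        using True by (simp add: compose_def b End_dga_eq b0[OF \<eta>_cocycle[OF True]] hom_complex_def
            hom_module_simps trivial_carrier)
    qed (simp add: compose_def hom_complex_def hom_module_simps trivial_carrier)
  qed
  ultimately show "\<exists>p\<in>coboundaries Ext_complex n.
      compose (carrier K) (s 0) \<eta> = p \<oplus>\<^bsub>obj Ext_complex n\<^esub> compose (carrier K) (\<alpha> 0) \<eta>" by blast
qed

lemma ext_cocycleD: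
  assumes "z \<in> cocycles Ext_complex n"
  shows "z \<in> lmod_hom kG triv (obj I n)" and "x \<in> carrier K \<Longrightarrow> z x \<in> cocycles I n"
proof -
  show z: "z \<in> lmod_hom kG triv (obj I n)"
    using assms by (simp add: cocycles_def hom_complex_def hom_module_simps)
  assume x: "x \<in> carrier K"
  have "compose (carrier K) (diff I n) z x = (\<lambda>x\<in>carrier K. \<zero>\<^bsub>obj I (n + 1)\<^esub>) x"
    using assms by (simp add: cocycles_def hom_complex_def hom_module_simps trivial_carrier)
  then show "z x \<in> cocycles I n"
    using x lmod_hom_closed[OF z] by (simp add: cocycles_def compose_def trivial_carrier)
qed

lemma transported_class_closed:
  assumes c: "chain_map kG I T c" and z: "z \<in> cocycles Ext_complex n"
  shows "compose (carrier K) (c n) z \<in> carrier (Hk n)"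
proof -
  have "(\<lambda>x. c n (z x)) \<in> lmod_hom kG triv (syzygy T n)"
    by (rule hom_into_syzygy[OF lmod_hom_comp[OF ext_cocycleD(1)[OF z] chain_map_hom[OF c]]])
       (rule chain_map_cocycle[OF resI(1) resT(1) c ext_cocycleD(2)[OF z]])
  from restrict_hom[OF trivial_module this] show ?thesis by (simp add: compose_def trivial_carrier)
qed

lemma stable_class_map_coset:
  assumes c: "chain_map kG I T c" and z: "z \<in> cocycles Ext_complex n"
  shows "stable_class_map K G T n (\<lambda>z. compose (carrier K) (c n) z)
      (coboundaries Ext_complex n +>\<^bsub>obj Ext_complex n\<^esub> z) = PH n +>\<^bsub>Hk n\<^esub> compose (carrier K) (c n) z"
  unfolding stable_class_map_def
proof (rule set_add_image[OF Hk_module PH_submod transported_class_closed[OF c z]])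
  note zh = ext_cocycleD(1)[OF z] and cn = chain_map_hom[OF c, of n]
  have "z \<in> carrier (obj Ext_complex n)" using z by (simp add: cocycles_def)
  from coset_self[OF complex_obj[OF Ext_complex] submod_coboundaries[OF Ext_complex] this]
  show "coboundaries Ext_complex n +>\<^bsub>obj Ext_complex n\<^esub> z \<noteq> {}" by blast
  fix s assume "s \<in> coboundaries Ext_complex n +>\<^bsub>obj Ext_complex n\<^esub> z"
  then obtain b where b: "b \<in> coboundaries Ext_complex n" "s = b \<oplus>\<^bsub>obj Ext_complex n\<^esub> z" by (auto simp: coset_iff)
  then obtain w where w: "w \<in> lmod_hom kG triv (obj I (n - 1))" "b = compose (carrier K) (diff I (n - 1)) w"
    by (auto simp: coboundaries_def hom_complex_def hom_module_simps trivial_carrier)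
  show "\<exists>p\<in>PH n. compose (carrier K) (c n) s = p \<oplus>\<^bsub>Hk n\<^esub> compose (carrier K) (c n) z"
  proof (rule stably_equal[OF transported_class_closed[OF c z] _ lmod_hom_comp[OF w(1) chain_map_hom[OF c]]])
    fix x assume x: "x \<in> carrier K"
    have wx: "w x \<in> carrier (obj I (n - 1))" and zx: "z x \<in> carrier (obj I n)"
      using lmod_hom_closed[OF w(1)] lmod_hom_closed[OF zh] x by (simp_all add: trivial_carrier)
    have dw: "diff I (n - 1) (w x) \<in> carrier (obj I n)"
      by (rule lmod_hom_closed[OF complex_diff[OF resI(1)] wx]) simp
    have "s x = diff I (n - 1) (w x) \<oplus>\<^bsub>obj I n\<^esub> z x"
      using x by (simp add: b w hom_complex_def hom_module_simps trivial_carrier compose_def)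
    then show "compose (carrier K) (c n) s x =
        diff T (n - 1) (c (n - 1) (w x)) \<oplus>\<^bsub>obj T n\<^esub> compose (carrier K) (c n) z x"
      using x chain_map_diff[OF c wx] lmod_hom_add[OF cn dw zx] by (simp add: compose_def)
  qed (simp add: compose_def)
qed

text \<open>Two comparison maps differ by a homotopy, and on cocycles only the term \<open>d s\<close> of it is left. So the
  stable class does not depend on the comparison map, and the definite description is justified.\<close>

lemma tate_iota_coset:
  assumes c: "comparison kG triv I \<eta> T \<theta> c" and z: "z \<in> cocycles Ext_complex n"
  shows "tate_iota K G I \<eta> T \<theta> n (coboundaries Ext_complex n +>\<^bsub>obj Ext_complex n\<^esub> z) =
    PH n +>\<^bsub>Hk n\<^esub> compose (carrier K) (c n) z"
proof -
  let ?S = "coboundaries Ext_complex n +>\<^bsub>obj Ext_complex n\<^esub> z"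
  let ?Y = "PH n +>\<^bsub>Hk n\<^esub> compose (carrier K) (c n) z"
  have cm: "chain_map kG I T c'" if "comparison kG triv I \<eta> T \<theta> c'" for c'
    using that by (simp add: comparison_def)
  have S: "?S \<in> group_cohomology K G I n"
    unfolding group_cohomology_def by (rule coset_cohomology[OF z])
  have Y: "?Y \<in> tate_cohomology K G T n"
    unfolding tate_cohomology_def stable_hom_def
    by (rule imageI[OF transported_class_closed[OF cm[OF c] z]])
  have same: "PH n +>\<^bsub>Hk n\<^esub> compose (carrier K) (c' n) z = ?Y" if c': "comparison kG triv I \<eta> T \<theta> c'" for c'
  proof -
    obtain s where s: "s \<in> lmod_hom kG (obj I n) (obj T (n - 1))"
      "\<And>y. y \<in> cocycles I n \<Longrightarrow> c' n y \<ominus>\<^bsub>obj T n\<^esub> c n y = diff T (n - 1) (s y)"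
      using comparison_unique[OF trivial_module I T c' c] by blast
    have "\<exists>p\<in>PH n. compose (carrier K) (c' n) z = p \<oplus>\<^bsub>Hk n\<^esub> compose (carrier K) (c n) z"
    proof (rule stably_equal[OF transported_class_closed[OF cm[OF c] z] _ lmod_hom_comp[OF ext_cocycleD(1)[OF z] s(1)]])
      fix x assume x: "x \<in> carrier K"
      interpret Tn: left_module kG "obj T n" by (rule complex_obj[OF resT(1)])
      have zx: "z x \<in> cocycles I n" by (rule ext_cocycleD(2)[OF z x])
      then have cl: "c' n (z x) \<in> carrier (obj T n)" "c n (z x) \<in> carrier (obj T n)"
        using lmod_hom_closed[OF chain_map_hom[OF cm[OF c']]] lmod_hom_closed[OF chain_map_hom[OF cm[OF c]]]
        by (auto simp: cocycles_def)
      show "compose (carrier K) (c' n) z x = diff T (n - 1) (s (z x)) \<oplus>\<^bsub>obj T n\<^esub> compose (carrier K) (c n) z x"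
        using x cl by (simp add: compose_def s(2)[OF zx, symmetric] Tn.minus_eq Tn.a_assoc Tn.l_neg)
    qed (simp add: compose_def)
    then show ?thesis
      using coset_eqI[OF Hk_module PH_submod transported_class_closed[OF cm[OF c] z]] by blast
  qed
  have "(THE Y. Y \<in> tate_cohomology K G T n \<and> (\<exists>c. comparison kG triv I \<eta> T \<theta> c \<and>
      Y = stable_class_map K G T n (\<lambda>z. compose (carrier K) (c n) z) ?S)) = ?Y"
  proof (rule the_equality)
    show "?Y \<in> tate_cohomology K G T n \<and> (\<exists>c. comparison kG triv I \<eta> T \<theta> c \<and>
        ?Y = stable_class_map K G T n (\<lambda>z. compose (carrier K) (c n) z) ?S)"
      using Y c stable_class_map_coset[OF cm[OF c] z] by blast
  next
    fix Y assume "Y \<in> tate_cohomology K G T n \<and> (\<exists>c. comparison kG triv I \<eta> T \<theta> c \<and>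
        Y = stable_class_map K G T n (\<lambda>z. compose (carrier K) (c n) z) ?S)"
    then obtain c' where c': "comparison kG triv I \<eta> T \<theta> c'"
      and "Y = stable_class_map K G T n (\<lambda>z. compose (carrier K) (c' n) z) ?S" by blast
    then show "Y = ?Y" using stable_class_map_coset[OF cm[OF c'] z] same[OF c'] by simp
  qed
  then show ?thesis using S by (simp add: tate_iota_def)
qed

context
  fixes c :: "int \<Rightarrow> 'i \<Rightarrow> 't"
  assumes c: "comparison kG triv I \<eta> T \<theta> c"
begin

lemma c_chain_map: "chain_map kG I T c"
  using c by (simp add: comparison_def)

text \<open>Elements of the complexes of homomorphisms are extensional, chain maps are not.\<close>

definition comparison_element :: "int \<Rightarrow> 'i \<Rightarrow> 't"
  where "comparison_element = (\<lambda>q. restrict (c q) (carrier (obj I q)))"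

lemma comparison_element_closed: "comparison_element \<in> carrier (H I T 0)"
  unfolding comparison_element_def
  by (rule hom_cochain_restrict[OF resI(1)]) (simp add: chain_map_hom[OF c_chain_map])

lemma comparison_element_cocycle: "D I T 0 comparison_element = \<zero>\<^bsub>H I T 1\<^esub>"
proof (rule hom_cochain_eqI)
  interpret H1: left_module K "H I T 1" by (rule hom_cochain_module[OF resI(1) resT(1)])
  show "\<zero>\<^bsub>H I T 1\<^esub> \<in> carrier (H I T 1)" by simp
  show "D I T 0 comparison_element \<in> carrier (H I T 1)"
    by (rule hom_cochain_diff_closed[OF resI(1) resT(1) comparison_element_closed]) simp
  fix q x assume x: "x \<in> carrier (obj I q)"
  interpret Tq: left_module kG "obj T (q + 1)" by (rule complex_obj[OF resT(1)])
  have dx: "diff I q x \<in> carrier (obj I (q + 1))" by (rule lmod_hom_closed[OF complex_diff[OF resI(1) refl] x])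
  have "c (q + 1) (diff I q x) \<in> carrier (obj T (q + 1))"
    by (rule lmod_hom_closed[OF chain_map_hom[OF c_chain_map] dx])
  then show "D I T 0 comparison_element q x = \<zero>\<^bsub>H I T 1\<^esub> q x"
    using x dx Tq.M.r_neg
    by (simp add: hom_cochain_eval comparison_element_def koszul_def Tq.minus_eq
        chain_map_diff[OF c_chain_map x, symmetric])
qed

lemma comp_comparison_element:
  assumes "x \<in> carrier (obj I q)" shows "hom_comp I 0 \<beta> comparison_element q x = \<beta> q (c q x)"
  using assms by (simp add: hom_comp_eval comparison_element_def)

text \<open>The acyclicity of the homomorphisms from the cone, stated for the elements \<open>(0, \<beta>, \<gamma>)\<close> of the
  triangular algebra, which form the kernel of the projection to \<open>End(I)\<close>.\<close>

lemma kernel_acyclic: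
  assumes \<beta>: "\<beta> \<in> carrier (H T T n)" and \<gamma>: "\<gamma> \<in> carrier (H I T (n - 1))"
    and d\<beta>: "D T T n \<beta> = \<zero>\<^bsub>H T T (n + 1)\<^esub>"
    and d\<gamma>: "hom_comp I 0 \<beta> comparison_element = D I T (n - 1) \<gamma>"
  shows "\<exists>\<beta>'\<in>carrier (H T T (n - 1)). \<exists>\<gamma>'\<in>carrier (H I T (n - 2)). D T T (n - 1) \<beta>' = \<beta> \<and>
    \<gamma> = hom_comp I 0 \<beta>' comparison_element \<ominus>\<^bsub>H I T (n - 1)\<^esub> D I T (n - 2) \<gamma>'"
proof -
  note oT = complex_obj[OF resT(1)]
  have \<beta>h: "\<beta> q \<in> lmod_hom kG (obj T q) (obj T (q + n))" for q by (rule hom_cochain_hom[OF \<beta> refl])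
  have \<gamma>h: "\<gamma> q \<in> lmod_hom kG (obj I q) (obj T (q + n - 1))" for q by (rule hom_cochain_hom[OF \<gamma>]) simp
  have d\<beta>': "diff T (q + n) (\<beta> q t) = koszul (obj T (q + n + 1)) n (\<beta> (q + 1) (diff T q t))"
    if t: "t \<in> carrier (obj T q)" for q t
  proof -
    interpret Tq: left_module kG "obj T (q + n + 1)" by (rule oT)
    have idx: "q + (n + 1) = q + n + 1" by simp
    have "D T T n \<beta> q t = \<zero>\<^bsub>obj T (q + n + 1)\<^esub>" unfolding d\<beta> hom_cochain_eval(2)[OF t] idx ..
    moreover have "diff T (q + n) (\<beta> q t) \<in> carrier (obj T (q + n + 1))"
      by (rule lmod_hom_closed[OF complex_diff[OF resT(1) refl] lmod_hom_closed[OF \<beta>h t]])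
    moreover have "\<beta> (q + 1) (diff T q t) \<in> carrier (obj T (q + n + 1))"
      by (rule hom_cochain_closed[OF \<beta> lmod_hom_closed[OF complex_diff[OF resT(1) refl] t]]) simp
    ultimately show ?thesis
      using Tq.M.minus_eq_zero_iff koszul_closed[OF Tq.M.abelian_group_axioms] by (simp add: hom_cochain_eval(4)[OF t])
  qed
  have d\<gamma>': "\<beta> q (c q a) = diff T (q + n - 1) (\<gamma> q a) \<ominus>\<^bsub>obj T (q + n)\<^esub>
      koszul (obj T (q + n)) (n - 1) (\<gamma> (q + 1) (diff I q a))" if a: "a \<in> carrier (obj I q)" for q a
  proof -
    have idx: "q + (n - 1) = q + n - 1" "q + n - 1 + 1 = q + n" by simp_all
    show ?thesis
      using fun_cong[OF fun_cong[OF d\<gamma>, of q], of a]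
      unfolding comp_comparison_element[OF a] hom_cochain_eval(4)[OF a] idx .
  qed
  from hom_from_cone_acyclic[OF group_algebra_one_neq_zero trivial_module I T c \<beta>h \<gamma>h d\<beta>' d\<gamma>']
  obtain \<beta>' \<gamma>' where \<beta>': "null_homotopy kG T T n \<beta> \<beta>'"
    and \<gamma>': "\<And>q. \<gamma>' q \<in> lmod_hom kG (obj I q) (obj T (q + n - 2))"
    and \<gamma>_eq: "\<And>q a. a \<in> carrier (obj I q) \<Longrightarrow> \<gamma> q a = \<beta>' q (c q a) \<ominus>\<^bsub>obj T (q + n - 1)\<^esub>
      (diff T (q + n - 2) (\<gamma>' q a) \<ominus>\<^bsub>obj T (q + n - 1)\<^esub>
       koszul (obj T (q + n - 1)) n (\<gamma>' (q + 1) (diff I q a)))"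
    by blast
  define B where "B = (\<lambda>q. restrict (\<beta>' q) (carrier (obj T q)))"
  define C where "C = (\<lambda>q. restrict (\<gamma>' q) (carrier (obj I q)))"
  have B: "B \<in> carrier (H T T (n - 1))"
    unfolding B_def by (rule hom_cochain_restrict[OF resT(1)], rule null_homotopy_hom[OF \<beta>']) simp
  have "\<gamma>' q \<in> lmod_hom kG (obj I q) (obj T (q + (n - 2)))" for q using \<gamma>'[of q] by (simp add: add_diff_eq)
  from hom_cochain_restrict[OF resI(1) this] have C: "C \<in> carrier (H I T (n - 2))" unfolding C_def .
  have DB: "D T T (n - 1) B = \<beta>"
  proof (rule hom_cochain_eqI[OF hom_cochain_diff_closed[OF resT(1) resT(1) B] \<beta>])
    fix q t assume t: "t \<in> carrier (obj T q)"
    have dt: "diff T q t \<in> carrier (obj T (q + 1))" by (rule lmod_hom_closed[OF complex_diff[OF resT(1) refl] t])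
    have idx: "q + (n - 1) = q + n - 1" "q + n - 1 + 1 = q + n" by simp_all
    show "D T T (n - 1) B q t = \<beta> q t"
      using null_homotopy_eq[OF \<beta>' t] t dt unfolding hom_cochain_eval(4)[OF t] idx by (simp add: B_def)
  qed simp
  have DC: "D I T (n - 2) C \<in> carrier (H I T (n - 1))"
    by (rule hom_cochain_diff_closed[OF resI(1) resT(1) C]) simp
  have Bc: "hom_comp I 0 B comparison_element \<in> carrier (H I T (n - 1))"
    by (rule hom_comp_closed[OF resI(1) B comparison_element_closed]) simp
  interpret HM: left_module K "H I T (n - 1)" by (rule hom_cochain_module[OF resI(1) resT(1)])
  have "\<gamma> = hom_comp I 0 B comparison_element \<ominus>\<^bsub>H I T (n - 1)\<^esub> D I T (n - 2) C"
  proof (rule hom_cochain_eqI[OF \<gamma> HM.M.minus_closed[OF Bc DC]])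
    fix q a assume a: "a \<in> carrier (obj I q)"
    have da: "diff I q a \<in> carrier (obj I (q + 1))" by (rule lmod_hom_closed[OF complex_diff[OF resI(1) refl] a])
    have ca: "c q a \<in> carrier (obj T q)" by (rule lmod_hom_closed[OF chain_map_hom[OF c_chain_map] a])
    have idx: "q + (n - 1) = q + n - 1" "q + (n - 2) = q + n - 2" "q + n - 2 + 1 = q + n - 1" by simp_all
    have ev: "even (n - 2) \<longleftrightarrow> even n" by simp
    show "\<gamma> q a = (hom_comp I 0 B comparison_element \<ominus>\<^bsub>H I T (n - 1)\<^esub> D I T (n - 2) C) q a"
      unfolding hom_cochain_eval_diff[OF resI(1) resT(1) DC a] comp_comparison_element[OF a]
        hom_cochain_eval(4)[OF a] idx
      using \<gamma>_eq[OF a] a da ca by (simp add: B_def C_def koszul_def ev)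
  qed
  then show ?thesis using B C DB by blast
qed

abbreviation E where "E \<equiv> triangular I T comparison_element"

lemmas E_dga = triangular_dga[OF resI(1) resT(1) comparison_element_closed comparison_element_cocycle]
lemmas E_complex = triangular_complex[OF resI(1) resT(1) comparison_element_closed comparison_element_cocycle]
lemmas E_simps = triangular_simps[OF resI(1) resT(1) comparison_element_closed comparison_element_cocycle]

lemma E_projections:
  "dga_hom K E (End_dga K G I) (\<lambda>n. fst)" "dga_hom K E (End_dga K G T) (\<lambda>n x. fst (snd x))"
proof -
  have "chain_map K E (End_dga K G I) (\<lambda>n. fst)" "chain_map K E (End_dga K G T) (\<lambda>n x. fst (snd x))"
    unfolding chain_map_def E_simps End_dga_eq
    by (auto simp: E_simps fst_hom intro: lmod_hom_comp[OF snd_hom fst_hom])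
  then show "dga_hom K E (End_dga K G I) (\<lambda>n. fst)" "dga_hom K E (End_dga K G T) (\<lambda>n x. fst (snd x))"
    by (auto intro!: dga_hom.intro E_dga End_dga[OF resI(1)] End_dga[OF resT(1)] dga_hom_axioms.intro
        simp: E_simps End_dga_eq) (simp_all add: End_dga_def hom_id_def)
qed

lemma E_carrier:
  "(\<alpha>, \<beta>, \<gamma>) \<in> carrier (obj E n) \<longleftrightarrow>
    \<alpha> \<in> carrier (H I I n) \<and> \<beta> \<in> carrier (H T T n) \<and> \<gamma> \<in> carrier (H I T (n - 1))"
  by (simp add: E_simps)

lemma E_cocycle_iff:
  assumes "(\<alpha>, \<beta>, \<gamma>) \<in> carrier (obj E n)"
  shows "(\<alpha>, \<beta>, \<gamma>) \<in> cocycles E n \<longleftrightarrow> D I I n \<alpha> = \<zero>\<^bsub>H I I (n + 1)\<^esub> \<and> D T T n \<beta> = \<zero>\<^bsub>H T T (n + 1)\<^esub> \<and>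
    hom_comp I 0 \<beta> comparison_element \<ominus>\<^bsub>H I T n\<^esub> hom_comp I n comparison_element \<alpha> = D I T (n - 1) \<gamma>"
proof -
  interpret M: left_module K "H I T n" by (rule hom_cochain_module[OF resI(1) resT(1)])
  have "hom_comp I 0 \<beta> comparison_element \<in> carrier (H I T n)"
    by (rule hom_comp_closed[OF resI(1) _ comparison_element_closed]) (use assms in \<open>simp_all add: E_carrier\<close>)
  moreover have "hom_comp I n comparison_element \<alpha> \<in> carrier (H I T n)"
    by (rule hom_comp_closed[OF resI(1) comparison_element_closed]) (use assms in \<open>simp_all add: E_carrier\<close>)
  moreover have "D I T (n - 1) \<gamma> \<in> carrier (H I T n)"
    by (rule hom_cochain_diff_closed[OF resI(1) resT(1)]) (use assms in \<open>simp_all add: E_carrier\<close>)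
  ultimately show ?thesis
    using assms M.M.minus_eq_zero_iff by (simp add: cocycles_def E_simps)
qed

text \<open>A cocycle \<open>\<alpha>\<close> lifts: \<open>(0, 0, c \<alpha>)\<close> is a cocycle of the kernel, and \<open>(\<alpha>, \<beta>', \<gamma>')\<close> is a cocycle when
  \<open>(0, 0, c \<alpha>)\<close> is the differential of \<open>(0, \<beta>', \<gamma>')\<close>. If \<open>\<alpha> = d \<alpha>\<^sub>0\<close> in a cocycle \<open>(\<alpha>, \<beta>, \<gamma>)\<close>, then
  subtraction of \<open>d (\<alpha>\<^sub>0, 0, 0)\<close> moves it into the kernel.\<close>

lemma projection_quasi_iso: "quasi_iso E (End_dga K G I) (\<lambda>n. fst)"
proof (rule quasi_isoI[OF E_complex End_complex[OF resI(1)]])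
  show "chain_map K E (End_dga K G I) (\<lambda>n. fst)" by (rule dga_hom.chain_map[OF E_projections(1)])
  note IT = resI(1) resT(1)
  interpret M: left_module K "H I T n" for n by (rule hom_cochain_module[OF IT])
  interpret TT: left_module K "H T T n" for n by (rule hom_cochain_module[OF resT(1) resT(1)])
  let ?c = comparison_element
  have D_IT: "D I T (n - 1) \<in> lmod_hom K (H I T (n - 1)) (H I T n)" for n
    by (rule complex_diff[OF hom_cochain_complex[OF IT]]) simp
  have \<beta>c: "hom_comp I 0 \<beta> ?c \<in> carrier (H I T n)" if "\<beta> \<in> carrier (H T T n)" for \<beta> n
    by (rule hom_comp_closed[OF resI(1) that comparison_element_closed]) simp
  have c\<alpha>: "hom_comp I n ?c \<alpha> \<in> carrier (H I T n)" if "\<alpha> \<in> carrier (H I I n)" for \<alpha> n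
    by (rule hom_comp_closed[OF resI(1) comparison_element_closed that]) simp
  have Dc\<alpha>: "D I T n (hom_comp I n ?c \<alpha>) = hom_comp I (n + 1) ?c (D I I n \<alpha>)" if "\<alpha> \<in> carrier (H I I n)" for \<alpha> n
    by (rule D_comp_c_right[OF IT comparison_element_closed comparison_element_cocycle that])
  {
    fix n \<alpha> assume "\<alpha> \<in> cocycles (End_dga K G I) n"
    then have \<alpha>: "\<alpha> \<in> carrier (H I I n)" "D I I n \<alpha> = \<zero>\<^bsub>H I I (n + 1)\<^esub>" by (simp_all add: cocycles_def End_dga_eq)
    have "hom_comp I (n + 1) ?c \<zero>\<^bsub>H I I (n + 1)\<^esub> = \<zero>\<^bsub>H I T (n + 1)\<^esub>"
      by (rule lmod_hom_zero[OF hom_comp_hom_right[OF resI(1) resI(1) resT(1) comparison_element_closed]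
            hom_cochain_module[OF resI(1) resI(1)] hom_cochain_module[OF IT]]) simp
    moreover have "hom_comp I 0 \<zero>\<^bsub>H T T (n + 1)\<^esub> ?c = \<zero>\<^bsub>H I T (n + 1)\<^esub>"
      by (rule lmod_hom_zero[OF hom_comp_hom_left[OF resI(1) resT(1) resT(1) comparison_element_closed]
            hom_cochain_module[OF resT(1) resT(1)] hom_cochain_module[OF IT]]) simp
    ultimately have "hom_comp I 0 \<zero>\<^bsub>H T T (n + 1)\<^esub> ?c = D I T (n + 1 - 1) (hom_comp I n ?c \<alpha>)"
      by (simp add: Dc\<alpha>[OF \<alpha>(1)] \<alpha>(2))
    moreover have "D T T (n + 1) \<zero>\<^bsub>H T T (n + 1)\<^esub> = \<zero>\<^bsub>H T T (n + 1 + 1)\<^esub>"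
      by (rule lmod_hom_zero[OF complex_diff[OF hom_cochain_complex[OF resT(1) resT(1)] refl] TT.left_module_axioms TT.left_module_axioms])
    moreover have "hom_comp I n ?c \<alpha> \<in> carrier (H I T (n + 1 - 1))" using c\<alpha>[OF \<alpha>(1)] by simp
    ultimately obtain \<beta>' \<gamma>' where \<beta>': "\<beta>' \<in> carrier (H T T (n + 1 - 1))" and \<gamma>': "\<gamma>' \<in> carrier (H I T (n + 1 - 2))"
      and eq: "D T T (n + 1 - 1) \<beta>' = \<zero>\<^bsub>H T T (n + 1)\<^esub>"
      "hom_comp I n ?c \<alpha> = hom_comp I 0 \<beta>' ?c \<ominus>\<^bsub>H I T (n + 1 - 1)\<^esub> D I T (n + 1 - 2) \<gamma>'"
      using kernel_acyclic[OF TT.M.zero_closed] by blast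
    have idx: "n + 1 - 1 = n" "n + 1 - 2 = n - 1" by simp_all
    note \<beta>' = \<beta>'[unfolded idx] and \<gamma>' = \<gamma>'[unfolded idx] and eq = eq[unfolded idx]
    have D\<gamma>': "D I T (n - 1) \<gamma>' \<in> carrier (H I T n)" by (rule lmod_hom_closed[OF D_IT \<gamma>'])
    have "hom_comp I 0 \<beta>' ?c \<ominus>\<^bsub>H I T n\<^esub> hom_comp I n ?c \<alpha> = D I T (n - 1) \<gamma>'"
      using \<beta>c[OF \<beta>'] D\<gamma>' by (simp add: eq(2) M.minus_eq M.minus_add M.a_assoc[symmetric] M.r_neg)
    then have "(\<alpha>, \<beta>', \<gamma>') \<in> cocycles E n"
      using \<alpha> \<beta>' \<gamma>' eq(1) by (simp add: E_cocycle_iff E_carrier)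
    then show "\<exists>x\<in>cocycles E n. fst x = \<alpha>" by force
  next
    fix n x assume x: "x \<in> cocycles E n" and "fst x \<in> coboundaries (End_dga K G I) n"
    then obtain \<alpha>0 where \<alpha>0: "\<alpha>0 \<in> carrier (H I I (n - 1))" "fst x = D I I (n - 1) \<alpha>0"
      by (auto simp: coboundaries_def End_dga_eq)
    obtain \<alpha> \<beta> \<gamma> where x_eq: "x = (\<alpha>, \<beta>, \<gamma>)" by (cases x)
    have "(\<alpha>, \<beta>, \<gamma>) \<in> carrier (obj E n)" using x by (simp add: cocycles_def x_eq)
    then have mem: "\<alpha> \<in> carrier (H I I n)" "\<beta> \<in> carrier (H T T n)" "\<gamma> \<in> carrier (H I T (n - 1))"
      and coc: "D T T n \<beta> = \<zero>\<^bsub>H T T (n + 1)\<^esub>"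
        "hom_comp I 0 \<beta> ?c \<ominus>\<^bsub>H I T n\<^esub> hom_comp I n ?c \<alpha> = D I T (n - 1) \<gamma>"
      using x by (auto simp: E_carrier E_cocycle_iff x_eq)
    let ?c\<alpha>0 = "hom_comp I (n - 1) ?c \<alpha>0"
    have c\<alpha>0: "?c\<alpha>0 \<in> carrier (H I T (n - 1))" by (rule c\<alpha>[OF \<alpha>0(1)])
    have "D I T (n - 1) ?c\<alpha>0 = hom_comp I n ?c \<alpha>" using Dc\<alpha>[OF \<alpha>0(1)] \<alpha>0(2) by (simp add: x_eq)
    then have "D I T (n - 1) (\<gamma> \<oplus>\<^bsub>H I T (n - 1)\<^esub> ?c\<alpha>0) = hom_comp I 0 \<beta> ?c"
      using lmod_hom_add[OF D_IT mem(3) c\<alpha>0] \<beta>c[OF mem(2)] c\<alpha>[OF mem(1)]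
      by (simp add: coc(2)[symmetric] M.minus_eq M.a_assoc M.l_neg)
    then obtain \<beta>' \<gamma>' where \<beta>': "\<beta>' \<in> carrier (H T T (n - 1))" and \<gamma>': "\<gamma>' \<in> carrier (H I T (n - 2))"
      and eq: "D T T (n - 1) \<beta>' = \<beta>"
      "\<gamma> \<oplus>\<^bsub>H I T (n - 1)\<^esub> ?c\<alpha>0 = hom_comp I 0 \<beta>' ?c \<ominus>\<^bsub>H I T (n - 1)\<^esub> D I T (n - 2) \<gamma>'"
      using kernel_acyclic[OF mem(2) M.a_closed[OF mem(3) c\<alpha>0] coc(1)] by metis
    have D\<gamma>': "D I T (n - 2) \<gamma>' \<in> carrier (H I T (n - 1))"
      by (rule hom_cochain_diff_closed[OF IT \<gamma>']) simp
    have idx: "n - 1 - 1 = n - 2" by simp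
    have "\<gamma> = (hom_comp I 0 \<beta>' ?c \<ominus>\<^bsub>H I T (n - 1)\<^esub> D I T (n - 2) \<gamma>') \<ominus>\<^bsub>H I T (n - 1)\<^esub> ?c\<alpha>0"
    proof -
      have "\<gamma> = (\<gamma> \<oplus>\<^bsub>H I T (n - 1)\<^esub> ?c\<alpha>0) \<ominus>\<^bsub>H I T (n - 1)\<^esub> ?c\<alpha>0"
        using mem(3) c\<alpha>0 by (simp add: M.minus_eq M.a_assoc M.r_neg)
      then show ?thesis by (simp only: eq(2))
    qed
    also have "\<dots> = (hom_comp I 0 \<beta>' ?c \<ominus>\<^bsub>H I T (n - 1)\<^esub> ?c\<alpha>0) \<ominus>\<^bsub>H I T (n - 1)\<^esub> D I T (n - 2) \<gamma>'"
      using \<beta>c[OF \<beta>'] D\<gamma>' c\<alpha>0 by (simp add: M.minus_eq M.a_ac)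
    finally have "x = diff E (n - 1) (\<alpha>0, \<beta>', \<gamma>')"
      using \<alpha>0(2) eq(1) by (simp add: x_eq E_simps idx)
    moreover have "(\<alpha>0, \<beta>', \<gamma>') \<in> carrier (obj E (n - 1))"
      using \<alpha>0(1) \<beta>' \<gamma>' by (simp add: E_carrier idx)
    ultimately show "x \<in> coboundaries E n" by (auto simp: coboundaries_def)
  }
qed

text \<open>On \<open>\<eta> x\<close> the cocycle condition \<open>\<beta> c - c \<alpha> = d \<gamma>\<close> becomes \<open>\<beta> (\<theta> x) - c (\<alpha> (\<eta> x)) = d (\<gamma> (\<eta> x))\<close>, since
  \<open>\<gamma> d\<close> vanishes there. So both sides are represented by maps that differ by one factoring through
  a projective module.\<close>

lemma projections_induce_iota:
  assumes S: "S \<in> cohomology E n"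
  shows "ident_tate K G T \<theta> n (cohomology_map (End_dga K G T) (\<lambda>n x. fst (snd x)) n S) =
    tate_iota K G I \<eta> T \<theta> n (ident_ext K G I \<eta> n (cohomology_map (End_dga K G I) (\<lambda>n. fst) n S))"
proof -
  obtain x where x: "x \<in> cocycles E n" "S = coboundaries E n +>\<^bsub>obj E n\<^esub> x" using S by (rule cohomologyE)
  obtain \<alpha> \<beta> \<gamma> where x_eq: "x = (\<alpha>, \<beta>, \<gamma>)" by (cases x)
  have "(\<alpha>, \<beta>, \<gamma>) \<in> carrier (obj E n)" using x by (simp add: cocycles_def x_eq)
  then have mem: "\<alpha> \<in> carrier (H I I n)" "\<beta> \<in> carrier (H T T n)" "\<gamma> \<in> carrier (H I T (n - 1))"
    and coc: "hom_comp I 0 \<beta> comparison_element \<ominus>\<^bsub>H I T n\<^esub> hom_comp I n comparison_element \<alpha> = D I T (n - 1) \<gamma>"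
    using x by (auto simp: E_carrier E_cocycle_iff x_eq)
  note cm = dga_hom.chain_map[OF E_projections(1)] dga_hom.chain_map[OF E_projections(2)]
  have \<alpha>: "\<alpha> \<in> cocycles (End_dga K G I) n" and \<beta>: "\<beta> \<in> cocycles (End_dga K G T) n"
    using chain_map_cocycle[OF E_complex End_complex[OF resI(1)] cm(1) x(1)]
      chain_map_cocycle[OF E_complex End_complex[OF resT(1)] cm(2) x(1)] by (simp_all add: x_eq)
  let ?z = "compose (carrier K) (\<alpha> 0) \<eta>"
  have lhs: "ident_tate K G T \<theta> n (cohomology_map (End_dga K G T) (\<lambda>n x. fst (snd x)) n S) =
      PH n +>\<^bsub>Hk n\<^esub> compose (carrier K) (\<beta> 0) \<theta>"
    using cohomology_map_coset[OF E_complex End_complex[OF resT(1)] cm(2) x(1)] ident_tate_coset[OF \<beta>]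
    by (simp add: x(2) x_eq)
  have rhs: "tate_iota K G I \<eta> T \<theta> n (ident_ext K G I \<eta> n (cohomology_map (End_dga K G I) (\<lambda>n. fst) n S)) =
      PH n +>\<^bsub>Hk n\<^esub> compose (carrier K) (c n) ?z"
    using cohomology_map_coset[OF E_complex End_complex[OF resI(1)] cm(1) x(1)] ident_ext_coset[OF \<alpha>]
      tate_iota_coset[OF c ext_class_cocycle[OF \<alpha>]]
    by (simp add: x(2) x_eq)
  have cz: "compose (carrier K) (c n) ?z \<in> carrier (Hk n)"
    by (rule transported_class_closed[OF c_chain_map ext_class_cocycle[OF \<alpha>]])
  have \<gamma>\<eta>: "(\<lambda>x. \<gamma> 0 (\<eta> x)) \<in> lmod_hom kG triv (obj T (n - 1))"
    by (rule lmod_hom_comp[OF resI(3) hom_cochain_hom[OF mem(3)]]) simp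
  have "\<exists>p\<in>PH n. compose (carrier K) (\<beta> 0) \<theta> = p \<oplus>\<^bsub>Hk n\<^esub> compose (carrier K) (c n) ?z"
  proof (rule stably_equal[OF cz _ \<gamma>\<eta>])
    fix x assume x: "x \<in> carrier K"
    interpret Tn: left_module kG "obj T n" by (rule complex_obj[OF resT(1)])
    have \<eta>x: "\<eta> x \<in> carrier (obj I 0)" "diff I 0 (\<eta> x) = \<zero>\<^bsub>obj I 1\<^esub>"
      using \<eta>_cocycle[OF x] by (auto simp: cocycles_def)
    have c\<eta>: "c 0 (\<eta> x) = \<theta> x" using c x by (simp add: comparison_def trivial_carrier)
    have c\<alpha>: "hom_comp I n comparison_element \<alpha> \<in> carrier (H I T n)"
      by (rule hom_comp_closed[OF resI(1) comparison_element_closed mem(1)]) simp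
    have \<alpha>x: "\<alpha> 0 (\<eta> x) \<in> carrier (obj I n)" by (rule hom_cochain_closed[OF mem(1) \<eta>x(1)]) simp
    have \<beta>x: "\<beta> 0 (\<theta> x) \<in> carrier (obj T n)"
      using \<theta>_cocycle[OF x] by (intro hom_cochain_closed[OF mem(2)]) (simp_all add: cocycles_def)
    have c\<alpha>x: "c n (\<alpha> 0 (\<eta> x)) \<in> carrier (obj T n)" by (rule lmod_hom_closed[OF chain_map_hom[OF c_chain_map] \<alpha>x])
    have z: "\<gamma> 1 \<zero>\<^bsub>obj I 1\<^esub> = \<zero>\<^bsub>obj T n\<^esub>"
      by (rule lmod_hom_zero[OF hom_cochain_hom[OF mem(3)] complex_obj[OF resI(1)] complex_obj[OF resT(1)]]) simp
    have dcl: "diff T (n - 1) (\<gamma> 0 (\<eta> x)) \<in> carrier (obj T n)"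
      by (rule lmod_hom_closed[OF complex_diff[OF resT(1)] hom_cochain_closed[OF mem(3) \<eta>x(1)]]) simp_all
    have "(hom_comp I 0 \<beta> comparison_element \<ominus>\<^bsub>H I T n\<^esub> hom_comp I n comparison_element \<alpha>) 0 (\<eta> x) =
        \<beta> 0 (\<theta> x) \<ominus>\<^bsub>obj T n\<^esub> c n (\<alpha> 0 (\<eta> x))"
      using \<alpha>x by (simp add: hom_cochain_eval_diff[OF resI(1) resT(1) c\<alpha> \<eta>x(1)] comp_comparison_element[OF \<eta>x(1)]
          hom_comp_eval[OF \<eta>x(1)] c\<eta>) (simp add: comparison_element_def \<eta>x c\<eta>)
    moreover have "D I T (n - 1) \<gamma> 0 (\<eta> x) = diff T (n - 1) (\<gamma> 0 (\<eta> x))"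
      using dcl by (simp add: hom_cochain_eval(4)[OF \<eta>x(1)] \<eta>x(2) z koszul_zero[OF Tn.M.abelian_group_axioms] Tn.minus_eq)
    ultimately have "diff T (n - 1) (\<gamma> 0 (\<eta> x)) = \<beta> 0 (\<theta> x) \<ominus>\<^bsub>obj T n\<^esub> c n (\<alpha> 0 (\<eta> x))"
      using coc by simp
    then show "compose (carrier K) (\<beta> 0) \<theta> x =
        diff T (n - 1) (\<gamma> 0 (\<eta> x)) \<oplus>\<^bsub>obj T n\<^esub> compose (carrier K) (c n) ?z x"
      using x \<beta>x c\<alpha>x by (simp add: compose_def Tn.minus_eq Tn.a_assoc Tn.l_neg)
  qed (simp add: compose_def)
  then show ?thesis
    unfolding lhs rhs using coset_eqI[OF Hk_module PH_submod cz] by blast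
qed

lemma zigzag:
  "\<exists>(E :: ('k, (int \<Rightarrow> 'i \<Rightarrow> 'i) \<times> (int \<Rightarrow> 't \<Rightarrow> 't) \<times> (int \<Rightarrow> 'i \<Rightarrow> 't)) dga) \<rho> \<phi>.
    dg_algebra K E \<and>
    dga_hom K E (End_dga K G I) \<rho> \<and> quasi_iso E (End_dga K G I) \<rho> \<and>
    dga_hom K E (End_dga K G T) \<phi> \<and>
    (\<forall>n. \<forall>S\<in>cohomology E n.
       ident_tate K G T \<theta> n (cohomology_map (End_dga K G T) \<phi> n S) =
       tate_iota K G I \<eta> T \<theta> n (ident_ext K G I \<eta> n (cohomology_map (End_dga K G I) \<rho> n S)))"
  by (intro exI[of _ E] exI[of _ "\<lambda>n. fst"] exI[of _ "\<lambda>n x. fst (snd x)"] conjI allI ballI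
      E_dga E_projections projection_quasi_iso projections_induce_iota)

end

end

end

theorem theorem13p18:
  fixes G :: "('g, 'b) monoid_scheme" and K :: "('k, 'c) ring_scheme"
    and I :: "('g \<Rightarrow> 'k, 'i) cochain" and \<eta> :: "'k \<Rightarrow> 'i"
    and T :: "('g \<Rightarrow> 'k, 't) cochain" and \<theta> :: "'k \<Rightarrow> 't"
  assumes "group G" and "finite (carrier G)" and "field K"
    and "injective_resolution (group_algebra K G) (trivial_module K G) I \<eta>"
    and "tate_resolution (group_algebra K G) (trivial_module K G) T \<theta>"
  shows "\<exists>(E :: ('k, (int \<Rightarrow> 'i \<Rightarrow> 'i) \<times> (int \<Rightarrow> 't \<Rightarrow> 't) \<times> (int \<Rightarrow> 'i \<Rightarrow> 't)) dga) \<rho> \<phi>.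
    dg_algebra K E \<and>
    dga_hom K E (End_dga K G I) \<rho> \<and> quasi_iso E (End_dga K G I) \<rho> \<and>
    dga_hom K E (End_dga K G T) \<phi> \<and>
    (\<forall>n. \<forall>S\<in>cohomology E n.
       ident_tate K G T \<theta> n (cohomology_map (End_dga K G T) \<phi> n S) =
       tate_iota K G I \<eta> T \<theta> n (ident_ext K G I \<eta> n (cohomology_map (End_dga K G I) \<rho> n S)))"
proof -
  interpret finite_group_over_field G K using assms(1-3) by (rule finite_group_over_field.intro)
  obtain c where "comparison kG (trivial_module K G) I \<eta> T \<theta> c"
    using comparison_exists[OF trivial_module assms(4,5)] by blast
  from zigzag[OF assms(4,5) this] show ?thesis .
qed

end
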